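(* Let $\mathcal M:(0,1)\to(0,\infty)$ be a majorant that does not increase on $(0,1)$ and satisfies: (1) $\int_0\log\log\mathcal M(\xi)\,d\xi<\infty$ (convergence of the integral at $0$); (2) $\lim_{\xi\to0}\xi^N\mathcal M(\xi)=\infty$ for each $N<\infty$; (3) the functions $s\mapsto\log\mathcal M(e^{-s})$ and $\xi\mapsto\log\mathcal M(\xi)$ are convex. Then, as $s\to0$ ($s>0$), $$\log\mathcal M^*(s)=(1+o(1))\,Q(s).$$
   Context: Let $S=\{\zeta=\xi+i\eta:|\xi|<1,\ |\eta|<1\}$ and $S^*=S\setminus\{0\}$. The exact majorant is $$\mathcal M^*(s)=\sup_F\ \max_{|\zeta|=s}|F(\zeta)|,$$ the supremum being taken over all functions $F$ analytic in $S^*$ with $|F(\zeta)|\le\mathcal M(|\xi|)$ for all $\zeta=\xi+i\eta\in S^*$ with $\xi\ne0$. Define $$\varphi(r)=\inf_{\xi>0}\left[\log\mathcal M(\xi)+r\xi\right],\qquad r\ge0,$$ where $\mathcal M(\xi)=\mathcal M(1-0)$ for $\xi\ge1$, and, for $s>0$, $$Q(s)=\sup_{y>0}\left[\frac{2y}{\pi}\int_0^\infty\frac{\varphi(t)\,dt}{t^2+y^2}-ys\right].$$ *)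

theory Defs
  imports "HOL-Complex_Analysis.Complex_Analysis" "HOL-Library.Landau_Symbols"
begin

definition unit_square :: "complex set" where
  "unit_square = {\<zeta>. \<bar>Re \<zeta>\<bar> < 1 \<and> \<bar>Im \<zeta>\<bar> < 1}"

definition punctured_square :: "complex set" where
  "punctured_square = unit_square - {0}"

definition majorized :: "(real \<Rightarrow> real) \<Rightarrow> (complex \<Rightarrow> complex) set" where
  "majorized M = {F. F analytic_on punctured_square \<and>
     (\<forall>\<zeta>\<in>punctured_square. Re \<zeta> \<noteq> 0 \<longrightarrow> cmod (F \<zeta>) \<le> M \<bar>Re \<zeta>\<bar>)}"

text \<open>The supremum is taken in the extended reals, so that its finiteness is a genuine assertion.
  Only \<open>0 < s < 1\<close> is meaningful: then the circle of radius \<open>s\<close> lies in the punctured square.\<close>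

definition exact_majorant :: "(real \<Rightarrow> real) \<Rightarrow> real \<Rightarrow> ereal" where
  "exact_majorant M s = (SUP F\<in>majorized M. SUP \<zeta>\<in>sphere 0 s. ereal (cmod (F \<zeta>)))"

text \<open>Convergence at \<open>0\<close> only concerns a right neighbourhood of \<open>0\<close>; it is chosen so small that
  \<open>ln (ln (M \<xi>))\<close> is meaningful there.\<close>

definition loglog_integrable_at_0 :: "(real \<Rightarrow> real) \<Rightarrow> bool" where
  "loglog_integrable_at_0 M \<longleftrightarrow>
     (\<exists>\<delta>\<in>{0<..<1}. (\<forall>\<xi>\<in>{0<..<\<delta>}. 1 < M \<xi>) \<and>
        set_integrable lborel {0<..<\<delta>} (\<lambda>\<xi>. ln (ln (M \<xi>))))"

definition extend_majorant :: "(real \<Rightarrow> real) \<Rightarrow> real \<Rightarrow> real" where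
  "extend_majorant M \<xi> = (if \<xi> < 1 then M \<xi> else Lim (at_left 1) M)"

definition phi :: "(real \<Rightarrow> real) \<Rightarrow> real \<Rightarrow> real" where
  "phi M r = (INF \<xi>\<in>{0<..}. ln (extend_majorant M \<xi>) + r * \<xi>)"

definition Q :: "(real \<Rightarrow> real) \<Rightarrow> real \<Rightarrow> ereal" where
  "Q M s = (SUP y\<in>{0<..}.
     ereal (2 * y / pi * (LBINT t:{0..}. phi M t / (t\<^sup>2 + y\<^sup>2)) - y * s))"

end

theory Submission
  imports Defs "HOL-Real_Asymp.Real_Asymp" "HOL-Computational_Algebra.Fundamental_Theorem_Algebra"
begin

text \<open>
  By (3), \<open>\<phi>(t)\<close> is convex in \<open>log t\<close>. Let \<open>U\<close> be the Poisson extension of \<open>\<phi>(\<bar>t\<bar>)\<close> to the upper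
  half-plane, so that \<open>Q(s) = sup (U(\<i>y) - ys)\<close>. Convexity in \<open>log t\<close> gives
  \<open>\<phi>(\<bar>z\<bar>) \<le> U(z) \<le> U(\<i>\<bar>z\<bar>)\<close>.

  Upper bound: the principal part of \<open>F\<close> at \<open>0\<close> is the Laplace transform of an entire function \<open>f\<close> of
  exponential type zero. Integration over thin rectangles, with Levinson's theorem on their short sides, gives
  \<open>log \<bar>f(t)\<bar> \<le> \<phi>(\<bar>t\<bar>) + O(1)\<close> on the real line, hence \<open>log \<bar>f(z)\<bar> \<le> U(\<i>\<bar>z\<bar>) + O(1)\<close> by Phragmen and
  Lindelof. Along the ray on which \<open>z\<zeta>\<close> is positive, the Laplace integral for \<open>\<bar>\<zeta>\<bar> = s\<close> is then at most
  \<open>\<integral> exp (U(\<i>y) - ys + O(1)) dy\<close>, which exceeds \<open>exp Q(s)\<close> by a factor that is negligible because (2) forces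
  \<open>\<phi>\<close> to grow faster than the logarithm.

  Lower bound: since \<open>\<phi>\<close> is convex in \<open>log t\<close>, up to powers of \<open>t\<close> the function \<open>exp \<phi>(t)\<close> is the maximal term of a
  power series in \<open>t\<^sup>2\<close> with positive coefficients, hence close to a polynomial \<open>R(t\<^sup>2)\<close> on a long interval.
  Replacing the zeros of \<open>R(z\<^sup>2)\<close> in the upper half-plane by their conjugates gives a polynomial with the same
  modulus on the real line, whose logarithm at \<open>\<i>y\<close> is its Poisson integral, that is, close to \<open>U(\<i>y)\<close>. The Laplace
  transform of this polynomial is nearly extremal.
\<close>

section \<open>Maximum principles on unbounded domains\<close>

text \<open>The obstacle is that \<open>M\<close> says nothing on the imaginary axis, which every
  circle around 0 crosses. Both bounds therefore pass through an entire function on the real line,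
  where the infimum over \<xi> turns \<open>ln M\<close> into \<open>phi\<close>. Condition (1) acts
  only through the summable widths of the strips where \<open>ln M\<close> is large: once for the
  integrability of \<open>phi M t / (1 + t^2)\<close>, once for a bound near the imaginary axis away
  from 0. Of the two estimates that convexity in log t provides, the lower one lets the division by
  the outer function take place on Im v = 1 instead of the real line; the upper one depends on the
  modulus alone, so the Laplace ray may turn with \<zeta>. The losses are ln Y above and 6 ln (1 +
  y) below, where U(iY) = sY and y nearly maximises U(iy) - ys; testing the Legendre transform at
  the square root of such a point shows that both are o(Q). In the code the half-plane is turned to
  Re w > 0 by z = i w, so that the positive imaginary axis becomes the positive real axis, where
  \<open>outer\<close> is real.\<close>

lemma maximum_modulus_closed:
  assumes hol: "H holomorphic_on S" and S: "closed S" "bounded S" and U: "open U" "U \<subseteq> S"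
    and le: "\<And>u. u \<in> S \<Longrightarrow> u \<notin> U \<Longrightarrow> cmod (H u) \<le> B" and z: "z \<in> S"
  shows "cmod (H z) \<le> B"
proof (rule maximum_modulus_frontier[OF _ _ S(2) _ z])
  show "H holomorphic_on interior S" by (rule holomorphic_on_subset[OF hol interior_subset])
  show "continuous_on (closure S) H" using S(1) holomorphic_on_imp_continuous_on[OF hol] by simp
  fix u assume "u \<in> frontier S"
  then have "u \<in> S" "u \<notin> U" using S(1) U interior_maximal[of U S] by (auto simp: frontier_def)
  then show "cmod (H u) \<le> B" by (rule le)
qed

lemma Re_two_width_kernel:
  fixes w :: real and q :: complex
  assumes "w > 0" "Re q \<ge> 0"
  shows "Re (of_real (2*w) / (of_real w + q)) = 2*w*(w + Re q) / ((w + Re q)\<^sup>2 + (Im q)\<^sup>2)"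
  using assms by (simp add: Re_divide power2_eq_square)

text \<open>A two-constants theorem with an explicit majorant in place of harmonic measure. For each
  horizontal side, \<open>q\<close> is the coordinate that sends the side into the imaginary axis
  and the rectangle into Re q \<ge> 0. There Re (2w / (w + q)) is nonnegative, at least 1 on the
  axis where |q| \<le> w, and at most 2w/r where Re q = r. The two kernels thus cancel
  \<open>exp B\<close> on the middle part of the horizontal sides and cost only
  \<open>B * (4 * w / r)\<close> on the middle line.\<close>

lemma two_constants_rectangle:
  fixes F :: "complex \<Rightarrow> complex"
  assumes hol: "F holomorphic_on T" and T: "open T" 
    and R: "\<And>z. \<bar>Re z\<bar> \<le> \<rho> \<Longrightarrow> \<bar>Im z - \<eta>\<bar> \<le> r \<Longrightarrow> z \<in> T"
    and pos: "0 < w" "w \<le> \<rho>" "0 < r" "0 \<le> A" "0 \<le> B"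
    and bA: "\<And>z. w \<le> \<bar>Re z\<bar> \<Longrightarrow> \<bar>Re z\<bar> \<le> \<rho> \<Longrightarrow> \<bar>Im z - \<eta>\<bar> \<le> r \<Longrightarrow> cmod (F z) \<le> exp A"
    and bB: "\<And>z. \<bar>Re z\<bar> \<le> \<rho> \<Longrightarrow> \<bar>Im z - \<eta>\<bar> \<le> r \<Longrightarrow> cmod (F z) \<le> exp B"
    and z: "\<bar>Re z\<bar> \<le> \<rho>" "Im z = \<eta>"
  shows "cmod (F z) \<le> exp (A + B * (4 * w / r))"
proof -
  define S where "S = {z. \<bar>Re z\<bar> \<le> \<rho> \<and> \<bar>Im z - \<eta>\<bar> \<le> r}"
  define q1 where "q1 = (\<lambda>z. \<i> * (z - \<i> * of_real (\<eta> + r)))"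
  define q2 where "q2 = (\<lambda>z. - \<i> * (z - \<i> * of_real (\<eta> - r)))"
  define k where "k = (\<lambda>q::complex. of_real (2*w) / (of_real w + q))"
  define G where "G = (\<lambda>z. F z * exp (- of_real B * (k (q1 z) + k (q2 z))))"
  have S_alt: "S = cbox (Complex (-\<rho>) (\<eta> - r)) (Complex \<rho> (\<eta> + r))"
    by (auto simp: S_def in_cbox_complex_iff)
  have Scl: "closed S" "bounded S" unfolding S_alt by (rule closed_cbox, rule bounded_cbox)
  have Re1: "Re (q1 z) = \<eta> + r - Im z" "Im (q1 z) = Re z" for z by (simp_all add: q1_def)
  have Re2: "Re (q2 z) = Im z - (\<eta> - r)" "Im (q2 z) = - Re z" for z by (simp_all add: q2_def)
  have q0: "Re (q1 z) \<ge> 0" "Re (q2 z) \<ge> 0" if "z \<in> S" for z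
    using that by (auto simp: Re1 Re2 S_def)
  have k0: "Re (k q) \<ge> 0" if "Re q \<ge> 0" for q
    unfolding k_def Re_two_width_kernel[OF pos(1) that] using that pos by simp
  have k1: "Re (k q) \<ge> 1" if "Re q = 0" "\<bar>Im q\<bar> \<le> w" for q
  proof -
    have "(Im q)\<^sup>2 \<le> w\<^sup>2" using that(2) pos by (metis abs_le_square_iff abs_of_pos)
    moreover have "w\<^sup>2 + (Im q)\<^sup>2 > 0" using pos by (simp add: add_pos_nonneg)
    ultimately show ?thesis
      unfolding k_def Re_two_width_kernel[OF pos(1) eq_refl[OF that(1)[symmetric]]] 
      using that(1) by (simp add: divide_simps power2_eq_square)
  qed
  have k2: "Re (k q) \<le> 2 * w / r" if "Re q = r" for q
  proof -
    have "Re (k q) = 2*w*(w + r) / ((w + r)\<^sup>2 + (Im q)\<^sup>2)"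
      unfolding k_def using Re_two_width_kernel[OF pos(1), of q] that pos by simp
    also have "\<dots> \<le> 2*w*(w + r) / ((w + r)\<^sup>2)"
      using pos by (intro divide_left_mono mult_pos_pos add_pos_nonneg) auto
    also have "\<dots> = 2*w/(w+r)" using pos by (simp add: power2_eq_square)
    also have "\<dots> \<le> 2*w/r" using pos by (intro divide_left_mono) auto
    finally show ?thesis .
  qed
  have nz: "of_real w + q1 z \<noteq> 0" "of_real w + q2 z \<noteq> 0" if "z \<in> S" for z
  proof -
    have "Re (of_real w + q1 z) > 0" "Re (of_real w + q2 z) > 0" using q0[OF that] pos by simp_all
    then show "of_real w + q1 z \<noteq> 0" "of_real w + q2 z \<noteq> 0" by (metis less_irrefl zero_complex.simps(1))+
  qed
  have hG: "G holomorphic_on S"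
    unfolding G_def k_def q1_def q2_def
    by (intro holomorphic_intros holomorphic_on_subset[OF hol])
       (use R nz in \<open>auto simp: q1_def q2_def S_def\<close>)
  have nG: "cmod (G z) = cmod (F z) * exp (- B * (Re (k (q1 z)) + Re (k (q2 z))))" for z
    by (simp add: G_def norm_mult)
  have fr: "cmod (G z) \<le> exp A" if zS: "z \<in> S" and zU: "z \<notin> box (Complex (-\<rho>) (\<eta> - r)) (Complex \<rho> (\<eta> + r))" for z
  proof -
    have nn: "Re (k (q1 z)) \<ge> 0" "Re (k (q2 z)) \<ge> 0" using q0[OF zS] k0 by auto
    show ?thesis
    proof (cases "w \<le> \<bar>Re z\<bar>")
      case True
      have "cmod (F z) * exp (- B * (Re (k (q1 z)) + Re (k (q2 z)))) \<le> exp A * 1"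
        using bA[OF True] zS nn pos by (intro mult_mono) (auto simp: S_def)
      then show ?thesis by (simp add: nG)
    next
      case False
      have "Im z = \<eta> + r \<or> Im z = \<eta> - r"
        using zS zU False pos by (auto simp: in_box_complex_iff S_def abs_le_iff abs_less_iff)
      then have "Re (k (q1 z)) \<ge> 1 \<or> Re (k (q2 z)) \<ge> 1"
        using k1[of "q1 z"] k1[of "q2 z"] False by (auto simp: Re1 Re2)
      then have "Re (k (q1 z)) + Re (k (q2 z)) \<ge> 1" using nn by auto
      then have "- B * (Re (k (q1 z)) + Re (k (q2 z))) \<le> - B"
        using pos by (simp add: mult_le_cancel_left1)
      then have "cmod (F z) * exp (- B * (Re (k (q1 z)) + Re (k (q2 z)))) \<le> exp B * exp (-B)"
        using bB zS by (intro mult_mono) (auto simp: S_def)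
      also have "\<dots> \<le> exp A" using pos by (simp add: exp_minus)
      finally show ?thesis by (simp add: nG)
    qed
  qed
  have zS: "z \<in> S" using z pos by (auto simp: S_def)
  have "cmod (G z) \<le> exp A"
    by (rule maximum_modulus_closed[OF hG Scl open_box _ fr zS]) (auto simp: S_alt box_subset_cbox)
  then have "cmod (F z) \<le> exp A / exp (- B * (Re (k (q1 z)) + Re (k (q2 z))))"
    by (simp add: nG pos_le_divide_eq)
  also have "\<dots> = exp (A + B * (Re (k (q1 z)) + Re (k (q2 z))))"
    by (simp add: exp_diff[symmetric])
  also have "\<dots> \<le> exp (A + B * (4 * w / r))"
  proof -
    have "Re (k (q1 z)) + Re (k (q2 z)) \<le> 4 * w / r"
      using k2[of "q1 z"] k2[of "q2 z"] z by (simp add: Re1 Re2)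
    then show ?thesis using pos by (simp add: mult_left_mono del: times_divide_eq_right)
  qed
  finally show ?thesis .
qed

text \<open>The opening is pi/2, so growth of order below 2 is admissible. The multiplier exp (-
  \<delta> (z + 1)^(3/2)) has an exponent between 1 and 2: it beats \<open>exp (a * cmod z)\<close>,
  while the argument of the power stays within 3 pi / 8 and its real part stays positive. The shift
  by 1 keeps the closed sector off the branch cut.\<close>

lemma phragmen_lindelof_sector:
  fixes G :: "complex \<Rightarrow> complex"
  assumes hol: "G holomorphic_on T" and T: "\<And>z. \<bar>Im z\<bar> \<le> Re z \<Longrightarrow> z \<in> T"
    and gr: "\<And>z. \<bar>Im z\<bar> \<le> Re z \<Longrightarrow> cmod (G z) \<le> K * exp (a * cmod z)"
    and bd: "\<And>z. \<bar>Im z\<bar> = Re z \<Longrightarrow> cmod (G z) \<le> B"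
    and z: "\<bar>Im z\<bar> \<le> Re z"
  shows "cmod (G z) \<le> B"
proof -
  define c where "c = cos (3 * pi / 8)"
  have c: "c > 0" unfolding c_def by (rule cos_gt_zero) auto
  define m where "m = (\<lambda>z. exp (3/2 * Ln (z + 1)))"
  have B0: "B \<ge> 0" using bd[of 0] by (simp add: order_trans[OF norm_ge_zero])
  have K0: "K \<ge> 0" using gr[of 0] by (simp add: order_trans[OF norm_ge_zero])
  have mRe: "Re (m z) \<ge> c * cmod z powr (3/2)" if "\<bar>Im z\<bar> \<le> Re z" for z
  proof -
    have nz: "z + 1 \<noteq> 0" and Re1: "Re (z+1) > 0" using that by (auto simp: complex_eq_iff)
    have arg: "\<bar>Im (Ln (z+1))\<bar> \<le> pi/4"
    proof -
      have "Im (Ln (z + 1)) = arctan (Im (z+1) / Re (z+1))"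
        using Re1 arg_conv_arctan[of "z+1"] by (simp add: Arg_eq_Im_Ln nz)
      moreover have "\<bar>Im (z+1) / Re (z+1)\<bar> \<le> 1" using that Re1 by (simp add: divide_simps)
      ultimately show ?thesis
        using arctan_monotone'[of "Im (z+1) / Re (z+1)" 1] arctan_monotone'[of "-1" "Im (z+1) / Re (z+1)"]
        unfolding abs_le_iff by (simp add: arctan_minus)
    qed
    have "cos (3/2 * Im (Ln (z+1))) \<ge> c"
    proof -
      have "cos (3/2 * Im (Ln (z+1))) = cos \<bar>3/2 * Im (Ln (z+1))\<bar>" by (metis cos_abs_real)
      also have "\<dots> \<ge> cos (3 * pi / 8)"
        using arg by (intro cos_monotone_0_pi_le) (auto simp: abs_mult)
      finally show ?thesis by (simp add: c_def)
    qed
    moreover have "exp (3/2 * ln (cmod (z+1))) \<ge> cmod z powr (3/2)"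
    proof -
      have "cmod z \<le> cmod (z+1)"
        using that by (auto simp: cmod_def power2_eq_square algebra_simps)
      then have "cmod z powr (3/2) \<le> cmod (z+1) powr (3/2)" by (intro powr_mono2) auto
      then show ?thesis using nz by (simp add: powr_def)
    qed
    ultimately have "c * cmod z powr (3/2) \<le> cos (3/2 * Im (Ln (z+1))) * exp (3/2 * ln (cmod (z+1)))"
      using c by (intro mult_mono) auto
    then show ?thesis by (simp add: m_def Re_exp nz mult.commute)
  qed
  have main: "cmod (G z) * exp (- \<delta> * Re (m z)) \<le> B" if d: "\<delta> > 0" for \<delta>
  proof -
    have "((\<lambda>R. K * exp (a * R - \<delta> * (c * R powr (3/2)))) \<longlongrightarrow> K * 0) at_top"
      apply (intro tendsto_intros)
      apply (rule filterlim_compose[OF exp_at_bot])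
      using c d by real_asymp
    then have "\<forall>\<^sub>F R in at_top. K * exp (a * R - \<delta> * (c * R powr (3/2))) < B + \<epsilon>" if "\<epsilon> > 0" for \<epsilon>
      using that B0 by (intro order_tendstoD) auto
    then have ev: "\<forall>\<^sub>F R in at_top. K * exp (a * R - \<delta> * (c * R powr (3/2))) < B + \<epsilon> \<and> R > cmod z \<and> R > 0" if "\<epsilon> > 0" for \<epsilon>
      using that by (intro eventually_conj eventually_gt_at_top) auto
    have "cmod (G z) * exp (- \<delta> * Re (m z)) \<le> B + \<epsilon>" if "\<epsilon> > 0" for \<epsilon>
    proof -
      obtain R where R: "K * exp (a * R - \<delta> * (c * R powr (3/2))) < B + \<epsilon>" "R > cmod z" "R > 0"
        using ev[OF \<open>\<epsilon> > 0\<close>] by (auto simp: eventually_at_top_linorder)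
      define S where "S = {z. \<bar>Im z\<bar> \<le> Re z \<and> cmod z \<le> R}"
      define U where "U = {z. \<bar>Im z\<bar> < Re z \<and> cmod z < R}"
      have S: "closed S" unfolding S_def by (intro closed_Collect_conj closed_Collect_le continuous_intros)
      have U: "open U" unfolding U_def by (intro open_Collect_conj open_Collect_less continuous_intros)
      have US: "U \<subseteq> S" by (auto simp: U_def S_def)
      have bS: "bounded S" unfolding S_def by (rule bounded_subset[of "cball 0 R"]) auto
      define H where "H = (\<lambda>z. G z * exp (- of_real \<delta> * m z))"
      have nH: "cmod (H z) = cmod (G z) * exp (- \<delta> * Re (m z))" for z
        by (simp add: H_def norm_mult)
      have hol: "H holomorphic_on S"
      proof -
        have "z + 1 \<notin> \<real>\<^sub>\<le>\<^sub>0" if "z \<in> S" for z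
          using that by (auto simp: S_def complex_nonpos_Reals_iff)
        then show ?thesis unfolding H_def m_def
          by (intro holomorphic_intros holomorphic_on_subset[OF hol]) (use T in \<open>auto simp: S_def\<close>)
      qed
      have "cmod (H z) \<le> B + \<epsilon>"
      proof (rule maximum_modulus_closed[OF hol S bS U US])
        show "z \<in> S" using z R by (auto simp: S_def)
        fix u assume uS: "u \<in> S" and uU: "u \<notin> U"
        show "cmod (H u) \<le> B + \<epsilon>"
        proof (cases "\<bar>Im u\<bar> = Re u")
          case True
          have "0 \<le> Re (m u)" using mRe[of u] uS c 
            by (auto simp: S_def intro: order_trans[rotated])
          then have "cmod (G u) * exp (- \<delta> * Re (m u)) \<le> B * 1"
            using bd[OF True] d B0 by (intro mult_mono) auto
          then show ?thesis using \<open>\<epsilon> > 0\<close> by (simp add: nH)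
        next
          case False
          then have cu: "cmod u = R" using uS uU by (auto simp: S_def U_def)
          have us: "\<bar>Im u\<bar> \<le> Re u" using uS by (auto simp: S_def)
          have "cmod (H u) \<le> (K * exp (a * R)) * exp (- \<delta> * (c * R powr (3/2)))"
            unfolding nH using gr[OF us] mRe[OF us] d K0 cu by (intro mult_mono) auto
          also have "\<dots> = K * exp (a * R - \<delta> * (c * R powr (3/2)))"
            by (simp add: mult_exp_exp)
          finally show ?thesis using R by linarith
        qed
      qed
      then show ?thesis by (simp add: nH)
    qed
    then show ?thesis by (rule field_le_epsilon)
  qed
  have "((\<lambda>\<delta>. cmod (G z) * exp (- \<delta> * Re (m z))) \<longlongrightarrow> cmod (G z) * exp (- 0 * Re (m z))) (at_right 0)"
    by (intro tendsto_intros)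
  then have "((\<lambda>\<delta>. cmod (G z) * exp (- \<delta> * Re (m z))) \<longlongrightarrow> cmod (G z)) (at_right 0)" by simp
  then show ?thesis
    by (rule tendsto_upperbound) (intro eventually_mono[OF eventually_at_right_less[of 0]] main, auto)
qed

text \<open>Division by \<open>1 + \<delta> * z\<close>, whose modulus on the half-plane is at least
  1 and at least \<delta> |z|, makes a bounded function small on large arcs without raising it on
  the axis; then \<delta> tends to 0.\<close>

lemma phragmen_lindelof_bounded:
  fixes G :: "complex \<Rightarrow> complex"
  assumes hol: "G holomorphic_on T" and T: "\<And>z. 0 \<le> Re z \<Longrightarrow> z \<in> T"
    and gr: "\<And>z. 0 \<le> Re z \<Longrightarrow> cmod (G z) \<le> K"
    and bd: "\<And>z. Re z = 0 \<Longrightarrow> cmod (G z) \<le> B"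
    and z: "0 \<le> Re z"
  shows "cmod (G z) \<le> B"
proof -
  have B0: "B \<ge> 0" using bd[of 0] by (simp add: order_trans[OF norm_ge_zero])
  have K0: "K \<ge> 0" using gr[of 0] by (simp add: order_trans[OF norm_ge_zero])
  have main: "cmod (G z) / cmod (1 + of_real \<delta> * z) \<le> B" if d: "\<delta> > 0" for \<delta>
  proof -
    have "cmod (G z) / cmod (1 + of_real \<delta> * z) \<le> B + \<epsilon>" if "\<epsilon> > 0" for \<epsilon>
    proof -
      define R where "R = max (cmod z + 1) (K / (\<delta> * \<epsilon>))"
      have R: "R > cmod z" "R > 0" "K \<le> \<epsilon> * (\<delta> * R)"
      proof -
        show "R > cmod z" by (simp add: R_def)
        show "R > 0" using norm_ge_zero[of z] unfolding R_def by linarith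
        have "K / (\<delta> * \<epsilon>) \<le> R" by (simp add: R_def)
        then show "K \<le> \<epsilon> * (\<delta> * R)" using d \<open>\<epsilon> > 0\<close> by (simp add: divide_le_eq mult_ac)
      qed
      define S where "S = {z. 0 \<le> Re z \<and> cmod z \<le> R}"
      define U where "U = {z. 0 < Re z \<and> cmod z < R}"
      have S: "closed S" unfolding S_def by (intro closed_Collect_conj closed_Collect_le continuous_intros)
      have U: "open U" unfolding U_def by (intro open_Collect_conj open_Collect_less continuous_intros)
      have US: "U \<subseteq> S" by (auto simp: U_def S_def)
      have bS: "bounded S" unfolding S_def by (rule bounded_subset[of "cball 0 R"]) auto
      define H where "H = (\<lambda>z. G z / (1 + of_real \<delta> * z))"
      have Re1: "Re (1 + of_real \<delta> * u) \<ge> 1" if "0 \<le> Re u" for u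
        using that d by simp
      have ge1: "cmod (1 + of_real \<delta> * u) \<ge> 1" if "0 \<le> Re u" for u
        using Re1[OF that] complex_Re_le_cmod order_trans by blast
      have nH: "cmod (H z) = cmod (G z) / cmod (1 + of_real \<delta> * z)" for z
        by (simp add: H_def norm_divide)
      have hol: "H holomorphic_on S"
        unfolding H_def
        by (intro holomorphic_intros holomorphic_on_subset[OF hol]) (use T ge1 in \<open>force simp: S_def\<close>)+
      have "cmod (H z) \<le> B + \<epsilon>"
      proof (rule maximum_modulus_closed[OF hol S bS U US])
        show "z \<in> S" using z R by (auto simp: S_def)
        fix u assume uS: "u \<in> S" and uU: "u \<notin> U"
        have u0: "0 \<le> Re u" using uS by (auto simp: S_def)
        show "cmod (H u) \<le> B + \<epsilon>"
        proof (cases "Re u = 0")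
          case True
          have "cmod (H u) \<le> B / 1"
            unfolding nH using bd[OF True] ge1[OF u0] B0 by (intro frac_le) auto
          then show ?thesis using \<open>\<epsilon> > 0\<close> by simp
        next
          case False
          then have cu: "cmod u = R" using uS uU by (auto simp: S_def U_def)
          have "\<delta> * R \<le> cmod (1 + of_real \<delta> * u)"
          proof -
            have "(\<delta> * R)\<^sup>2 \<le> (cmod (1 + of_real \<delta> * u))\<^sup>2"
              using d u0 unfolding cu[symmetric] by (simp add: cmod_power2 power_mult_distrib algebra_simps) (simp add: power2_eq_square algebra_simps)
            then show ?thesis by (rule power2_le_imp_le) auto
          qed
          then have "cmod (H u) \<le> K / (\<delta> * R)"
            unfolding nH using gr[OF u0] K0 d R by (intro frac_le) auto
          also have "\<dots> \<le> \<epsilon>" using R d by (simp add: divide_le_eq)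
          finally show ?thesis using B0 by linarith
        qed
      qed
      then show ?thesis by (simp add: nH)
    qed
    then show ?thesis by (rule field_le_epsilon)
  qed
  have "((\<lambda>\<delta>. cmod (G z) / cmod (1 + of_real \<delta> * z)) \<longlongrightarrow> cmod (G z) / cmod (1 + of_real 0 * z)) (at_right 0)"
    by (intro tendsto_intros) auto
  then have "((\<lambda>\<delta>. cmod (G z) / cmod (1 + of_real \<delta> * z)) \<longlongrightarrow> cmod (G z)) (at_right 0)" by simp
  then show ?thesis
    by (rule tendsto_upperbound) (intro eventually_mono[OF eventually_at_right_less[of 0]] main, auto)
qed

text \<open>The factor exp (- \<epsilon> z) has modulus 1 on the imaginary axis and compensates the
  growth on the positive real axis, so each quadrant, rotated by pi/4, is a sector on whose sides
  the product is bounded. This gives a bound \<open>L\<close> that still depends on \<epsilon>; the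
  bounded case restores the bound \<open>B\<close>, and \<epsilon> tends to 0.\<close>

lemma phragmen_lindelof_half_plane:
  fixes G :: "complex \<Rightarrow> complex"
  assumes hol: "G holomorphic_on T" and T: "\<And>z. 0 \<le> Re z \<Longrightarrow> z \<in> T"
    and gr: "\<And>\<epsilon>. \<epsilon> > 0 \<Longrightarrow> \<exists>K. \<forall>z. 0 \<le> Re z \<longrightarrow> cmod (G z) \<le> K * exp (\<epsilon> * cmod z)"
    and bd: "\<And>z. Re z = 0 \<Longrightarrow> cmod (G z) \<le> B"
    and z: "0 \<le> Re z"
  shows "cmod (G z) \<le> B"
proof -
  have B0: "B \<ge> 0" using bd[of 0] by (simp add: order_trans[OF norm_ge_zero])
  have main: "cmod (G z) * exp (- \<epsilon> * Re z) \<le> B" if e: "\<epsilon> > 0" for \<epsilon>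
  proof -
    obtain K where K: "\<And>z. 0 \<le> Re z \<Longrightarrow> cmod (G z) \<le> K * exp (\<epsilon> * cmod z)" using gr[OF e] by blast
    have K0: "K \<ge> 0" using K[of 0] by (simp add: order_trans[OF norm_ge_zero])
    define H where "H = (\<lambda>z. G z * exp (- of_real \<epsilon> * z))"
    have nH: "cmod (H z) = cmod (G z) * exp (- \<epsilon> * Re z)" for z
      by (simp add: H_def norm_mult)
    have hH: "H holomorphic_on T" unfolding H_def by (intro holomorphic_intros hol)
    define L where "L = max B K"
    \<comment> \<open>Multiplication by \<open>s\<close> carries the sector |Im u| \<le> Re u to the
      upper quadrant, multiplication by \<open>cnj s\<close> to the lower one.\<close>
    define s where "s = exp (\<i> * of_real (pi/4))"
    have s: "cmod s = 1" "Re s = sqrt 2 / 2" "Im s = sqrt 2 / 2"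
      by (simp_all add: s_def Re_exp Im_exp cos_45 sin_45)
    have sRe: "Re (s * u) = sqrt 2 / 2 * (Re u - Im u)" "Re (cnj s * u) = sqrt 2 / 2 * (Re u + Im u)"
      "Im (s * u) = sqrt 2 / 2 * (Re u + Im u)" "Im (cnj s * u) = sqrt 2 / 2 * (Im u - Re u)" for u
      by (simp_all add: s algebra_simps)
    have Hgr: "cmod (H z) \<le> K * exp (\<epsilon> * cmod z)" if "0 \<le> Re z" for z
    proof -
      have "cmod (H z) \<le> (K * exp (\<epsilon> * cmod z)) * 1"
        unfolding nH using K[OF that] K0 that e by (intro mult_mono) auto
      then show ?thesis by simp
    qed
    have imag: "cmod (H z) \<le> L" if "Re z = 0" for z
      using bd[OF that] that by (simp add: nH L_def)
    have real: "cmod (H z) \<le> L" if "Re z \<ge> 0" "Im z = 0" for z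
    proof -
      have "cmod z = Re z" using that by (simp add: cmod_def)
      then have "cmod (H z) \<le> (K * exp (\<epsilon> * Re z)) * exp (- \<epsilon> * Re z)"
        unfolding nH using K[OF that(1)] by (intro mult_right_mono) auto
      also have "\<dots> = K" by (simp add: exp_minus)
      finally show ?thesis by (simp add: L_def)
    qed
    have up: "cmod (H (s * u)) \<le> L" if "\<bar>Im u\<bar> \<le> Re u" for u
    proof (rule phragmen_lindelof_sector[where G="\<lambda>u. H (s * u)" and T="(\<lambda>u. s * u) -` T" and K=K and a=\<epsilon>])
      show "(\<lambda>u. H (s * u)) holomorphic_on (\<lambda>u. s * u) -` T"
        by (rule holomorphic_on_compose_gen[of "\<lambda>u. s * u" _ H T, unfolded o_def]) (auto intro!: holomorphic_intros hH)
      show "z \<in> (\<lambda>u. s * u) -` T" if "\<bar>Im z\<bar> \<le> Re z" for z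
        using that by (intro vimageI2 T, unfold sRe) (simp add: abs_le_iff)
      show "cmod (H (s * z)) \<le> K * exp (\<epsilon> * cmod z)" if "\<bar>Im z\<bar> \<le> Re z" for z
        using Hgr[of "s * z"] that unfolding sRe by (simp add: s norm_mult abs_le_iff)
      show "cmod (H (s * z)) \<le> L" if "\<bar>Im z\<bar> = Re z" for z
        using imag[of "s * z"] real[of "s * z"] that unfolding sRe by (cases "Im z \<ge> 0") auto
    qed (rule that)
    have dn: "cmod (H (cnj s * u)) \<le> L" if "\<bar>Im u\<bar> \<le> Re u" for u
    proof (rule phragmen_lindelof_sector[where G="\<lambda>u. H (cnj s * u)" and T="(\<lambda>u. cnj s * u) -` T" and K=K and a=\<epsilon>])
      show "(\<lambda>u. H (cnj s * u)) holomorphic_on (\<lambda>u. cnj s * u) -` T"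
        by (rule holomorphic_on_compose_gen[of "\<lambda>u. cnj s * u" _ H T, unfolded o_def]) (auto intro!: holomorphic_intros hH)
      show "z \<in> (\<lambda>u. cnj s * u) -` T" if "\<bar>Im z\<bar> \<le> Re z" for z
        using that by (intro vimageI2 T, unfold sRe) (simp add: abs_le_iff)
      show "cmod (H (cnj s * z)) \<le> K * exp (\<epsilon> * cmod z)" if "\<bar>Im z\<bar> \<le> Re z" for z
        using Hgr[of "cnj s * z"] that unfolding sRe by (simp add: s norm_mult abs_le_iff)
      show "cmod (H (cnj s * z)) \<le> L" if "\<bar>Im z\<bar> = Re z" for z
        using imag[of "cnj s * z"] real[of "cnj s * z"] that unfolding sRe by (cases "Im z \<ge> 0") auto
    qed (rule that)
    have ss: "s * cnj s = 1" by (simp add: complex_norm_square[symmetric] s)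
    have HL: "cmod (H z) \<le> L" if "0 \<le> Re z" for z
    proof (cases "Im z \<ge> 0")
      case True
      have "\<bar>Im (cnj s * z)\<bar> \<le> Re (cnj s * z)"
        using that True unfolding sRe by (simp add: abs_mult)
      from up[OF this] show ?thesis by (simp add: mult.assoc[symmetric] ss)
    next
      case False
      have "\<bar>Im (s * z)\<bar> \<le> Re (s * z)"
        using that False unfolding sRe by (simp add: abs_mult)
      from dn[OF this] show ?thesis by (simp add: mult.assoc[symmetric] ss mult.commute[of "cnj s" s])
    qed
    have "cmod (H z) \<le> B"
      by (rule phragmen_lindelof_bounded[OF hH T HL _ z]) (use bd in \<open>auto simp: nH\<close>)
    then show ?thesis by (simp add: nH)
  qed
  have "((\<lambda>\<delta>. cmod (G z) * exp (- \<delta> * Re z)) \<longlongrightarrow> cmod (G z) * exp (- 0 * Re z)) (at_right 0)"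
    by (intro tendsto_intros)
  then have "((\<lambda>\<delta>. cmod (G z) * exp (- \<delta> * Re z)) \<longlongrightarrow> cmod (G z)) (at_right 0)" by simp
  then show ?thesis
    by (rule tendsto_upperbound) (intro eventually_mono[OF eventually_at_right_less[of 0]] main, auto)
qed

section \<open>The Poisson kernel of the half-plane\<close>

lemma set_integrable_powr_tail:
  assumes "a > 0" "e < -1"
  shows "set_integrable lborel {a..} (\<lambda>t::real. t powr e)"
proof -
  have "(\<lambda>t. t powr e) absolutely_integrable_on {a..}"
    using has_integral_powr_to_inf[OF assms(2,1)] by (intro nonnegative_absolutely_integrable_1) (auto simp: integrable_on_def)
  then show ?thesis
    unfolding set_integrable_def by (subst (asm) integrable_completion) auto
qed

lemma set_borel_measurable_continuous_on:
  fixes f :: "real \<Rightarrow> 'a::{banach, second_countable_topology}"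
  assumes "continuous_on A f" "A \<in> sets borel"
  shows "set_borel_measurable lborel A f"
  using borel_measurable_continuous_on_indicator[OF assms(2,1)] by (simp add: set_borel_measurable_def)

text \<open>The exponent -3/2 suits both 1/(1 + t^2) and a logarithm divided by t^2, a logarithm
  being dominated by the square root.\<close>

lemma set_integrable_powr_decay:
  fixes f :: "real \<Rightarrow> 'a::{banach, second_countable_topology}"
  assumes cont: "continuous_on {0..} f" and bd: "\<And>t. t \<ge> 1 \<Longrightarrow> norm (f t) \<le> C * t powr (-3/2)"
  shows "set_integrable lborel {0..} f"
proof -
  have 1: "set_integrable lborel {0..1} f"
    by (rule borel_integrable_atLeastAtMost') (use cont in \<open>auto intro: continuous_on_subset\<close>)
  have 2: "set_integrable lborel {1..} f"
  proof (rule set_integrable_bound)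
    show "set_integrable lborel {1..} (\<lambda>t. C * t powr (-3/2))"
      by (intro set_integrable_mult_right set_integrable_powr_tail) auto
    show "set_borel_measurable lborel {1..} f"
      by (rule set_borel_measurable_continuous_on) (use cont in \<open>auto intro: continuous_on_subset\<close>)
    show "AE x in lborel. x \<in> {1..} \<longrightarrow> norm (f x) \<le> norm (C * x powr (-3/2))"
      using bd by (intro AE_I2) (force intro: order_trans[OF bd abs_ge_self])
  qed
  have "{0..} = {0..1} \<union> {1::real..}" by auto
  with set_integrable_Un[OF 1 2] show ?thesis by simp
qed

lemma integrable_inverse_one_plus_square:
  "set_integrable lborel {0..} (\<lambda>t::real. 1 / (1 + t\<^sup>2))"
proof (rule set_integrable_powr_decay[where C=1])
  show "continuous_on {0..} (\<lambda>t::real. 1 / (1 + t\<^sup>2))"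
    by (intro continuous_intros) (auto simp: add_nonneg_eq_0_iff)
  fix t :: real assume t: "t \<ge> 1"
  have "norm (1/(1+t\<^sup>2)) \<le> 1 / t powr 2" using t
    by (simp add: divide_simps powr_numeral add_pos_nonneg)
  also have "\<dots> = t powr (-2)" using t by (simp add: powr_minus_divide)
  also have "\<dots> \<le> t powr (-3/2)" using t by (intro powr_mono) auto
  finally show "norm (1/(1+t\<^sup>2)) \<le> 1 * t powr (-3/2)" by simp
qed

text \<open>The real part is the sum of the Poisson kernels of the half-plane Re w > 0 for the
  boundary points i t and -i t, which is what an even boundary function needs. Keeping the complex
  kernel yields the harmonic conjugate as well, hence a holomorphic function.\<close>

definition poisson_kernel :: "complex \<Rightarrow> real \<Rightarrow> complex" where
  "poisson_kernel w t = 2 * w / (of_real pi * ((of_real t)\<^sup>2 + w\<^sup>2))"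

lemma kernel_factor: "(of_real t)\<^sup>2 + w\<^sup>2 = (w + \<i> * of_real t) * (w - \<i> * of_real t)" for w :: complex
  by (simp add: algebra_simps power2_eq_square)

lemma kernel_nonzero:
  assumes "Re w > 0" shows "(complex_of_real t)\<^sup>2 + w\<^sup>2 \<noteq> 0"
proof -
  have "Re (w + \<i> * of_real t) > 0" "Re (w - \<i> * of_real t) > 0" using assms by auto
  then show ?thesis unfolding kernel_factor by (metis less_irrefl mult_eq_0_iff zero_complex.simps(1))
qed

text \<open>The modulus is the product of the distances of w from i t and -i t. Both are at least
  \<delta>; for t \<ge> 2R both are at least t/2, and the one to the point on the side opposite to
  Im w is at least t. The constant depends only on \<delta> and R, which later gives locally uniform
  convergence.\<close>

lemma kernel_denominator_bound:
  fixes w :: complex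
  assumes d: "\<delta> > 0" and w: "\<delta> \<le> Re w" "cmod w \<le> R" and t: "t \<ge> 0"
  shows "1 + t\<^sup>2 \<le> ((1 + 4*R\<^sup>2)/\<delta>\<^sup>2 + 1/\<delta>\<^sup>2 + 2) * cmod ((of_real t)\<^sup>2 + w\<^sup>2)"
proof -
  define a b where "a = cmod (w + \<i> * of_real t)" and "b = cmod (w - \<i> * of_real t)"
  have ab: "cmod ((of_real t)\<^sup>2 + w\<^sup>2) = a * b" unfolding kernel_factor a_def b_def norm_mult ..
  have R: "R > 0" using w d norm_ge_zero[of w] complex_Re_le_cmod[of w] by linarith
  have "\<delta> \<le> Re (w + \<i> * of_real t)" "\<delta> \<le> Re (w - \<i> * of_real t)" using w by auto
  then have ad: "\<delta> \<le> a" "\<delta> \<le> b" unfolding a_def b_def by (meson complex_Re_le_cmod order_trans)+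
  have dd: "\<delta>\<^sup>2 \<le> a * b" using ad d by (auto simp: power2_eq_square intro!: mult_mono)
  have at: "t - R \<le> a" "t - R \<le> b"
  proof -
    have "t = cmod (\<i> * of_real t)" using t by (simp add: norm_mult)
    also have "\<dots> \<le> a + cmod w" unfolding a_def using norm_triangle_ineq4[of "w + \<i> * of_real t" w] by simp
    finally show "t - R \<le> a" using w by simp
    have "t = cmod (\<i> * of_real t)" using t by (simp add: norm_mult)
    also have "\<dots> \<le> b + cmod w" unfolding b_def using norm_triangle_ineq4[of w "w - \<i> * of_real t"] by simp
    finally show "t - R \<le> b" using w by simp
  qed
  have tt: "t \<le> a \<or> t \<le> b"
  proof (cases "Im w \<ge> 0")
    case True
    then have "t \<le> \<bar>Im (w + \<i> * of_real t)\<bar>" using t by simp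
    then show ?thesis unfolding a_def using abs_Im_le_cmod order_trans by blast
  next
    case False
    then have "t \<le> \<bar>Im (w - \<i> * of_real t)\<bar>" using t by simp
    then show ?thesis unfolding b_def using abs_Im_le_cmod order_trans by blast
  qed
  have ab0: "a * b \<ge> 0" by (simp add: a_def b_def)
  have 1: "1 \<le> (1/\<delta>\<^sup>2) * (a * b)" using dd d by (simp add: divide_simps)
  show ?thesis
  proof (cases "t \<ge> 2 * R")
    case True
    then have *: "t / 2 \<le> a" "t / 2 \<le> b" using at by auto
    have "t * (t/2) \<le> a * b"
    proof (cases "t \<le> a")
      case True then show ?thesis using * t by (intro mult_mono) (auto simp: a_def b_def)
    next
      case False 
      then have "t \<le> b" using tt by auto
      then have "(t/2) * t \<le> a * b" using * t by (intro mult_mono) (auto simp: a_def b_def)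
      then show ?thesis by simp
    qed
    then have "t\<^sup>2 \<le> 2 * (a * b)" by (simp add: power2_eq_square)
    moreover have "0 \<le> (1 + 4*R\<^sup>2)/\<delta>\<^sup>2 * (a*b)" using ab0 by simp
    ultimately show ?thesis using 1 unfolding ab by (simp add: algebra_simps)
  next
    case False
    then have "t\<^sup>2 \<le> (2*R)\<^sup>2" using t by (intro power_mono) auto
    then have "1 + t\<^sup>2 \<le> 1 + 4*R\<^sup>2" by (simp add: power_mult_distrib)
    also have "\<dots> \<le> (1 + 4*R\<^sup>2) * ((1/\<delta>\<^sup>2) * (a * b))"
      using mult_left_mono[OF 1, of "1 + 4*R\<^sup>2"] by simp
    also have "\<dots> \<le> ((1 + 4*R\<^sup>2)/\<delta>\<^sup>2 + 1/\<delta>\<^sup>2 + 2) * (a*b)"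
    proof -
      have "0 \<le> (1/\<delta>\<^sup>2 + 2) * (a*b)" using ab0 by simp
      then show ?thesis by (simp add: ring_distribs)
    qed
    finally show ?thesis unfolding ab .
  qed
qed

lemma kernel_bound:
  assumes "Re w > 0"
  obtains C where "C > 0" "\<And>t. t \<ge> 0 \<Longrightarrow> cmod (poisson_kernel w t) \<le> C / (1 + t\<^sup>2)"
proof -
  define D where "D = (1 + 4*(cmod w)\<^sup>2)/(Re w)\<^sup>2 + 1/(Re w)\<^sup>2 + 2"
  have D: "D > 0" unfolding D_def using assms by (intro add_nonneg_pos add_nonneg_nonneg) auto
  have "cmod (poisson_kernel w t) \<le> (2 * cmod w / pi * D) / (1 + t\<^sup>2)" if "t \<ge> 0" for t
  proof -
    have nz: "cmod ((of_real t)\<^sup>2 + w\<^sup>2) > 0" using kernel_nonzero[OF assms] by simp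
    have "1 + t\<^sup>2 \<le> D * cmod ((of_real t)\<^sup>2 + w\<^sup>2)"
      unfolding D_def by (rule kernel_denominator_bound[OF assms]) (use that in auto)
    then have "1 / cmod ((of_real t)\<^sup>2 + w\<^sup>2) \<le> D / (1 + t\<^sup>2)"
      using nz by (simp add: divide_simps add_pos_nonneg)
    then have "2 * cmod w / pi * (1 / cmod ((of_real t)\<^sup>2 + w\<^sup>2)) \<le> 2 * cmod w / pi * (D / (1 + t\<^sup>2))"
      by (intro mult_left_mono) auto
    then show ?thesis by (simp add: poisson_kernel_def norm_divide norm_mult)
  qed
  moreover have "2 * cmod w / pi * D > 0" using D assms by (auto intro!: divide_pos_pos mult_pos_pos)
  ultimately show ?thesis using that by blast
qed

lemma continuous_kernel: "Re w > 0 \<Longrightarrow> continuous_on A (poisson_kernel w)"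
  unfolding poisson_kernel_def[abs_def]
  by (intro continuous_intros) (auto simp: kernel_nonzero)

lemma kernel_measurable [measurable]: "poisson_kernel w \<in> borel_measurable borel"
  unfolding poisson_kernel_def[abs_def] by measurable

lemma set_integrable_of_norm_bound:
  fixes f :: "real \<Rightarrow> 'a::{banach, second_countable_topology}" and g :: "real \<Rightarrow> real"
  assumes "set_integrable lborel A g" "f \<in> borel_measurable borel" "A \<in> sets borel"
    "\<And>t. t \<in> A \<Longrightarrow> norm (f t) \<le> g t"
  shows "set_integrable lborel A f"
proof (rule set_integrable_bound[OF assms(1)])
  show "set_borel_measurable lborel A f" unfolding set_borel_measurable_def using assms(2,3) by measurable
  show "AE x in lborel. x \<in> A \<longrightarrow> norm (f x) \<le> norm (g x)"
    using assms(4) by (intro AE_I2) (auto intro: order_trans[OF _ abs_ge_self])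
qed

lemma kernel_integrable: "Re w > 0 \<Longrightarrow> set_integrable lborel {0..} (poisson_kernel w)"
proof -
  assume w: "Re w > 0"
  obtain C where C: "C > 0" "\<And>t. t \<ge> 0 \<Longrightarrow> cmod (poisson_kernel w t) \<le> C / (1 + t\<^sup>2)"
    using kernel_bound[OF w] by blast
  have "set_integrable lborel {0..} (\<lambda>t::real. C * (1 / (1 + t\<^sup>2)))"
    by (intro set_integrable_mult_right integrable_inverse_one_plus_square)
  then show ?thesis
    by (rule set_integrable_of_norm_bound) (use C in auto)
qed

text \<open>Dividing both arguments by t > 0 leaves the difference unchanged and reduces the limit
  to Ln i - Ln (-i), taken away from the branch cut.\<close>

lemma Ln_difference_tendsto:
  assumes w: "Re w > 0"
  shows "((\<lambda>t. Ln (w + \<i> * of_real t) - Ln (w - \<i> * of_real t)) \<longlongrightarrow> \<i> * pi) at_top"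
proof -
  have split: "Ln (w + \<i> * of_real t) - Ln (w - \<i> * of_real t) = Ln (w / of_real t + \<i>) - Ln (w / of_real t - \<i>)" if "t > 0" for t
  proof -
    have "w + \<i> * of_real t = of_real t * (w / of_real t + \<i>)" "w - \<i> * of_real t = of_real t * (w / of_real t - \<i>)"
      using that by (simp_all add: field_simps)
    moreover have "Re (w / of_real t + \<i>) > 0" "Re (w / of_real t - \<i>) > 0" using that w by auto
    then have "w / of_real t + \<i> \<noteq> 0" "w / of_real t - \<i> \<noteq> 0" by (metis less_irrefl zero_complex.simps(1))+
    ultimately show ?thesis using that by (simp add: Ln_times_of_real)
  qed
  have "((\<lambda>t. Ln (w / of_real t + \<i>) - Ln (w / of_real t - \<i>)) \<longlongrightarrow> Ln (0 + \<i>) - Ln (0 - \<i>)) at_top"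
  proof (intro tendsto_intros)
    have "filterlim (\<lambda>t::real. complex_of_real t) at_infinity at_top"
      by (rule filterlim_of_real_at_infinity)
    then show "((\<lambda>t. w / complex_of_real t) \<longlongrightarrow> 0) at_top" by (rule tendsto_divide_0[OF tendsto_const])
    then show "((\<lambda>t. w / complex_of_real t) \<longlongrightarrow> 0) at_top" .
  qed (auto simp: complex_nonpos_Reals_iff)
  moreover have "Ln (0 + \<i>) - Ln (0 - \<i>) = \<i> * pi" by (simp add: complex_eq_iff)
  ultimately have "((\<lambda>t. Ln (w / of_real t + \<i>) - Ln (w / of_real t - \<i>)) \<longlongrightarrow> \<i> * pi) at_top" by simp
  then show ?thesis
    by (rule Lim_transform_eventually) (use eventually_gt_at_top[of 0] in \<open>eventually_elim, simp add: split\<close>)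
qed

lemma kernel_integral:
  assumes w: "Re w > 0"
  shows "(LBINT t:{0..}. poisson_kernel w t) = 1"
proof -
  \<comment> \<open>An antiderivative of the kernel with value 0 at 0, from its partial fractions in
    w + i t and w - i t; both arguments stay in the right half-plane, where the principal branch is
    smooth.\<close>
  define F where "F = (\<lambda>t::real. (Ln (w + \<i> * of_real t) - Ln (w - \<i> * of_real t)) / (\<i> * pi))"
  have nz: "w + \<i> * of_real t \<noteq> 0" "w - \<i> * of_real t \<noteq> 0" "w + \<i> * of_real t \<notin> \<real>\<^sub>\<le>\<^sub>0" "w - \<i> * of_real t \<notin> \<real>\<^sub>\<le>\<^sub>0" for t
    using w by (auto simp: complex_eq_iff complex_nonpos_Reals_iff)
  have F: "(F has_vector_derivative poisson_kernel w t) (at t within S)" for t S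
  proof -
    have "((\<lambda>z. (Ln (w + \<i> * z) - Ln (w - \<i> * z)) / (\<i> * pi)) has_field_derivative poisson_kernel w t) (at (of_real t))"
    proof -
      have e: "(1 / a * \<i> - 1 / b * (- \<i>)) / (\<i> * pi) = (a + b) / (pi * (a * b))" if "a \<noteq> 0" "b \<noteq> 0" for a b :: complex
        using that by (simp add: field_simps)
      have k: "poisson_kernel w t = (1 / (w + \<i> * of_real t) * \<i> - 1 / (w - \<i> * of_real t) * (- \<i>)) / (\<i> * pi)"
        unfolding e[OF nz(1,2)[of t]] poisson_kernel_def kernel_factor by simp
      show ?thesis unfolding k
        by (rule derivative_eq_intros refl nz | simp)+ (use nz[of t] in \<open>auto simp: field_simps\<close>)
    qed
    then have "((\<lambda>x. (Ln (w + \<i> * of_real x) - Ln (w - \<i> * of_real x)) / (\<i> * pi)) has_vector_derivative poisson_kernel w t) (at t within S)"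
      by (rule has_vector_derivative_real_field)
    then show ?thesis unfolding F_def .
  qed
  have FTC: "(LBINT t:{0..b}. poisson_kernel w t) = F b" if "b \<ge> 0" for b
    using integral_FTC_atLeastAtMost[OF that F continuous_kernel[OF w]] by (simp add: set_lebesgue_integral_def F_def)
  have "((\<lambda>b. LBINT t:{0..b}. poisson_kernel w t) \<longlongrightarrow> (LBINT t:{0..}. poisson_kernel w t)) at_top"
    by (rule tendsto_set_lebesgue_integral_at_top) (use kernel_integrable[OF w] in auto)
  then have "(F \<longlongrightarrow> (LBINT t:{0..}. poisson_kernel w t)) at_top"
    by (rule Lim_transform_eventually) (use eventually_ge_at_top[of 0] in \<open>eventually_elim, simp add: FTC\<close>)
  moreover have "(F \<longlongrightarrow> (\<i> * pi) / (\<i> * pi)) at_top"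
    unfolding F_def by (intro tendsto_intros Ln_difference_tendsto w) auto
  ultimately show ?thesis using tendsto_unique trivial_limit_at_top_linorder by fastforce
qed

lemma Re_poisson_kernel_of_real: "Re (poisson_kernel (of_real y) t) = 2 * y / pi * (1 / (t\<^sup>2 + y\<^sup>2))"
  unfolding poisson_kernel_def
  by (simp flip: of_real_power of_real_add of_real_mult of_real_divide add: Re_divide_of_real del: of_real_mult of_real_add)

lemma Re_poisson_kernel:
  assumes "Re w > 0"
  shows "Re (poisson_kernel w t) = (2/pi) * (Re w * (t\<^sup>2 + (cmod w)\<^sup>2) / ((t\<^sup>2 + (cmod w)\<^sup>2)\<^sup>2 - 4 * t\<^sup>2 * (Im w)\<^sup>2))"
    and "(t\<^sup>2 + (cmod w)\<^sup>2)\<^sup>2 - 4 * t\<^sup>2 * (Im w)\<^sup>2 > 0"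
proof -
  have nrm: "(cmod ((of_real t)\<^sup>2 + w\<^sup>2))\<^sup>2 = (t\<^sup>2 + (cmod w)\<^sup>2)\<^sup>2 - 4 * t\<^sup>2 * (Im w)\<^sup>2"
    unfolding cmod_power2 by (simp add: power2_eq_square algebra_simps)
  show pos: "(t\<^sup>2 + (cmod w)\<^sup>2)\<^sup>2 - 4 * t\<^sup>2 * (Im w)\<^sup>2 > 0"
    unfolding nrm[symmetric] using kernel_nonzero[OF assms] by simp
  have "poisson_kernel w t = (2/pi) *\<^sub>R (w / ((of_real t)\<^sup>2 + w\<^sup>2))"
    by (simp add: poisson_kernel_def scaleR_conv_of_real)
  then have "Re (poisson_kernel w t) = (2/pi) * Re (w / ((of_real t)\<^sup>2 + w\<^sup>2))" by simp
  also have "Re (w / ((of_real t)\<^sup>2 + w\<^sup>2)) = Re w * (t\<^sup>2 + (cmod w)\<^sup>2) / (cmod ((of_real t)\<^sup>2 + w\<^sup>2))\<^sup>2"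
  proof -
    have "Re (w * cnj ((of_real t)\<^sup>2 + w\<^sup>2)) = Re w * (t\<^sup>2 + (cmod w)\<^sup>2)"
      unfolding cmod_power2 by (simp add: power2_eq_square algebra_simps)
    then show ?thesis by (simp only: complex_div_cnj[of w] Re_divide_of_real flip: of_real_power)
  qed
  finally show "Re (poisson_kernel w t) = (2/pi) * (Re w * (t\<^sup>2 + (cmod w)\<^sup>2) / ((t\<^sup>2 + (cmod w)\<^sup>2)\<^sup>2 - 4 * t\<^sup>2 * (Im w)\<^sup>2))"
    by (simp add: nrm)
qed

lemma Re_poisson_kernel_nonneg: "Re w > 0 \<Longrightarrow> Re (poisson_kernel w t) \<ge> 0"
  using Re_poisson_kernel[of w t] by (auto intro!: mult_nonneg_nonneg divide_nonneg_pos)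

text \<open>The measure Re (poisson_kernel w t) dt is invariant under t \<mapsto> |w|^2 / t, that
  is, even in the variable ln (t / |w|). This symmetry is why convexity in ln t, rather than in t,
  is the property to exploit.\<close>

lemma Re_poisson_kernel_inversion:
  assumes w: "Re w > 0" and t: "t > 0"
  shows "(cmod w)\<^sup>2 / t\<^sup>2 * Re (poisson_kernel w ((cmod w)\<^sup>2 / t)) = Re (poisson_kernel w t)"
proof -
  define r where "r = cmod w"
  have r: "r > 0" using w unfolding r_def by (metis less_irrefl zero_complex.simps(1) zero_less_norm_iff)
  define s where "s = r\<^sup>2 / t"
  have s: "s > 0" "s * t = r\<^sup>2" using r t by (simp_all add: s_def)
  define D where "D = (t\<^sup>2 + r\<^sup>2)\<^sup>2 - 4 * t\<^sup>2 * (Im w)\<^sup>2"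
  have D: "D > 0" using Re_poisson_kernel(2)[OF w, of t] by (simp add: D_def r_def)
  have e1: "s\<^sup>2 + r\<^sup>2 = (r\<^sup>2/t\<^sup>2) * (t\<^sup>2 + r\<^sup>2)" using t by (simp add: s_def field_simps power2_eq_square)
  have e2: "(s\<^sup>2 + r\<^sup>2)\<^sup>2 - 4 * s\<^sup>2 * (Im w)\<^sup>2 = (r\<^sup>2/t\<^sup>2)\<^sup>2 * D"
    unfolding e1 D_def using t by (simp add: s_def field_simps power2_eq_square)
  have "r\<^sup>2/t\<^sup>2 * Re (poisson_kernel w s) = r\<^sup>2/t\<^sup>2 * ((2/pi) * (Re w * ((r\<^sup>2/t\<^sup>2) * (t\<^sup>2 + r\<^sup>2)) / ((r\<^sup>2/t\<^sup>2)\<^sup>2 * D)))"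
    unfolding Re_poisson_kernel(1)[OF w] r_def[symmetric] e2 unfolding e1 ..
  also have "\<dots> = (2/pi) * (Re w * (t\<^sup>2 + r\<^sup>2) / D)"
    using r t D by (simp add: field_simps power2_eq_square)
  also have "\<dots> = Re (poisson_kernel w t)"
    unfolding Re_poisson_kernel(1)[OF w] r_def[symmetric] D_def ..
  finally show ?thesis by (simp add: r_def s_def)
qed

lemma abs_ln_le_sqrt: "\<bar>ln x\<bar> \<le> 2 * sqrt x" if "x \<ge> 1" for x :: real
proof -
  have "ln (sqrt x) \<le> sqrt x - 1" using that by (intro ln_le_minus_one) auto
  then show ?thesis using that by (simp add: ln_sqrt)
qed

lemma integrable_log_tail:
  fixes r :: real
  assumes r: "r > 0"
  shows "set_integrable lborel {r..} (\<lambda>t. ln (t / r) * (1 / (1 + t\<^sup>2)))"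
proof (rule set_integrable_of_norm_bound)
  show "set_integrable lborel {r..} (\<lambda>t. 2 / sqrt r * t powr (-3/2))"
    using r by (intro set_integrable_mult_right set_integrable_powr_tail) auto
  fix t assume "t \<in> {r..}"
  then have t: "t \<ge> r" "t > 0" using r by auto
  have "\<bar>ln (t/r)\<bar> \<le> 2 * sqrt (t/r)" using t r by (intro abs_ln_le_sqrt) auto
  then have "\<bar>ln (t / r)\<bar> * (1 / (1 + t\<^sup>2)) \<le> (2 * sqrt (t/r)) * (1 / t\<^sup>2)"
    using t r by (intro mult_mono divide_left_mono) (auto simp: add_pos_nonneg)
  also have "\<dots> = 2 / sqrt r * (t powr (1/2) * t powr (-2))"
    using t r by (simp add: real_sqrt_divide powr_half_sqrt powr_minus_divide powr_numeral)
  also have "t powr (1/2) * t powr (-2) = t powr (-3/2)" by (simp flip: powr_add)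
  finally show "norm (ln (t / r) * (1 / (1 + t\<^sup>2))) \<le> 2 / sqrt r * t powr (-3/2)"
    by (simp add: abs_mult)
qed auto

text \<open>The substitution \<open>t \<mapsto> r\<^sup>2 / t\<close> exchanges the two halves of the half-line.\<close>

lemma antisymmetric_inversion_integral:
  fixes f :: "real \<Rightarrow> real"
  assumes r: "r > 0" and [measurable]: "f \<in> borel_measurable borel"
    and int: "set_integrable lborel {r..} f"
    and inv: "\<And>t. t > 0 \<Longrightarrow> r\<^sup>2 / t\<^sup>2 * f (r\<^sup>2 / t) = - f t"
  shows "set_integrable lborel {0..} f" "(LBINT t:{0..}. f t) = 0"
proof -
  have im: "(\<lambda>t. r\<^sup>2 / t) ` {r..} = {0<..r}"
  proof (intro equalityI subsetI)
    fix x assume "x \<in> (\<lambda>t. r\<^sup>2 / t) ` {r..}"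
    then show "x \<in> {0<..r}" using r by (auto simp: divide_le_eq power2_eq_square)
  next
    fix x assume "x \<in> {0<..r}"
    then show "x \<in> (\<lambda>t. r\<^sup>2 / t) ` {r..}" using r
      by (intro image_eqI[of _ _ "r\<^sup>2 / x"]) (auto simp: le_divide_eq power2_eq_square)
  qed
  have int': "f absolutely_integrable_on {r..}"
    using int unfolding set_integrable_def by (subst integrable_completion) auto
  have "(\<lambda>t. \<bar>- (r\<^sup>2 / t\<^sup>2)\<bar> * f (r\<^sup>2 / t)) absolutely_integrable_on {r..} \<and>
        integral {r..} (\<lambda>t. \<bar>- (r\<^sup>2 / t\<^sup>2)\<bar> * f (r\<^sup>2 / t)) = - integral {r..} f
     \<longleftrightarrow> f absolutely_integrable_on ((\<lambda>t. r\<^sup>2 / t) ` {r..}) \<and> integral ((\<lambda>t. r\<^sup>2 / t) ` {r..}) f = - integral {r..} f"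
    by (rule has_absolute_integral_change_of_variables_1')
       (use r in \<open>auto intro!: derivative_eq_intros inj_onI simp: power2_eq_square\<close>)
  moreover have "(\<lambda>t. \<bar>- (r\<^sup>2 / t\<^sup>2)\<bar> * f (r\<^sup>2 / t)) absolutely_integrable_on {r..} \<longleftrightarrow> (\<lambda>t. - f t) absolutely_integrable_on {r..}"
    by (rule set_integrable_cong) (use inv r in auto)
  moreover have "integral {r..} (\<lambda>t. \<bar>- (r\<^sup>2 / t\<^sup>2)\<bar> * f (r\<^sup>2 / t)) = integral {r..} (\<lambda>t. - f t)"
    by (rule integral_cong) (use inv r in auto)
  moreover have "(\<lambda>t. - f t) absolutely_integrable_on {r..}"
    using set_integrable_mult_right[OF int', of "-1"] by simp
  ultimately have *: "f absolutely_integrable_on {0<..r}" "integral {0<..r} f = - integral {r..} f"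
    by (simp_all add: im)
  have i0: "set_integrable lborel {0<..r} f"
    using *(1) unfolding set_integrable_def by (subst (asm) integrable_completion) auto
  have i1: "set_integrable lborel {r<..} f" by (rule set_integrable_subset[OF int]) auto
  have "set_integrable lborel ({0} \<union> ({0<..r} \<union> {r<..})) f"
    by (intro set_integrable_Un i0 i1) auto
  moreover have U: "{0} \<union> ({0<..r} \<union> {r<..}) = {0..}" using r by auto
  ultimately show "set_integrable lborel {0..} f" by simp
  have "(LBINT t:{0..}. f t) = (LBINT t:{0<..r} \<union> {r<..}. f t)"
    by (rule set_integral_cong_set) (use r in \<open>auto simp: set_borel_measurable_def intro!: AE_I[where N="{0}"]\<close>)
  also have "\<dots> = (LBINT t:{0<..r}. f t) + (LBINT t:{r<..}. f t)"
    by (rule set_integral_Un) (use i0 i1 in auto)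
  also have "(LBINT t:{r<..}. f t) = (LBINT t:{r..}. f t)"
    by (rule set_integral_cong_set) (auto simp: set_borel_measurable_def intro!: AE_I[where N="{r}"])
  also have "(LBINT t:{r..}. f t) = integral {r..} f" by (rule set_borel_integral_eq_integral[OF int])
  also have "(LBINT t:{0<..r}. f t) = integral {0<..r} f" by (rule set_borel_integral_eq_integral[OF i0])
  finally show "(LBINT t:{0..}. f t) = 0" using * by simp
qed

text \<open>Under t \<mapsto> |w|^2 / t the logarithm changes sign and the kernel measure is
  preserved. Functions affine in ln t are thus integrated to their value at t = |w|, the equality
  case of the convexity arguments that follow.\<close>

lemma kernel_log_integral:
  assumes w: "Re w > 0"
  shows "set_integrable lborel {0..} (\<lambda>t. ln (t / cmod w) * Re (poisson_kernel w t))"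
    and "(LBINT t:{0..}. ln (t / cmod w) * Re (poisson_kernel w t)) = 0"
proof -
  have r: "cmod w > 0" using w by (metis less_irrefl zero_complex.simps(1) zero_less_norm_iff)
  have int: "set_integrable lborel {cmod w..} (\<lambda>t. ln (t / cmod w) * Re (poisson_kernel w t))"
  proof -
    obtain C where C: "C > 0" "\<And>t. t \<ge> 0 \<Longrightarrow> cmod (poisson_kernel w t) \<le> C / (1 + t\<^sup>2)"
      using kernel_bound[OF w] by blast
    have "set_integrable lborel {cmod w..} (\<lambda>t. C * (ln (t / cmod w) * (1 / (1 + t\<^sup>2))))"
      by (intro set_integrable_mult_right integrable_log_tail r)
    then show ?thesis
    proof (rule set_integrable_of_norm_bound)
      fix t assume t: "t \<in> {cmod w..}"
      then have l: "0 \<le> ln (t / cmod w)" using r by simp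
      have "\<bar>Re (poisson_kernel w t)\<bar> \<le> C / (1 + t\<^sup>2)"
        using order_trans[OF abs_Re_le_cmod C(2)[of t]] t order_trans[OF norm_ge_zero, of w t] by simp
      then have "ln (t / cmod w) * \<bar>Re (poisson_kernel w t)\<bar> \<le> ln (t / cmod w) * (C / (1 + t\<^sup>2))"
        by (intro mult_left_mono l)
      then show "norm (ln (t / cmod w) * Re (poisson_kernel w t)) \<le> C * (ln (t / cmod w) * (1 / (1 + t\<^sup>2)))"
        using l by (simp add: abs_mult mult_ac)
    qed auto
  qed
  have inv: "(cmod w)\<^sup>2 / t\<^sup>2 * (ln ((cmod w)\<^sup>2 / t / cmod w) * Re (poisson_kernel w ((cmod w)\<^sup>2 / t))) =
      - (ln (t / cmod w) * Re (poisson_kernel w t))" if t: "t > 0" for t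
  proof -
    have "ln ((cmod w)\<^sup>2 / t / cmod w) = - ln (t / cmod w)"
    proof -
      have "(cmod w)\<^sup>2 / t / cmod w = inverse (t / cmod w)" using r by (simp add: field_simps power2_eq_square)
      then show ?thesis by (simp only: ln_inverse)
    qed
    then show ?thesis using Re_poisson_kernel_inversion[OF w t] by (simp add: mult_ac)
  qed
  show "set_integrable lborel {0..} (\<lambda>t. ln (t / cmod w) * Re (poisson_kernel w t))"
    by (rule antisymmetric_inversion_integral(1)[OF r _ int inv]) auto
  show "(LBINT t:{0..}. ln (t / cmod w) * Re (poisson_kernel w t)) = 0"
    by (rule antisymmetric_inversion_integral(2)[OF r _ int inv]) auto
qed

text \<open>The kernels at \<open>w\<close> and at \<open>cmod w\<close> cross exactly once on each side of \<open>t = cmod w\<close>, symmetrically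
  in \<open>ln (t / cmod w)\<close>; hence the second dominates the first on functions that are convex in \<open>ln t\<close>.\<close>

lemma Re_poisson_kernel_le_iff:
  assumes w: "Re w > 0" "Im w \<noteq> 0"
  shows "Re (poisson_kernel w t) \<le> Re (poisson_kernel (of_real (cmod w)) t) \<longleftrightarrow>
    4 * t\<^sup>2 * (cmod w)\<^sup>2 * (1 + Re w / cmod w) \<le> (t\<^sup>2 + (cmod w)\<^sup>2)\<^sup>2"
proof -
  define r x where "r = cmod w" and "x = Re w"
  have r: "r > 0" using w by (metis less_irrefl zero_complex.simps(1) zero_less_norm_iff r_def)
  have y2: "(Im w)\<^sup>2 = r\<^sup>2 - x\<^sup>2" by (simp add: r_def x_def cmod_power2)
  have "x < r" 
  proof -
    have "x\<^sup>2 < r\<^sup>2" using y2 w by (smt (verit) zero_less_power2)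
    then show ?thesis using r by (simp add: power2_less_imp_less)
  qed
  define T where "T = t\<^sup>2 + r\<^sup>2"
  have T: "T > 0" using r by (simp add: T_def add_nonneg_pos)
  have D: "T\<^sup>2 - 4 * t\<^sup>2 * (r\<^sup>2 - x\<^sup>2) > 0"
    using Re_poisson_kernel(2)[OF w(1), of t] unfolding y2 by (simp add: r_def T_def)
  have k1: "Re (poisson_kernel w t) = (2/pi) * (x * T / (T\<^sup>2 - 4 * t\<^sup>2 * (r\<^sup>2 - x\<^sup>2)))"
    unfolding Re_poisson_kernel(1)[OF w(1)] y2 by (simp add: r_def x_def T_def)
  have k2: "Re (poisson_kernel (of_real (cmod w)) t) = (2/pi) * (r * T / T\<^sup>2)"
    using Re_poisson_kernel(1)[of "of_real r" t] r by (simp add: r_def T_def)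
  have "Re (poisson_kernel w t) \<le> Re (poisson_kernel (of_real (cmod w)) t) \<longleftrightarrow>
      x * T / (T\<^sup>2 - 4 * t\<^sup>2 * (r\<^sup>2 - x\<^sup>2)) \<le> r * T / T\<^sup>2"
    unfolding k1 k2 by (subst mult_le_cancel_left_pos) auto
  also have "\<dots> \<longleftrightarrow> T * (x * T\<^sup>2) \<le> T * (r * (T\<^sup>2 - 4 * t\<^sup>2 * (r\<^sup>2 - x\<^sup>2)))"
    using D T by (simp add: divide_simps mult_ac)
  also have "\<dots> \<longleftrightarrow> x * T\<^sup>2 \<le> r * (T\<^sup>2 - 4 * t\<^sup>2 * (r\<^sup>2 - x\<^sup>2))"
    using T by simp
  \<comment> \<open>The factor r - x is positive because Im w \<noteq> 0; cancelling it leaves a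
    condition quadratic in t^2.\<close>
  also have "\<dots> \<longleftrightarrow> (r - x) * (4 * t\<^sup>2 * r * (r + x)) \<le> (r - x) * T\<^sup>2"
    by (simp add: algebra_simps power2_eq_square)
  also have "\<dots> \<longleftrightarrow> 4 * t\<^sup>2 * r * (r + x) \<le> T\<^sup>2"
    by (rule mult_le_cancel_left_pos) (use \<open>x < r\<close> in simp)
  also have "4 * t\<^sup>2 * r * (r + x) = 4 * t\<^sup>2 * r\<^sup>2 * (1 + x / r)"
    using r by (simp add: field_simps power2_eq_square)
  finally show ?thesis by (simp add: r_def x_def T_def)
qed

section \<open>The outer function of a weight\<close>

lemma set_integral_Re:
  assumes "set_integrable M A f"
  shows "Re (LINT t:A|M. f t) = (LINT t:A|M. Re (f t))" "set_integrable M A (\<lambda>t. Re (f t))"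
  using assms integral_Re[of M "\<lambda>t. indicator A t *\<^sub>R f t"] integrable_Re[of M "\<lambda>t. indicator A t *\<^sub>R f t"]
  by (auto simp: set_integrable_def set_lebesgue_integral_def)

lemma DERIV_poisson_kernel:
  assumes nz: "(complex_of_real t)\<^sup>2 + w\<^sup>2 \<noteq> 0"
  shows "((\<lambda>w. poisson_kernel w t) has_field_derivative
    2 * ((of_real t)\<^sup>2 - w\<^sup>2) / (of_real pi * ((of_real t)\<^sup>2 + w\<^sup>2)\<^sup>2)) (at w within S)"
proof -
  define T where "T = (complex_of_real t)\<^sup>2"
  have *: "(2 * (P * D) - 2 * w * (P * (2 * w))) / ((P * D) * (P * D)) = 2 * (D - w\<^sup>2 - w\<^sup>2) / (P * D\<^sup>2)"
    if "P \<noteq> 0" "D \<noteq> 0" for P D :: complex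
    using that by (simp add: divide_simps) (simp add: power2_eq_square algebra_simps)
  have "((\<lambda>w. 2 * w / (of_real pi * (T + w\<^sup>2))) has_field_derivative
      (2 * (of_real pi * (T + w\<^sup>2)) - 2 * w * (of_real pi * (2 * w))) / ((of_real pi * (T + w\<^sup>2)) * (of_real pi * (T + w\<^sup>2)))) (at w within S)"
    using nz unfolding T_def[symmetric] by (auto intro!: derivative_eq_intros)
  then show ?thesis
    using *[of "of_real pi" "T + w\<^sup>2"] nz by (simp add: poisson_kernel_def[abs_def] T_def[symmetric])
qed

text \<open>Outside [-L, L] the nearer endpoint is a convex combination of x and the opposite
  endpoint, which reverses the inequality. With L the crossing point of two kernels, the sign of g -
  chord will match the sign of the difference of the kernels.\<close>

lemma convex_chord:
  fixes g :: "real \<Rightarrow> real"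
  assumes g: "convex_on UNIV g" and L: "L > 0"
  defines "chord \<equiv> \<lambda>x. (g L + g (-L)) / 2 + (g L - g (-L)) / (2 * L) * x"
  shows "\<bar>x\<bar> \<le> L \<Longrightarrow> g x \<le> chord x" and "L \<le> \<bar>x\<bar> \<Longrightarrow> chord x \<le> g x"
proof -
  assume x: "\<bar>x\<bar> \<le> L"
  define u where "u = (x + L) / (2 * L)"
  have u: "0 \<le> u" "u \<le> 1" using x L by (auto simp: u_def divide_le_eq)
  have "(1 - u) * (-L) + u * L = x" using L by (simp add: u_def field_simps)
  then have "g x \<le> (1 - u) * g (-L) + u * g L"
    using convex_onD[OF g, of u "-L" L] u by simp
  also have "\<dots> = chord x" using L by (simp add: u_def chord_def field_simps)
  finally show "g x \<le> chord x" .
next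
  assume x: "L \<le> \<bar>x\<bar>"
  show "chord x \<le> g x"
  proof (cases "x \<ge> 0")
    case True
    then have xL: "x \<ge> L" using x by simp
    define u where "u = 2 * L / (x + L)"
    have u: "0 < u" "u \<le> 1" using xL L by (auto simp: u_def divide_le_eq)
    have "u * (x + L) = 2 * L" using L xL by (simp add: u_def)
    then have "(1 - u) * (-L) + u * x = L" by (simp add: algebra_simps)
    then have "g L \<le> (1 - u) * g (-L) + u * g x"
      using convex_onD[OF g, of u "-L" x] u by simp
    then have "(g L - g (-L)) / u + g (-L) \<le> g x" using u by (simp add: field_simps)
    also have "(g L - g (-L)) / u + g (-L) = chord x" using L xL by (simp add: u_def chord_def field_simps)
    finally show ?thesis .
  next
    case False
    then have xL: "x \<le> -L" using x by simp
    define u where "u = 2 * L / (L - x)"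
    have u: "0 < u" "u \<le> 1" using xL L by (auto simp: u_def divide_le_eq)
    have "u * (L - x) = 2 * L" using L xL by (simp add: u_def)
    then have "(1 - u) * L + u * x = -L" by (simp add: algebra_simps)
    then have "g (-L) \<le> (1 - u) * g L + u * g x"
      using convex_onD[OF g, of u L x] u by simp
    then have "(g (-L) - g L) / u + g L \<le> g x" using u by (simp add: field_simps)
    also have "(g (-L) - g L) / u + g L = chord x" using L xL by (simp add: u_def chord_def field_simps)
    finally show ?thesis .
  qed
qed

text \<open>The properties of phi(|t|) - phi(0) on which the analysis rests, isolated from
  \<open>M\<close>. Subtracting phi(0) makes the weight nonnegative with value 0 at 0. The Lipschitz
  constant 1 reflects that the infimum defining phi is governed by \<xi> < 1.\<close>

locale weight =
  fixes p :: "real \<Rightarrow> real"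
  assumes even: "p (- t) = p t"
    and zero: "p 0 = 0"
    and mono: "0 \<le> a \<Longrightarrow> a \<le> b \<Longrightarrow> p a \<le> p b"
    and lipschitz: "0 \<le> a \<Longrightarrow> a \<le> b \<Longrightarrow> p b - p a \<le> b - a"
    and log_convex: "convex_on UNIV (\<lambda>x. p (exp x))"
    and integrable: "set_integrable lborel {0..} (\<lambda>t. p t / (1 + t\<^sup>2))"
    and dominates_log: "\<forall>\<^sub>F t in at_top. A * ln t \<le> p t"
begin

text \<open>exp (outer w) is the outer function of the half-plane Re w > 0 with boundary modulus exp
  (p t) at i t and -i t; the Poisson extension of \<open>p\<close> is the real part of the
  exponent.\<close>

definition outer :: "complex \<Rightarrow> complex" where
  "outer w = (LBINT t:{0..}. of_real (p t) * poisson_kernel w t)"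

text \<open>Up to the factor 2/pi this is the quotient \<open>poisson y / y\<close>. It decreases to
  0, so comparing \<open>poisson y\<close> with \<open>y * s\<close> means comparing it with
  \<open>s * pi / 2\<close>.\<close>

definition poisson_mean :: "real \<Rightarrow> real" where
  "poisson_mean y = (LBINT t:{0..}. p t / (t\<^sup>2 + y\<^sup>2))"

definition poisson :: "real \<Rightarrow> real" where
  "poisson y = 2 * y / pi * poisson_mean y"

text \<open>The quantity Q(s) of the theorem up to the additive constant phi(0).\<close>

definition legendre :: "real \<Rightarrow> real" where
  "legendre s = (SUP y\<in>{0<..}. poisson y - y * s)"

lemma p_abs: "p \<bar>t\<bar> = p t"
  using even[of t] by (auto simp: abs_if)

lemma nonneg: "p t \<ge> 0"
  using mono[of 0 "\<bar>t\<bar>"] by (simp add: zero p_abs)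

lemma p_le: "t \<ge> 0 \<Longrightarrow> p t \<le> t"
  using lipschitz[of 0 t] by (simp add: zero)

lemma p_continuous: "continuous_on A p"
proof -
  have "dist (p a) (p b) \<le> 1 * dist a b" for a b
  proof -
    have "\<bar>p \<bar>a\<bar> - p \<bar>b\<bar>\<bar> \<le> \<bar>\<bar>a\<bar> - \<bar>b\<bar>\<bar>"
      using lipschitz[of "\<bar>a\<bar>" "\<bar>b\<bar>"] lipschitz[of "\<bar>b\<bar>" "\<bar>a\<bar>"] mono[of "\<bar>a\<bar>" "\<bar>b\<bar>"] mono[of "\<bar>b\<bar>" "\<bar>a\<bar>"]
      by (cases "\<bar>a\<bar> \<le> \<bar>b\<bar>") auto
    then show ?thesis by (simp add: p_abs dist_real_def)
  qed
  then have "1-lipschitz_on A p" by (intro lipschitz_onI) auto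
  then show ?thesis by (rule lipschitz_on_continuous_on)
qed

lemma p_measurable [measurable]: "p \<in> borel_measurable borel"
  by (rule borel_measurable_continuous_onI) (rule p_continuous)

text \<open>The slope is the right derivative of x \<mapsto> p (exp x) at ln r; a comparison with a
  point to the left of r, where \<open>p\<close> is no larger, shows that it is nonnegative.\<close>

lemma support_line:
  assumes r: "r > 0"
  obtains q where "q \<ge> 0" "\<And>t. t > 0 \<Longrightarrow> p r + q * ln (t / r) \<le> p t"
proof -
  define q where "q = Inf ((\<lambda>t. (p (exp (ln r)) - p (exp t)) / (ln r - t)) ` ({ln r<..} \<inter> UNIV))"
  have q: "p (exp y) \<ge> p (exp (ln r)) + q * (y - ln r)" for y
    unfolding q_def by (rule convex_le_Inf_differential[OF log_convex]) auto
  have "p (exp (ln r - 1)) \<le> p (exp (ln r))" by (rule mono) auto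
  with q[of "ln r - 1"] have "q \<ge> 0" by simp
  moreover have "p r + q * ln (t / r) \<le> p t" if "t > 0" for t
    using q[of "ln t"] that r by (simp add: ln_div)
  ultimately show ?thesis using that by blast
qed

lemma p_kernel_integrable:
  assumes w: "Re w > 0"
  shows "set_integrable lborel {0..} (\<lambda>t. of_real (p t) * poisson_kernel w t)"
proof -
  obtain C where C: "C > 0" "\<And>t. t \<ge> 0 \<Longrightarrow> cmod (poisson_kernel w t) \<le> C / (1 + t\<^sup>2)"
    using kernel_bound[OF w] by blast
  have "set_integrable lborel {0..} (\<lambda>t. C * (p t / (1 + t\<^sup>2)))"
    by (intro set_integrable_mult_right integrable)
  then show ?thesis
  proof (rule set_integrable_of_norm_bound)
    fix t :: real assume "t \<in> {0..}"
    then have "p t * cmod (poisson_kernel w t) \<le> p t * (C / (1 + t\<^sup>2))"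
      using C(2) nonneg by (intro mult_left_mono) auto
    then show "norm (of_real (p t) * poisson_kernel w t) \<le> C * (p t / (1 + t\<^sup>2))"
      using nonneg[of t] by (simp add: norm_mult mult_ac)
  qed auto
qed

lemma Re_outer:
  assumes w: "Re w > 0"
  shows "Re (outer w) = (LBINT t:{0..}. p t * Re (poisson_kernel w t))"
    and "set_integrable lborel {0..} (\<lambda>t. p t * Re (poisson_kernel w t))"
  using set_integral_Re[OF p_kernel_integrable[OF w]] by (simp_all add: outer_def)

lemma p_integrable:
  assumes "y > 0" shows "set_integrable lborel {0..} (\<lambda>t. p t / (t\<^sup>2 + y\<^sup>2))"
proof -
  have "set_integrable lborel {0..} (\<lambda>t. 2 * y / pi * (p t / (t\<^sup>2 + y\<^sup>2)))"
    using Re_outer(2)[of "of_real y"] assms by (simp add: Re_poisson_kernel_of_real mult_ac)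
  then have "set_integrable lborel {0..} (\<lambda>t. pi / (2*y) * (2 * y / pi * (p t / (t\<^sup>2 + y\<^sup>2))))"
    by (rule set_integrable_mult_right)
  then show ?thesis using assms by simp
qed

lemma outer_of_real:
  assumes "y > 0" shows "outer (of_real y) = of_real (poisson y)"
proof -
  have "outer (of_real y) = (LBINT t:{0..}. complex_of_real (2 * y / pi * (p t / (t\<^sup>2 + y\<^sup>2))))"
    unfolding outer_def poisson_kernel_def by (simp add: mult_ac)
  also have "\<dots> = of_real (LBINT t:{0..}. 2 * y / pi * (p t / (t\<^sup>2 + y\<^sup>2)))"
    by (rule set_integral_complex_of_real)
  also have "(LBINT t:{0..}. 2 * y / pi * (p t / (t\<^sup>2 + y\<^sup>2))) = poisson y"
    unfolding poisson_def poisson_mean_def by (rule set_integral_mult_right)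
  finally show ?thesis .
qed

text \<open>The truncated integrals are holomorphic by differentiation under the integral sign. On a
  closed disc inside the half-plane the kernel is at most C / (1 + t^2) with one C, so the
  truncation error is at most C times a tail of the convergent integral of p t / (1 + t^2),
  uniformly on the disc.\<close>

lemma outer_holomorphic: "outer holomorphic_on {w. Re w > 0}"
proof (rule holomorphic_uniform_sequence)
  define f where "f = (\<lambda>n w. LBINT t:{0..real n}. of_real (p t) * poisson_kernel w t)"
  have cont: "continuous_on A (\<lambda>t. of_real (p t) * poisson_kernel w t)" if "Re w > 0" for w A
    by (intro continuous_intros continuous_kernel that p_continuous)
  show "f n holomorphic_on {w. Re w > 0}" for n
  proof -
    have eq: "f n w = integral (cbox 0 (real n)) (\<lambda>t. of_real (p t) * poisson_kernel w t)" if "Re w > 0" for w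
      unfolding f_def cbox_interval
      by (rule set_borel_integral_eq_integral) (intro borel_integrable_atLeastAtMost' cont that)
    have "(\<lambda>w. integral (cbox 0 (real n)) (\<lambda>t. of_real (p t) * poisson_kernel w t)) holomorphic_on {w. Re w > 0}"
    proof (rule leibniz_rule_holomorphic[where fx = "\<lambda>w t. of_real (p t) * (2 * ((of_real t)\<^sup>2 - w\<^sup>2) / (of_real pi * ((of_real t)\<^sup>2 + w\<^sup>2)\<^sup>2))"])
      fix w :: complex and t :: real assume "w \<in> {w. 0 < Re w}"
      then have nz: "(complex_of_real t)\<^sup>2 + w\<^sup>2 \<noteq> 0" using kernel_nonzero by auto
      show "((\<lambda>w. of_real (p t) * poisson_kernel w t) has_field_derivative
          of_real (p t) * (2 * ((of_real t)\<^sup>2 - w\<^sup>2) / (of_real pi * ((of_real t)\<^sup>2 + w\<^sup>2)\<^sup>2))) (at w within {w. 0 < Re w})"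
        by (intro DERIV_cmult DERIV_poisson_kernel nz)
    next
      fix w :: complex assume "w \<in> {w. 0 < Re w}"
      then show "(\<lambda>t. of_real (p t) * poisson_kernel w t) integrable_on cbox 0 (real n)"
        by (intro integrable_continuous cont) auto
    next
      have "continuous_on A (\<lambda>x. p (snd x))" for A :: "(complex \<times> real) set"
        by (rule continuous_on_compose2[OF p_continuous[of UNIV]]) (auto intro: continuous_intros)
      then show "continuous_on ({w. 0 < Re w} \<times> cbox 0 (real n))
         (\<lambda>(w, t). of_real (p t) * (2 * ((of_real t)\<^sup>2 - w\<^sup>2) / (of_real pi * ((of_real t)\<^sup>2 + w\<^sup>2)\<^sup>2)))"
        unfolding case_prod_unfold
        by (intro continuous_intros) (auto simp: kernel_nonzero)
    next
      show "convex {w. 0 < Re w}" by (simp add: convex_halfspace_Re_gt)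
    qed
    then show ?thesis by (rule holomorphic_transform) (simp add: eq)
  qed
  show "open {w. 0 < Re w}" by (simp add: open_halfspace_Re_gt)
  fix w0 :: complex assume "w0 \<in> {w. 0 < Re w}"
  then have w0: "Re w0 > 0" by simp
  define d where "d = Re w0 / 2"
  define R where "R = cmod w0 + d"
  define D where "D = (1 + 4*R\<^sup>2)/d\<^sup>2 + 1/d\<^sup>2 + 2"
  define C where "C = 2 * R / pi * D"
  have d: "d > 0" using w0 by (simp add: d_def)
  have R: "R > 0" using d by (simp add: R_def add_nonneg_pos)
  have in_ball: "d \<le> Re w \<and> cmod w \<le> R" if "w \<in> cball w0 d" for w
  proof -
    have "cmod (w0 - w) \<le> d" using that by (simp add: dist_norm)
    moreover have "\<bar>Re (w0 - w)\<bar> \<le> cmod (w0 - w)" by (rule abs_Re_le_cmod)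
    moreover have "cmod w \<le> cmod w0 + cmod (w0 - w)" by (metis norm_minus_commute norm_triangle_sub)
    ultimately show ?thesis by (auto simp: d_def R_def)
  qed
  have kb: "cmod (poisson_kernel w t) \<le> C / (1 + t\<^sup>2)" if w: "w \<in> cball w0 d" and t: "t \<ge> 0" for w t
  proof -
    have Rew: "Re w > 0" "cmod w \<le> R" using in_ball[OF w] d by auto
    have nz: "cmod ((of_real t)\<^sup>2 + w\<^sup>2) > 0" using kernel_nonzero[OF Rew(1)] by simp
    have "1 + t\<^sup>2 \<le> D * cmod ((of_real t)\<^sup>2 + w\<^sup>2)"
      unfolding D_def by (rule kernel_denominator_bound[OF d]) (use in_ball[OF w] t in auto)
    then have "1 / cmod ((of_real t)\<^sup>2 + w\<^sup>2) \<le> D / (1 + t\<^sup>2)"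
      using nz by (simp add: divide_simps add_pos_nonneg)
    then have "2 * cmod w / pi * (1 / cmod ((of_real t)\<^sup>2 + w\<^sup>2)) \<le> 2 * R / pi * (D / (1 + t\<^sup>2))"
      using Rew R by (intro mult_mono divide_right_mono) auto
    then show ?thesis by (simp add: poisson_kernel_def norm_divide norm_mult C_def)
  qed
  define I where "I = (LBINT t:{0..}. p t / (1 + t\<^sup>2))"
  define J where "J = (\<lambda>n. LBINT t:{0..real n}. p t / (1 + t\<^sup>2))"
  have C: "C \<ge> 0" using kb[of w0 0] d by (simp add: order_trans[OF norm_ge_zero])
  have est: "cmod (f n w - outer w) \<le> C * (I - J n)" if w: "w \<in> cball w0 d" for w n
  proof -
    have Rew: "Re w > 0" using in_ball[OF w] d by auto
    have U: "{0..} = {0..real n} \<union> {real n<..}" by auto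
    have i1: "set_integrable lborel {0..real n} (\<lambda>t. of_real (p t) * poisson_kernel w t)"
      "set_integrable lborel {real n<..} (\<lambda>t. of_real (p t) * poisson_kernel w t)"
      by (auto intro: set_integrable_subset[OF p_kernel_integrable[OF Rew]])
    have i2: "set_integrable lborel {0..real n} (\<lambda>t. p t / (1 + t\<^sup>2))"
      "set_integrable lborel {real n<..} (\<lambda>t. p t / (1 + t\<^sup>2))"
      by (auto intro: set_integrable_subset[OF integrable])
    have "outer w - f n w = (LBINT t:{real n<..}. of_real (p t) * poisson_kernel w t)"
      unfolding outer_def f_def U by (subst set_integral_Un) (use i1 in auto)
    then have "cmod (f n w - outer w) = cmod (LBINT t:{real n<..}. of_real (p t) * poisson_kernel w t)"
      by (metis norm_minus_commute)
    also have "\<dots> \<le> (LBINT t:{real n<..}. cmod (of_real (p t) * poisson_kernel w t))"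
      by (rule set_integral_norm_bound[OF i1(2)])
    also have "\<dots> \<le> (LBINT t:{real n<..}. C * (p t / (1 + t\<^sup>2)))"
    proof (rule set_integral_mono)
      show "set_integrable lborel {real n<..} (\<lambda>t. cmod (of_real (p t) * poisson_kernel w t))"
        by (rule set_integrable_norm[OF i1(2)])
      show "set_integrable lborel {real n<..} (\<lambda>t. C * (p t / (1 + t\<^sup>2)))"
        by (intro set_integrable_mult_right i2)
      fix t assume "t \<in> {real n<..}"
      then have "t \<ge> 0" by (smt (verit) greaterThan_iff of_nat_0_le_iff)
      then have "p t * cmod (poisson_kernel w t) \<le> p t * (C / (1 + t\<^sup>2))"
        using kb[OF w] nonneg by (intro mult_left_mono) auto
      then show "cmod (of_real (p t) * poisson_kernel w t) \<le> C * (p t / (1 + t\<^sup>2))"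
        using nonneg[of t] by (simp add: norm_mult mult_ac)
    qed
    also have "\<dots> = C * (LBINT t:{real n<..}. p t / (1 + t\<^sup>2))" by (rule set_integral_mult_right)
    also have "(LBINT t:{real n<..}. p t / (1 + t\<^sup>2)) = I - J n"
      unfolding I_def J_def U by (subst set_integral_Un) (use i2 in auto)
    finally show ?thesis .
  qed
  have J: "J \<longlonglongrightarrow> I"
    unfolding J_def I_def
    by (rule filterlim_compose[OF tendsto_set_lebesgue_integral_at_top[OF _ integrable] filterlim_real_sequentially]) auto
  have "uniform_limit (cball w0 d) f outer sequentially"
  proof (rule uniform_limitI)
    fix e :: real assume e: "e > 0"
    have "(\<lambda>n. C * (I - J n)) \<longlonglongrightarrow> C * (I - I)" by (intro tendsto_intros J)
    then have "\<forall>\<^sub>F n in sequentially. C * (I - J n) < e" using e by (intro order_tendstoD) auto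
    then show "\<forall>\<^sub>F n in sequentially. \<forall>w\<in>cball w0 d. dist (f n w) (outer w) < e"
    proof eventually_elim
      case (elim n)
      then show ?case unfolding dist_norm using est le_less_trans by blast
    qed
  qed
  moreover have "cball w0 d \<subseteq> {w. 0 < Re w}" using in_ball d by fastforce
  ultimately show "\<exists>d>0. cball w0 d \<subseteq> {w. 0 < Re w} \<and> uniform_limit (cball w0 d) f outer sequentially"
    using d by blast
qed

lemma AE_nonzero: "AE t in lborel. t \<noteq> (0::real)"
  by (rule AE_lborel_singleton)

text \<open>Jensen's inequality in the variable ln t: the support line at ln |w| is integrated
  against the kernel, which has mass 1 and mean ln |w|.\<close>

lemma outer_Re_ge:
  assumes w: "Re w > 0"
  shows "p (cmod w) \<le> Re (outer w)"
proof -
  have r: "cmod w > 0" using w by (metis less_irrefl zero_complex.simps(1) zero_less_norm_iff)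
  obtain q where q: "q \<ge> 0" "\<And>t. t > 0 \<Longrightarrow> p (cmod w) + q * ln (t / cmod w) \<le> p t"
    using support_line[OF r] by blast
  have i0: "set_integrable lborel {0..} (\<lambda>t. Re (poisson_kernel w t))" "(LBINT t:{0..}. Re (poisson_kernel w t)) = 1"
    using set_integral_Re[OF kernel_integrable[OF w]] by (simp_all add: kernel_integral[OF w])
  note i1 = kernel_log_integral[OF w]
  have "p (cmod w) = p (cmod w) * (LBINT t:{0..}. Re (poisson_kernel w t)) + q * (LBINT t:{0..}. ln (t / cmod w) * Re (poisson_kernel w t))"
    by (simp add: i0 i1)
  also have "\<dots> = (LBINT t:{0..}. p (cmod w) * Re (poisson_kernel w t) + q * (ln (t / cmod w) * Re (poisson_kernel w t)))"
    by (subst set_integral_add) (auto intro!: set_integrable_mult_right i0 i1 simp del: times_divide_eq_right)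
  also have "\<dots> \<le> (LBINT t:{0..}. p t * Re (poisson_kernel w t))"
  proof (rule set_integral_mono_AE)
    show "set_integrable lborel {0..} (\<lambda>t. p (cmod w) * Re (poisson_kernel w t) + q * (ln (t / cmod w) * Re (poisson_kernel w t)))"
      by (intro set_integral_add set_integrable_mult_right i0 i1)
    show "set_integrable lborel {0..} (\<lambda>t. p t * Re (poisson_kernel w t))" by (rule Re_outer(2)[OF w])
    show "AE t\<in>{0..} in lborel. p (cmod w) * Re (poisson_kernel w t) + q * (ln (t / cmod w) * Re (poisson_kernel w t))
       \<le> p t * Re (poisson_kernel w t)"
      using AE_nonzero
    proof eventually_elim
      case (elim t)
      show ?case
      proof
        assume "t \<in> {0..}"
        then have "(p (cmod w) + q * ln (t / cmod w)) * Re (poisson_kernel w t) \<le> p t * Re (poisson_kernel w t)"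
          using q elim Re_poisson_kernel_nonneg[OF w] by (intro mult_right_mono) auto
        then show "p (cmod w) * Re (poisson_kernel w t) + q * (ln (t / cmod w) * Re (poisson_kernel w t))
           \<le> p t * Re (poisson_kernel w t)" by (simp add: algebra_simps)
      qed
    qed
  qed
  finally show ?thesis by (simp add: Re_outer(1)[OF w])
qed

lemma poisson_ge: "y > 0 \<Longrightarrow> p y \<le> poisson y"
  using outer_Re_ge[of "of_real y"] outer_of_real[of y] by simp

text \<open>The kernels at w and at |w| have equal mass and equal mean of ln t, so an affine
  function of ln t may be subtracted from \<open>p\<close> without changing the comparison of the
  two integrals. The chord of \<open>p\<close> between the crossing points ln (t / r) = L and -L
  makes (p - chord) (k0 - k1) nonnegative for all t > 0.\<close>

lemma outer_Re_le:
  assumes w: "Re w > 0"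
  shows "Re (outer w) \<le> poisson (cmod w)"
proof (cases "Im w = 0")
  case True
  then have "w = of_real (cmod w)" using w by (simp add: complex_eq_iff cmod_def)
  then have "outer w = of_real (poisson (cmod w))"
    using outer_of_real[of "cmod w"] w by (metis complex_Re_le_cmod less_le_trans)
  then show ?thesis by simp
next
  case False
  define r where "r = cmod w"
  have r: "r > 0" using w unfolding r_def by (metis less_irrefl zero_complex.simps(1) zero_less_norm_iff)
  define \<kappa> where "\<kappa> = Re w / r"
  have \<kappa>: "\<kappa> > 0" using w r by (simp add: \<kappa>_def)
  \<comment> \<open>The kernels cross where \<tau> = t / r satisfies \<tau>^2 - 2 sqrt (1 +
    \<kappa>) \<tau> + 1 = 0; \<open>b\<close> is the larger root and 1/b the other.\<close>
  define b where "b = sqrt (1 + \<kappa>) + sqrt \<kappa>"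
  have b1: "b > 1"
  proof -
    have "sqrt (1 + \<kappa>) > 1" "sqrt \<kappa> > 0" using \<kappa> by auto
    then show ?thesis unfolding b_def by linarith
  qed
  have binv: "1 / b = sqrt (1 + \<kappa>) - sqrt \<kappa>"
  proof -
    have "b * (sqrt (1 + \<kappa>) - sqrt \<kappa>) = 1" using \<kappa> by (simp add: b_def algebra_simps)
    then show ?thesis using b1 by (simp add: field_simps)
  qed
  define L where "L = ln b"
  have L: "L > 0" using b1 by (simp add: L_def)
  define g where "g = (\<lambda>x. p (r * exp x))"
  have g: "convex_on UNIV g"
  proof -
    have "g = (\<lambda>x. p (exp (x + ln r)))" using r by (auto simp: g_def exp_add mult.commute)
    moreover have "convex_on UNIV (\<lambda>x. p (exp (x + ln r)))"
    proof (intro convex_onI)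
      fix t x y :: real assume t: "0 < t" "t < 1"
      have "(1 - t) *\<^sub>R x + t *\<^sub>R y + ln r = (1 - t) *\<^sub>R (x + ln r) + t *\<^sub>R (y + ln r)" by (simp add: algebra_simps)
      then show "p (exp ((1 - t) *\<^sub>R x + t *\<^sub>R y + ln r)) \<le> (1 - t) * p (exp (x + ln r)) + t * p (exp (y + ln r))"
        using convex_onD[OF log_convex, of t "x + ln r" "y + ln r"] t by simp
    qed simp
    ultimately show ?thesis by simp
  qed
  define A where "A = (g L + g (-L)) / 2"
  define B where "B = (g L - g (-L)) / (2 * L)"
  note chord = convex_chord[OF g L, folded A_def B_def]
  define k0 k1 where "k0 = (\<lambda>t. Re (poisson_kernel (of_real r) t))" and "k1 = (\<lambda>t. Re (poisson_kernel w t))"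
  have cross: "k1 t \<le> k0 t \<longleftrightarrow> L \<le> \<bar>ln (t / r)\<bar>" if t: "t > 0" for t
  proof -
    define \<tau> where "\<tau> = t / r"
    have \<tau>: "\<tau> > 0" "t = r * \<tau>" using t r by (simp_all add: \<tau>_def)
    have "k1 t \<le> k0 t \<longleftrightarrow> 4 * t\<^sup>2 * r\<^sup>2 * (1 + \<kappa>) \<le> (t\<^sup>2 + r\<^sup>2)\<^sup>2"
      unfolding k0_def k1_def r_def \<kappa>_def by (rule Re_poisson_kernel_le_iff[OF w False])
    also have "4 * t\<^sup>2 * r\<^sup>2 * (1 + \<kappa>) = (2 * t * r * sqrt (1 + \<kappa>))\<^sup>2"
      using \<kappa> by (simp add: power_mult_distrib)
    also have "\<dots> \<le> (t\<^sup>2 + r\<^sup>2)\<^sup>2 \<longleftrightarrow> 2 * t * r * sqrt (1 + \<kappa>) \<le> t\<^sup>2 + r\<^sup>2"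
      using t r \<kappa> by (intro power_mono_iff) auto
    also have "2 * t * r * sqrt (1 + \<kappa>) = r\<^sup>2 * (\<tau> * (b + 1/b))"
      unfolding binv \<tau>(2) by (simp add: b_def power2_eq_square)
    also have "t\<^sup>2 + r\<^sup>2 = r\<^sup>2 * (\<tau>\<^sup>2 + 1)" unfolding \<tau>(2) by (simp add: power_mult_distrib algebra_simps)
    also have "r\<^sup>2 * (\<tau> * (b + 1/b)) \<le> r\<^sup>2 * (\<tau>\<^sup>2 + 1) \<longleftrightarrow> \<tau> * (b + 1/b) \<le> \<tau>\<^sup>2 + 1"
      using r by (intro mult_le_cancel_left_pos) auto
    also have "\<dots> \<longleftrightarrow> 0 \<le> (\<tau> - b) * (\<tau> - 1/b)"
    proof -
      have "(\<tau> - b) * (\<tau> - 1/b) = \<tau>\<^sup>2 + 1 - \<tau> * (b + 1/b)" using b1 by (simp add: field_simps power2_eq_square)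
      then show ?thesis by simp
    qed
    also have "\<dots> \<longleftrightarrow> b \<le> \<tau> \<or> \<tau> \<le> 1/b"
    proof -
      have "1/b < b" using b1 by (simp add: divide_less_eq power2_eq_square[symmetric])
      then show ?thesis by (auto simp: zero_le_mult_iff)
    qed
    also have "b \<le> \<tau> \<longleftrightarrow> L \<le> ln \<tau>" using b1 \<tau> by (simp add: L_def)
    also have "\<tau> \<le> 1/b \<longleftrightarrow> ln \<tau> \<le> - L"
    proof -
      have "\<tau> \<le> 1/b \<longleftrightarrow> ln \<tau> \<le> ln (1/b)" using b1 \<tau> by simp
      then show ?thesis using b1 by (simp add: L_def ln_div)
    qed
    finally show ?thesis by (auto simp: \<tau>_def)
  qed
  have w0: "Re (complex_of_real r) > 0" using r by simp
  have i0: "set_integrable lborel {0..} k0" "(LBINT t:{0..}. k0 t) = 1"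
    using set_integral_Re[OF kernel_integrable[OF w0]] by (simp_all add: kernel_integral[OF w0] k0_def)
  have i1: "set_integrable lborel {0..} k1" "(LBINT t:{0..}. k1 t) = 1"
    using set_integral_Re[OF kernel_integrable[OF w]] by (simp_all add: kernel_integral[OF w] k1_def)
  have l0: "set_integrable lborel {0..} (\<lambda>t. ln (t / r) * k0 t)" "(LBINT t:{0..}. ln (t / r) * k0 t) = 0"
    using kernel_log_integral[OF w0] r by (simp_all add: k0_def)
  have l1: "set_integrable lborel {0..} (\<lambda>t. ln (t / r) * k1 t)" "(LBINT t:{0..}. ln (t / r) * k1 t) = 0"
    using kernel_log_integral[OF w] by (simp_all add: k1_def r_def)
  have p0: "set_integrable lborel {0..} (\<lambda>t. p t * k0 t)" "(LBINT t:{0..}. p t * k0 t) = poisson r"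
    using Re_outer[OF w0] outer_of_real[OF r] by (simp_all add: k0_def)
  have p1: "set_integrable lborel {0..} (\<lambda>t. p t * k1 t)" "(LBINT t:{0..}. p t * k1 t) = Re (outer w)"
    using Re_outer[OF w] by (simp_all add: k1_def)
  have a0: "(LBINT t:{0..}. A * k0 t + B * (ln (t / r) * k0 t)) = A"
    by (subst set_integral_add) (auto intro!: set_integrable_mult_right i0 l0 simp: i0 l0 simp del: times_divide_eq_right)
  have a1: "(LBINT t:{0..}. A * k1 t + B * (ln (t / r) * k1 t)) = A"
    by (subst set_integral_add) (auto intro!: set_integrable_mult_right i1 l1 simp: i1 l1 simp del: times_divide_eq_right)
  have s0: "set_integrable lborel {0..} (\<lambda>t. A * k0 t + B * (ln (t / r) * k0 t))"
    by (intro set_integral_add set_integrable_mult_right i0 l0)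
  have s1: "set_integrable lborel {0..} (\<lambda>t. A * k1 t + B * (ln (t / r) * k1 t))"
    by (intro set_integral_add set_integrable_mult_right i1 l1)
  \<comment> \<open>The inequality (p - chord) (k0 - k1) \<ge> 0 with its terms arranged as sums of
    integrable functions; the chord contributes \<open>A\<close> to either side. It is used almost
    everywhere because ln (t / r) is meaningful only for t > 0.\<close>
  have "(LBINT t:{0..}. p t * k1 t + (A * k0 t + B * (ln (t / r) * k0 t)))
      \<le> (LBINT t:{0..}. p t * k0 t + (A * k1 t + B * (ln (t / r) * k1 t)))"
  proof (rule set_integral_mono_AE)
    show "set_integrable lborel {0..} (\<lambda>t. p t * k1 t + (A * k0 t + B * (ln (t / r) * k0 t)))"
      by (intro set_integral_add p1 s0)
    show "set_integrable lborel {0..} (\<lambda>t. p t * k0 t + (A * k1 t + B * (ln (t / r) * k1 t)))"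
      by (intro set_integral_add p0 s1)
    show "AE t\<in>{0..} in lborel. p t * k1 t + (A * k0 t + B * (ln (t / r) * k0 t))
       \<le> p t * k0 t + (A * k1 t + B * (ln (t / r) * k1 t))"
      using AE_nonzero
    proof eventually_elim
      case (elim t)
      show ?case
      proof
        assume "t \<in> {0..}"
        then have t: "t > 0" using elim by simp
        have gt: "g (ln (t / r)) = p t" using t r by (simp add: g_def)
        have "0 \<le> (p t - (A + B * ln (t / r))) * (k0 t - k1 t)"
        proof (cases "L \<le> \<bar>ln (t / r)\<bar>")
          case True
          then show ?thesis using cross[OF t] chord(2)[OF True] gt by (intro mult_nonneg_nonneg) auto
        next
          case False
          then show ?thesis using cross[OF t] chord(1)[of "ln (t/r)"] gt by (intro mult_nonpos_nonpos) auto
        qed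
        then show "p t * k1 t + (A * k0 t + B * (ln (t / r) * k0 t))
          \<le> p t * k0 t + (A * k1 t + B * (ln (t / r) * k1 t))" by (simp add: algebra_simps)
      qed
    qed
  qed
  moreover have "(LBINT t:{0..}. p t * k1 t + (A * k0 t + B * (ln (t / r) * k0 t))) = Re (outer w) + A"
    using set_integral_add(2)[OF p1(1) s0] p1(2) a0 by simp
  moreover have "(LBINT t:{0..}. p t * k0 t + (A * k1 t + B * (ln (t / r) * k1 t))) = poisson r + A"
    using set_integral_add(2)[OF p0(1) s1] p0(2) a1 by simp
  ultimately show ?thesis by (simp add: r_def)
qed

end

section \<open>The Legendre transform of the Poisson extension\<close>

context weight begin

lemma poisson_nonneg: "y > 0 \<Longrightarrow> poisson y \<ge> 0"
  using poisson_ge[of y] nonneg[of y] by linarith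

text \<open>On [y, 2y] one has p t \<ge> p y, t^2 + y^2 \<le> 5 y^2 and t^2 + z^2 \<ge> y^2 + z^2;
  elsewhere the integrand is nonnegative. This quantifies the decrease of
  \<open>poisson y / y\<close> in terms of the single value p y.\<close>

lemma poisson_mean_diff:
  assumes y: "0 < y" and z: "2 * y \<le> z"
  shows "p y * y * (1 / (5 * y\<^sup>2) - 1 / (y\<^sup>2 + z\<^sup>2)) \<le> poisson_mean y - poisson_mean z"
proof -
  have z0: "z > 0" using y z by simp
  have d: "1 / (t\<^sup>2 + z\<^sup>2) \<le> 1 / (t\<^sup>2 + y\<^sup>2)" for t
    using y z by (intro divide_left_mono mult_pos_pos add_nonneg_pos power_mono add_left_mono) auto
  have i: "set_integrable lborel {0..} (\<lambda>t. p t / (t\<^sup>2 + y\<^sup>2) - p t / (t\<^sup>2 + z\<^sup>2))"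
    by (intro set_integral_diff p_integrable y z0)
  have const: "(LBINT t:{y..2*y}. c) = y * c" for c :: real
    using y by (simp add: set_integral_const)
  have "p y * y * (1 / (5 * y\<^sup>2) - 1 / (y\<^sup>2 + z\<^sup>2)) = (LBINT t:{y..2*y}. p y * (1 / (5 * y\<^sup>2) - 1 / (y\<^sup>2 + z\<^sup>2)))"
    unfolding const by simp
  also have "\<dots> \<le> (LBINT t:{y..2*y}. p t / (t\<^sup>2 + y\<^sup>2) - p t / (t\<^sup>2 + z\<^sup>2))"
  proof (rule set_integral_mono)
    show "set_integrable lborel {y..2*y} (\<lambda>t. p y * (1 / (5 * y\<^sup>2) - 1 / (y\<^sup>2 + z\<^sup>2)))"
      by (rule borel_integrable_atLeastAtMost') (rule continuous_on_const)
    show "set_integrable lborel {y..2*y} (\<lambda>t. p t / (t\<^sup>2 + y\<^sup>2) - p t / (t\<^sup>2 + z\<^sup>2))"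
      by (rule set_integrable_subset[OF i]) (use y in auto)
    fix t assume t: "t \<in> {y..2*y}"
    have t2: "t\<^sup>2 \<le> 4 * y\<^sup>2" "y\<^sup>2 \<le> t\<^sup>2" using t y power_mono[of t "2*y" 2] power_mono[of y t 2] by (auto simp: power_mult_distrib)
    have "1 / (5 * y\<^sup>2) \<le> 1 / (t\<^sup>2 + y\<^sup>2)" using t2 y by (intro divide_left_mono mult_pos_pos) (auto simp: add_nonneg_pos)
    moreover have "1 / (t\<^sup>2 + z\<^sup>2) \<le> 1 / (y\<^sup>2 + z\<^sup>2)" using t2 y z0 by (intro divide_left_mono mult_pos_pos) (auto simp: add_pos_nonneg add_nonneg_pos)
    moreover have "1 / (y\<^sup>2 + z\<^sup>2) \<le> 1 / (5 * y\<^sup>2)"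
      using y power_mono[OF z, of 2] by (intro divide_left_mono mult_pos_pos) (auto simp: power_mult_distrib add_pos_nonneg)
    ultimately have "p y * (1 / (5 * y\<^sup>2) - 1 / (y\<^sup>2 + z\<^sup>2)) \<le> p t * (1 / (t\<^sup>2 + y\<^sup>2) - 1 / (t\<^sup>2 + z\<^sup>2))"
      using t y nonneg by (intro mult_mono mono) auto
    then show "p y * (1 / (5 * y\<^sup>2) - 1 / (y\<^sup>2 + z\<^sup>2)) \<le> p t / (t\<^sup>2 + y\<^sup>2) - p t / (t\<^sup>2 + z\<^sup>2)"
      by (simp add: algebra_simps)
  qed
  also have "\<dots> \<le> (LBINT t:{0..}. p t / (t\<^sup>2 + y\<^sup>2) - p t / (t\<^sup>2 + z\<^sup>2))"
  proof -
    have nn: "0 \<le> p t / (t\<^sup>2 + y\<^sup>2) - p t / (t\<^sup>2 + z\<^sup>2)" for t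
      using mult_left_mono[OF d nonneg[of t]] by simp
    have "integral\<^sup>L lborel (\<lambda>t. indicator {y..2*y} t *\<^sub>R (p t / (t\<^sup>2 + y\<^sup>2) - p t / (t\<^sup>2 + z\<^sup>2)))
      \<le> integral\<^sup>L lborel (\<lambda>t. indicator {0..} t *\<^sub>R (p t / (t\<^sup>2 + y\<^sup>2) - p t / (t\<^sup>2 + z\<^sup>2)))"
    proof (rule integral_mono)
      show "Bochner_Integration.integrable lborel (\<lambda>t. indicator {y..2*y} t *\<^sub>R (p t / (t\<^sup>2 + y\<^sup>2) - p t / (t\<^sup>2 + z\<^sup>2)))"
        using set_integrable_subset[OF i, of "{y..2*y}"] y by (auto simp: set_integrable_def)
      show "Bochner_Integration.integrable lborel (\<lambda>t. indicator {0..} t *\<^sub>R (p t / (t\<^sup>2 + y\<^sup>2) - p t / (t\<^sup>2 + z\<^sup>2)))"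
        using i by (simp add: set_integrable_def)
      show "indicator {y..2*y} t *\<^sub>R (p t / (t\<^sup>2 + y\<^sup>2) - p t / (t\<^sup>2 + z\<^sup>2))
         \<le> indicator {0..} t *\<^sub>R (p t / (t\<^sup>2 + y\<^sup>2) - p t / (t\<^sup>2 + z\<^sup>2))" for t
        using nn[of t] y by (auto simp: indicator_def)
    qed
    then show ?thesis by (simp add: set_lebesgue_integral_def)
  qed
  also have "\<dots> = poisson_mean y - poisson_mean z"
    unfolding poisson_mean_def by (rule set_integral_diff(2)) (intro p_integrable y z0)+
  finally show ?thesis .
qed

lemma poisson_mean_antimono:
  assumes y: "0 < y" "y \<le> z" shows "poisson_mean z \<le> poisson_mean y"
  unfolding poisson_mean_def
proof (rule set_integral_mono)
  fix t
  have "1 / (t\<^sup>2 + z\<^sup>2) \<le> 1 / (t\<^sup>2 + y\<^sup>2)"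
    using y by (intro divide_left_mono mult_pos_pos add_nonneg_pos power_mono add_left_mono) auto
  then have d: "1 / (t\<^sup>2 + z\<^sup>2) \<le> 1 / (t\<^sup>2 + y\<^sup>2)" .
  show "p t / (t\<^sup>2 + z\<^sup>2) \<le> p t / (t\<^sup>2 + y\<^sup>2)" using mult_left_mono[OF d nonneg[of t]] by simp
qed (use y in \<open>auto intro: p_integrable\<close>)

lemma poisson_mean_tendsto: "(poisson_mean \<longlongrightarrow> 0) at_top"
proof -
  have "((\<lambda>y. integral\<^sup>L lborel (\<lambda>t. indicator {0..} t *\<^sub>R (p t / (t\<^sup>2 + y\<^sup>2)))) \<longlongrightarrow> integral\<^sup>L lborel (\<lambda>t::real. 0::real)) at_top"
  proof (rule integral_dominated_convergence_at_top[where w="\<lambda>t. indicator {0..} t *\<^sub>R (p t / (1 + t\<^sup>2))"])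
    show "Bochner_Integration.integrable lborel (\<lambda>t. indicator {0..} t *\<^sub>R (p t / (1 + t\<^sup>2)))"
      using integrable by (simp add: set_integrable_def)
    show "AE t in lborel. ((\<lambda>y. indicator {0..} t *\<^sub>R (p t / (t\<^sup>2 + y\<^sup>2))) \<longlongrightarrow> 0) at_top"
    proof (rule AE_I2)
      fix t :: real
      have "filterlim (\<lambda>y::real. t\<^sup>2 + y\<^sup>2) at_top at_top"
        by (intro filterlim_tendsto_add_at_top[OF tendsto_const] filterlim_pow_at_top filterlim_ident) auto
      then have "((\<lambda>y. p t / (t\<^sup>2 + y\<^sup>2)) \<longlongrightarrow> 0) at_top"
        by (intro tendsto_divide_0[OF tendsto_const] filterlim_at_top_imp_at_infinity)
      then have "((\<lambda>y. indicator {0..} t *\<^sub>R (p t / (t\<^sup>2 + y\<^sup>2))) \<longlongrightarrow> indicator {0..} t *\<^sub>R 0) at_top"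
        by (intro tendsto_intros)
      then show "((\<lambda>y. indicator {0..} t *\<^sub>R (p t / (t\<^sup>2 + y\<^sup>2))) \<longlongrightarrow> 0) at_top" by simp
    qed
    show "\<forall>\<^sub>F y in at_top. AE t in lborel. norm (indicator {0..} t *\<^sub>R (p t / (t\<^sup>2 + y\<^sup>2))) \<le> indicator {0..} t *\<^sub>R (p t / (1 + t\<^sup>2))"
      using eventually_ge_at_top[of 1]
    proof eventually_elim
      case (elim y)
      have "p t / (t\<^sup>2 + y\<^sup>2) \<le> p t / (1 + t\<^sup>2)" for t
      proof -
        have "1 \<le> y\<^sup>2" using elim by (simp add: one_le_power)
        then show ?thesis using nonneg elim by (intro divide_left_mono mult_pos_pos) (auto simp: add_pos_nonneg add_nonneg_pos)
      qed
      then show ?case using nonneg by (intro AE_I2) (auto simp: indicator_def)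
    qed
  qed auto
  then show ?thesis by (simp add: poisson_mean_def[abs_def] set_lebesgue_integral_def)
qed

lemma poisson_continuous: "continuous_on {0<..} poisson"
proof -
  have "continuous_on {0<..} (\<lambda>y. Re (outer (of_real y)))"
    by (intro continuous_intros continuous_on_compose2[OF holomorphic_on_imp_continuous_on[OF outer_holomorphic]]) auto
  then show ?thesis by (rule continuous_on_eq) (simp add: outer_of_real)
qed

text \<open>For t \<le> 1 the weight is at most 1 and the kernel has total mass 1; for t \<ge> 1 the
  bound 1/(t^2 + y^2) \<le> 2/(1 + t^2) leaves the convergent integral of p t / (1 + t^2), uniformly
  in y \<le> Y.\<close>

lemma poisson_bounded_near_zero:
  assumes Y: "Y > 0"
  obtains B where "\<And>y. 0 < y \<Longrightarrow> y \<le> Y \<Longrightarrow> poisson y \<le> B"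
proof
  fix y assume y: "0 < y" "y \<le> Y"
  have w: "Re (complex_of_real y) > 0" using y by simp
  have i: "set_integrable lborel {0..} (\<lambda>t. Re (poisson_kernel (of_real y) t))" "(LBINT t:{0..}. Re (poisson_kernel (of_real y) t)) = 1"
    using set_integral_Re[OF kernel_integrable[OF w]] by (simp_all add: kernel_integral[OF w])
  have "poisson y = (LBINT t:{0..}. p t * Re (poisson_kernel (of_real y) t))"
    using Re_outer(1)[OF w] outer_of_real[OF y(1)] by simp
  also have "\<dots> \<le> (LBINT t:{0..}. Re (poisson_kernel (of_real y) t) + 4 * Y / pi * (p t / (1 + t\<^sup>2)))"
  proof (rule set_integral_mono)
    show "set_integrable lborel {0..} (\<lambda>t. p t * Re (poisson_kernel (of_real y) t))" by (rule Re_outer(2)[OF w])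
    show "set_integrable lborel {0..} (\<lambda>t. Re (poisson_kernel (of_real y) t) + 4 * Y / pi * (p t / (1 + t\<^sup>2)))"
      by (intro set_integral_add i set_integrable_mult_right integrable)
    fix t :: real assume "t \<in> {0..}"
    then have t: "t \<ge> 0" by simp
    have k0: "Re (poisson_kernel (of_real y) t) \<ge> 0" by (rule Re_poisson_kernel_nonneg[OF w])
    show "p t * Re (poisson_kernel (of_real y) t) \<le> Re (poisson_kernel (of_real y) t) + 4 * Y / pi * (p t / (1 + t\<^sup>2))"
    proof (cases "t \<le> 1")
      case True
      then have "p t \<le> 1" using p_le[OF t] by simp
      then have "p t * Re (poisson_kernel (of_real y) t) \<le> 1 * Re (poisson_kernel (of_real y) t)"
        using k0 by (intro mult_right_mono) auto
      moreover have "0 \<le> 4 * Y / pi * (p t / (1 + t\<^sup>2))" using Y nonneg[of t] by simp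
      ultimately show ?thesis by simp
    next
      case False
      then have "1 \<le> t\<^sup>2" by (simp add: one_le_power)
      then have "(1 + t\<^sup>2) / 2 \<le> t\<^sup>2 + y\<^sup>2" using zero_le_power2[of y] by argo
      then have "1 / (t\<^sup>2 + y\<^sup>2) \<le> 1 / ((1 + t\<^sup>2) / 2)" using y by (intro divide_left_mono mult_pos_pos) (auto simp: add_pos_nonneg add_nonneg_pos)
      then have "2 * y / pi * (1 / (t\<^sup>2 + y\<^sup>2)) \<le> 2 * Y / pi * (2 / (1 + t\<^sup>2))"
        using y by (intro mult_mono divide_right_mono) auto
      then have "p t * Re (poisson_kernel (of_real y) t) \<le> p t * (2 * Y / pi * (2 / (1 + t\<^sup>2)))"
        unfolding Re_poisson_kernel_of_real by (intro mult_left_mono nonneg)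
      then show ?thesis using k0 by (simp add: mult_ac)
    qed
  qed
  also have "\<dots> = 1 + 4 * Y / pi * (LBINT t:{0..}. p t / (1 + t\<^sup>2))"
    by (subst set_integral_add) (auto intro!: set_integrable_mult_right i integrable simp: i simp del: times_divide_eq_right times_divide_eq_left)
  finally show "poisson y \<le> 1 + 4 * Y / pi * (LBINT t:{0..}. p t / (1 + t\<^sup>2))" .
qed

text \<open>\<open>poisson_mean y < s * pi / 2\<close> is the same as
  \<open>poisson y < y * s\<close>, and holds for large y; on the remaining bounded interval
  \<open>poisson\<close> is bounded.\<close>

lemma legendre_bdd:
  assumes s: "s > 0" shows "bdd_above ((\<lambda>y. poisson y - y * s) ` {0<..})"
proof -
  have "\<forall>\<^sub>F y in at_top. poisson_mean y < s * pi / 2"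
    using poisson_mean_tendsto s by (intro order_tendstoD) auto
  then obtain Y0 where Y0: "\<And>y. y \<ge> Y0 \<Longrightarrow> poisson_mean y < s * pi / 2" by (auto simp: eventually_at_top_linorder)
  define Y where "Y = max Y0 1"
  have Y: "Y > 0" "\<And>y. y \<ge> Y \<Longrightarrow> poisson_mean y < s * pi / 2" using Y0 by (auto simp: Y_def)
  obtain B where B: "\<And>y. 0 < y \<Longrightarrow> y \<le> Y \<Longrightarrow> poisson y \<le> B"
    using poisson_bounded_near_zero[OF Y(1)] by blast
  show ?thesis
  proof (rule bdd_aboveI2[where M="max B 0"])
    fix y :: real assume "y \<in> {0<..}"
    then have y: "y > 0" by simp
    show "poisson y - y * s \<le> max B 0"
    proof (cases "y \<le> Y")
      case True
      have "0 \<le> y * s" using y s by simp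
      then show ?thesis using B[OF y True] by linarith
    next
      case False
      then have "2 * y / pi * poisson_mean y \<le> 2 * y / pi * (s * pi / 2)"
        using Y(2)[of y] y by (intro mult_left_mono) auto
      then have "poisson y \<le> y * s" using y by (simp add: poisson_def)
      then show ?thesis by simp
    qed
  qed
qed

lemma legendre_upper: "s > 0 \<Longrightarrow> y > 0 \<Longrightarrow> poisson y - y * s \<le> legendre s"
  unfolding legendre_def by (rule cSUP_upper[OF _ legendre_bdd]) auto

lemma legendre_nonneg:
  assumes s: "s > 0" shows "legendre s \<ge> 0"
proof (rule field_le_epsilon)
  fix e :: real assume e: "e > 0"
  have "poisson (e / s) - (e / s) * s \<le> legendre s" using s e by (intro legendre_upper) auto
  moreover have "poisson (e / s) \<ge> 0" using s e by (intro poisson_nonneg) auto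
  ultimately show "0 \<le> legendre s + e" using s by simp
qed

lemma legendre_near_maximizer:
  assumes "s > 0" "\<epsilon> > 0"
  obtains y where "y > 0" "legendre s - \<epsilon> < poisson y - y * s"
proof -
  have "legendre s - \<epsilon> < (SUP y\<in>{0<..}. poisson y - y * s)" using assms by (simp add: legendre_def)
  then show ?thesis using that by (subst (asm) less_cSUP_iff[OF _ legendre_bdd[OF assms(1)]]) auto
qed

lemma weight_at_top: "filterlim p at_top at_top"
proof -
  have "\<forall>\<^sub>F t in at_top. ln t \<le> p t" using dominates_log[of 1] by simp
  then show ?thesis by (rule filterlim_at_top_mono[OF ln_at_top])
qed

lemma legendre_at_top: "filterlim legendre at_top (at_right 0)"
proof (rule filterlim_at_top[THEN iffD2], rule allI)
  fix K :: real
  have "\<forall>\<^sub>F y in at_top. K + 1 \<le> p y" using weight_at_top by (simp add: filterlim_at_top)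
  then have "\<forall>\<^sub>F y in at_top. K + 1 \<le> p y \<and> y \<ge> 1" by (intro eventually_conj eventually_ge_at_top)
  then obtain y where y: "K + 1 \<le> p y" "y \<ge> 1" using eventually_happens'[OF trivial_limit_at_top_linorder] by blast
  have "\<forall>\<^sub>F s in at_right 0. s \<in> {0<..<1/y}" using y by (intro eventually_at_right_real) auto
  then show "\<forall>\<^sub>F s in at_right 0. K \<le> legendre s"
  proof eventually_elim
    case (elim s)
    then have "y * s \<le> 1" using y by (auto simp: field_simps)
    moreover have "poisson y - y * s \<le> legendre s" using elim y by (intro legendre_upper) auto
    moreover have "p y \<le> poisson y" using y by (intro poisson_ge) auto
    ultimately show ?case using y by linarith
  qed
qed

text \<open>For a point Y with s Y \<le> poisson Y, the trial value y = sqrt Y gives legendre s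
  \<ge> poisson y - y s \<ge> poisson y - poisson (y^2) / y. The last expression is 2y/pi times the
  drop of \<open>poisson_mean\<close> from y to y^2, hence at least p y / (5 pi), which beats every
  multiple of ln Y = 2 ln y. This is what makes losses polynomial in Y negligible.\<close>

lemma legendre_dominates_log:
  obtains K where "\<And>s Y. 0 < s \<Longrightarrow> 1 \<le> Y \<Longrightarrow> s * Y \<le> poisson Y \<Longrightarrow> A * ln Y \<le> legendre s + K"
proof -
  have "\<forall>\<^sub>F y in at_top. 10 * pi * A * ln y \<le> p y" by (rule dominates_log)
  then obtain y1 where y1: "\<And>y. y \<ge> y1 \<Longrightarrow> 10 * pi * A * ln y \<le> p y" by (auto simp: eventually_at_top_linorder)
  \<comment> \<open>The factor 10 pi combines the 2 of ln Y = 2 ln y with the divisor 5 pi; y \<ge>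
    4 is enough for 10 y^2 \<le> y^2 + y^4.\<close>
  define y0 where "y0 = max y1 4"
  have y0: "y0 \<ge> 4" "\<And>y. y \<ge> y0 \<Longrightarrow> 10 * pi * A * ln y \<le> p y" using y1 by (auto simp: y0_def)
  define K where "K = \<bar>A\<bar> * ln (y0\<^sup>2)"
  have K: "K \<ge> 0" unfolding K_def using y0 by (intro mult_nonneg_nonneg) (auto simp: one_le_power)
  show ?thesis
  proof
    fix s Y :: real assume s: "0 < s" and Y: "1 \<le> Y" and sY: "s * Y \<le> poisson Y"
    show "A * ln Y \<le> legendre s + K"
    proof (cases "Y \<le> y0\<^sup>2")
      case True
      have "ln Y \<le> ln (y0\<^sup>2)" by (subst ln_le_cancel_iff) (use Y True in linarith)+
      then have "A * ln Y \<le> \<bar>A\<bar> * ln (y0\<^sup>2)" using Y by (intro mult_mono) auto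
      then show ?thesis using legendre_nonneg[OF s] by (simp add: K_def)
    next
      case False
      define y where "y = sqrt Y"
      have yy: "Y = y\<^sup>2" using Y by (simp add: y_def)
      have y: "y \<ge> y0" using False y0 by (simp add: y_def real_le_rsqrt)
      have y4: "y \<ge> 4" using y y0 by simp
      have "2 * y \<le> y\<^sup>2" using y4 by (simp add: power2_eq_square)
      then have diff: "p y * y * (1 / (5 * y\<^sup>2) - 1 / (y\<^sup>2 + (y\<^sup>2)\<^sup>2)) \<le> poisson_mean y - poisson_mean (y\<^sup>2)"
        using y4 by (intro poisson_mean_diff) auto
      have "1 / (y\<^sup>2 + (y\<^sup>2)\<^sup>2) \<le> 1 / (10 * y\<^sup>2)"
      proof -
        have "4 * 4 \<le> y * y" using y4 by (intro mult_mono) auto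
        then have "9 * y\<^sup>2 \<le> y\<^sup>2 * y\<^sup>2" using y4 by (intro mult_right_mono) (auto simp: power2_eq_square)
        then have "10 * y\<^sup>2 \<le> y\<^sup>2 + (y\<^sup>2)\<^sup>2" by (simp add: power2_eq_square)
        then show ?thesis using y4 by (intro divide_left_mono mult_pos_pos) (auto simp: add_pos_nonneg)
      qed
      then have "1 / (10 * y\<^sup>2) \<le> 1 / (5 * y\<^sup>2) - 1 / (y\<^sup>2 + (y\<^sup>2)\<^sup>2)" using y4 by simp
      then have "p y * y * (1 / (10 * y\<^sup>2)) \<le> p y * y * (1 / (5 * y\<^sup>2) - 1 / (y\<^sup>2 + (y\<^sup>2)\<^sup>2))"
        using y4 nonneg[of y] by (intro mult_left_mono) auto
      then have "p y * y * (1 / (10 * y\<^sup>2)) \<le> poisson_mean y - poisson_mean (y\<^sup>2)"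
        using diff by linarith
      then have "2 * y / pi * (p y * y * (1 / (10 * y\<^sup>2))) \<le> 2 * y / pi * (poisson_mean y - poisson_mean (y\<^sup>2))"
        using y4 by (intro mult_left_mono) auto
      moreover have "2 * y / pi * (p y * y * (1 / (10 * y\<^sup>2))) = p y / (5 * pi)"
        using y4 by (simp add: field_simps power2_eq_square)
      moreover have "2 * y / pi * (poisson_mean y - poisson_mean (y\<^sup>2)) = poisson y - poisson (y\<^sup>2) / y"
        using y4 by (simp add: poisson_def field_simps power2_eq_square)
      ultimately have "p y / (5 * pi) \<le> poisson y - poisson (y\<^sup>2) / y" by simp
      also have "\<dots> \<le> poisson y - y * s"
      proof -
        have "y * s = s * y\<^sup>2 / y" using y4 by (simp add: power2_eq_square)
        also have "\<dots> \<le> poisson (y\<^sup>2) / y" using sY y4 by (intro divide_right_mono) (auto simp: yy)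
        finally show ?thesis by simp
      qed
      also have "\<dots> \<le> legendre s" using s y4 by (intro legendre_upper) auto
      finally have 1: "p y / (5 * pi) \<le> legendre s" .
      have "A * ln Y = 2 * A * ln y" using y4 by (simp add: yy ln_realpow)
      also have "\<dots> = 10 * pi * A * ln y / (5 * pi)" by simp
      also have "\<dots> \<le> p y / (5 * pi)" using y0(2)[OF y] by (intro divide_right_mono) auto
      finally show ?thesis using 1 K by linarith
    qed
  qed
qed

text \<open>Y is a crossing point of \<open>poisson y / y\<close> with the level s, found by the
  intermediate value theorem. For t \<ge> 4Y the quotient has fallen at least c/Y below s, because p
  Y \<ge> 1, so poisson t - s t \<le> - c t / Y; for t \<le> 4Y the summand 4c pays for c t / Y. The
  integral of exp (poisson t - s t) is therefore at most of order Y exp (legendre s).\<close>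

lemma legendre_tail:
  obtains c s0 where "c > 0" "s0 > 0"
    "\<And>s. 0 < s \<Longrightarrow> s < s0 \<Longrightarrow> \<exists>Y\<ge>1. poisson Y = s * Y \<and> (\<forall>t>0. poisson t - s * t \<le> legendre s + 4 * c - c * t / Y)"
proof -
  have "\<forall>\<^sub>F y in at_top. 1 \<le> p y" using weight_at_top by (simp add: filterlim_at_top)
  then have "\<forall>\<^sub>F y in at_top. 1 \<le> p y \<and> y \<ge> 1" by (intro eventually_conj eventually_ge_at_top)
  then obtain Y1 where Y1: "1 \<le> p Y1" "Y1 \<ge> 1" using eventually_happens'[OF trivial_limit_at_top_linorder] by blast
  \<comment> \<open>The denominators are those of \<open>poisson_mean_diff\<close> for z = 4y: 5 = 1
    + 2^2 and 17 = 1 + 4^2.\<close>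
  define c where "c = 2 / pi * (1/5 - 1/17)"
  have c: "c > 0" by (simp add: c_def)
  have P1: "poisson Y1 \<ge> 1" using poisson_ge[of Y1] Y1 by simp
  show ?thesis
  proof
    show "c > 0" by (rule c)
    show "poisson Y1 / Y1 > 0" using P1 Y1 by simp
    fix s assume s: "0 < s" "s < poisson Y1 / Y1"
    define g where "g = (\<lambda>y. poisson y / y)"
    have g: "g y = 2 / pi * poisson_mean y" if "y > 0" for y using that by (simp add: g_def poisson_def)
    have "\<forall>\<^sub>F y in at_top. poisson_mean y < s * pi / 2"
      using poisson_mean_tendsto s by (intro order_tendstoD) auto
    then have "\<forall>\<^sub>F y in at_top. poisson_mean y < s * pi / 2 \<and> y \<ge> Y1" by (intro eventually_conj eventually_ge_at_top)
    then obtain Y2 where Y2: "poisson_mean Y2 < s * pi / 2" "Y2 \<ge> Y1" using eventually_happens'[OF trivial_limit_at_top_linorder] by blast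
    have "2 / pi * poisson_mean Y2 \<le> 2 / pi * (s * pi / 2)" using Y2 by (intro mult_left_mono) auto
    then have "g Y2 \<le> s" using g[of Y2] Y1 Y2 by simp
    moreover have "s \<le> g Y1" using s by (simp add: g_def)
    moreover have "continuous_on {Y1..Y2} g" unfolding g_def
      by (intro continuous_intros continuous_on_subset[OF poisson_continuous]) (use Y1 in auto)
    ultimately obtain Y where Y: "Y1 \<le> Y" "Y \<le> Y2" "g Y = s"
      using IVT2'[of g Y2 s Y1] Y2 by auto
    have Y0: "Y \<ge> 1" using Y Y1 by simp
    have PY: "poisson Y = s * Y" using Y Y0 by (simp add: g_def field_simps)
    have pY: "p Y \<ge> 1" using Y Y1 mono[of Y1 Y] by simp
    have tail: "poisson t - s * t \<le> legendre s + 4 * c - c * t / Y" if t: "t > 0" for t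
    proof (cases "t \<le> 4 * Y")
      case True
      then have "c * t / Y \<le> 4 * c" using c Y0 by (simp add: divide_le_eq)
      then show ?thesis using legendre_upper[OF s(1) t] by (simp add: mult.commute)
    next
      case False
      then have t4: "t \<ge> 4 * Y" by simp
      have "p Y * Y * (1 / (5 * Y\<^sup>2) - 1 / (Y\<^sup>2 + (4*Y)\<^sup>2)) \<le> poisson_mean Y - poisson_mean (4 * Y)"
        using Y0 by (intro poisson_mean_diff) auto
      moreover have "p Y * Y * (1 / (5 * Y\<^sup>2) - 1 / (Y\<^sup>2 + (4*Y)\<^sup>2)) = p Y / Y * (1/5 - 1/17)"
        using Y0 by (simp add: field_simps power2_eq_square)
      moreover have "1 / Y * (1/5 - 1/17) \<le> p Y / Y * (1/5 - 1/17)"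
        using pY Y0 by (intro mult_right_mono divide_right_mono) auto
      moreover have "poisson_mean t \<le> poisson_mean (4 * Y)" using Y0 t4 by (intro poisson_mean_antimono) auto
      ultimately have "1 / Y * (1/5 - 1/17) \<le> poisson_mean Y - poisson_mean t" by linarith
      then have "2 / pi * (1 / Y * (1/5 - 1/17)) \<le> 2 / pi * (poisson_mean Y - poisson_mean t)"
        by (intro mult_left_mono) auto
      then have "c / Y \<le> g Y - g t"
        using g[of Y] g[of t] Y0 t by (simp add: c_def right_diff_distrib)
      then have "t * (c / Y) \<le> t * (s - g t)" using t Y by (intro mult_left_mono) auto
      then have "poisson t - s * t \<le> - (c * t / Y)" using t by (simp add: g_def algebra_simps)
      then show ?thesis using legendre_nonneg[OF s(1)] c by simp
    qed
    show "\<exists>Y\<ge>1. poisson Y = s * Y \<and> (\<forall>t>0. poisson t - s * t \<le> legendre s + 4 * c - c * t / Y)"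
      using Y0 PY tail by blast
  qed
qed

end

section \<open>Poisson representation of logarithms\<close>

text \<open>Cauchy's theorem on half-discs, applied to \<open>(g z - g y) / (z\<^sup>2 - y\<^sup>2)\<close>.\<close>

lemma half_plane_poisson:
  fixes g :: "complex \<Rightarrow> complex"
  assumes d: "\<delta> > 0" and hol: "g holomorphic_on {z. - \<delta> < Re z}"
    and gr: "\<And>z. 0 \<le> Re z \<Longrightarrow> cmod (g z) \<le> A + B * sqrt (cmod z)"
    and y: "y > 0"
  shows "((\<lambda>R. integral {-R..R} (\<lambda>t. (g (Complex 0 t) - g (of_real y)) / (of_real (t\<^sup>2 + y\<^sup>2)))) \<longlongrightarrow> 0) at_top"
proof -
  \<comment> \<open>The bound - y on the real part keeps the pole -y of 1/(z^2 - y^2) outside S; the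
    singularity at y is removable and is filled in by \<open>f\<close>.\<close>
  define S where "S = {z. - min \<delta> y < Re z}"
  have S: "open S" "convex S" unfolding S_def by (simp_all add: open_halfspace_Re_gt convex_halfspace_Re_gt)
  define f where "f = (\<lambda>z. if z = of_real y then deriv g (of_real y) else (g z - g (of_real y)) / (z - of_real y))"
  have yS: "of_real y \<in> S" using y d by (simp add: S_def)
  have holg: "g holomorphic_on S" by (rule holomorphic_on_subset[OF hol]) (auto simp: S_def)
  have dg: "g field_differentiable at (of_real y)"
    using holg S yS holomorphic_on_imp_differentiable_at by blast
  have "f holomorphic_on S"
  proof (rule pole_theorem_open_0[where g="\<lambda>z. g z - g (of_real y)" and a="of_real y"])
    show "(\<lambda>z. g z - g (of_real y)) holomorphic_on S" by (intro holomorphic_intros holg)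
    show "f (of_real y) = deriv (\<lambda>z. g z - g (of_real y)) (of_real y)"
      using dg by (simp add: f_def)
  qed (use S in \<open>auto simp: f_def\<close>)
  define k where "k = (\<lambda>z. f z / (z + of_real y))"
  have holk: "k holomorphic_on S" unfolding k_def
  proof (intro holomorphic_intros \<open>f holomorphic_on S\<close>)
    fix z assume "z \<in> S"
    then have "Re (z + of_real y) > 0" by (simp add: S_def)
    then show "z + of_real y \<noteq> 0" by (metis less_irrefl zero_complex.simps(1))
  qed
  \<comment> \<open>On the arc |z^2 - y^2| \<ge> (R - y)^2, and the arc has length pi R; growth like
    a square root leaves decay of order R^(-1/2).\<close>
  define E where "E = (\<lambda>R. (A + B * sqrt R + cmod (g (of_real y))) / (R - y)\<^sup>2 * R * pi)"
  have est: "cmod (integral {-R..R} (\<lambda>t. (g (Complex 0 t) - g (of_real y)) / (of_real (t\<^sup>2 + y\<^sup>2)))) \<le> E R" if R: "R > y" for R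
  proof -
    have R0: "R > 0" using R y by simp
    define arc where "arc = part_circlepath 0 R (-(pi/2)) (pi/2)"
    define seg where "seg = linepath (Complex 0 (-R)) (Complex 0 R)"
    have RS: "z \<in> S" if "0 \<le> Re z" for z using that d y by (simp add: S_def)
    have ends: "pathstart arc = Complex 0 (-R)" "pathfinish arc = Complex 0 R"
      by (simp_all add: arc_def complex_eq_iff Re_exp Im_exp cis_conv_exp[symmetric])
    have arcpt: "cmod z = R \<and> 0 \<le> Re z" if "z \<in> path_image arc" for z
    proof -
      obtain \<theta> where "\<theta> \<in> {-(pi/2)..pi/2}" "z = 0 + R * exp (\<i> * \<theta>)"
        using \<open>z \<in> path_image arc\<close> unfolding arc_def path_image_part_circlepath' by (auto simp: closed_segment_eq_real_ivl cis_conv_exp)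
      then show ?thesis using R0 by (auto simp: norm_mult Re_exp intro!: mult_nonneg_nonneg cos_ge_zero)
    qed
    have segpt: "Re z = 0" if "z \<in> path_image seg" for z
      using that by (auto simp: seg_def in_segment complex_eq_iff)
    have ci: "k contour_integrable_on arc" "k contour_integrable_on seg"
      by (rule contour_integrable_holomorphic_simple[OF holk S(1)]; use arcpt segpt RS in \<open>force simp: arc_def seg_def\<close>)+
    have "(k has_contour_integral 0) (arc +++ reversepath seg)"
    proof (rule Cauchy_theorem_convex_simple[OF holk S(2)])
      show "valid_path (arc +++ reversepath seg)" using ends by (intro valid_path_join) (auto simp: arc_def seg_def)
      show "path_image (arc +++ reversepath seg) \<subseteq> S"
        using arcpt segpt RS by (intro subset_path_image_join) force+
    qed (use ends in \<open>auto simp: seg_def\<close>)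
    moreover have vp: "valid_path arc" "valid_path seg" by (simp_all add: arc_def seg_def)
    ultimately have "contour_integral arc k + contour_integral (reversepath seg) k = 0"
      using contour_integral_join[OF ci(1) contour_integrable_reversepath[OF vp(2) ci(2)] vp(1)] contour_integral_unique by fastforce
    then have eq: "contour_integral seg k = contour_integral arc k"
      using contour_integral_reversepath[OF vp(2), of k] by simp
    have "cmod (contour_integral arc k) \<le> (A + B * sqrt R + cmod (g (of_real y))) / (R - y)\<^sup>2 * R * \<bar>pi/2 - - (pi/2)\<bar>"
      unfolding arc_def
    proof (rule contour_integral_bound_part_circlepath)
      show "k contour_integrable_on part_circlepath 0 R (- (pi / 2)) (pi / 2)" using ci by (simp add: arc_def)
      have "0 \<le> A + B * sqrt R" using gr[of "of_real R"] R0 by (simp add: order_trans[OF norm_ge_zero])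
      then show "0 \<le> (A + B * sqrt R + cmod (g (of_real y))) / (R - y)\<^sup>2" by simp
      show "0 \<le> R" using R0 by simp
      fix z assume "z \<in> path_image (part_circlepath 0 R (- (pi / 2)) (pi / 2))"
      then have z: "cmod z = R" "0 \<le> Re z" using arcpt by (auto simp: arc_def)
      have "z \<noteq> of_real y" using z R y by auto
      then have "cmod (k z) = cmod (g z - g (of_real y)) / (cmod (z - of_real y) * cmod (z + of_real y))"
        by (simp add: k_def f_def norm_divide norm_mult)
      also have "\<dots> \<le> (A + B * sqrt R + cmod (g (of_real y))) / ((R - y) * (R - y))"
      proof (intro frac_le mult_mono)
        show "cmod (g z - g (of_real y)) \<le> A + B * sqrt R + cmod (g (of_real y))"
          using gr[OF z(2)] norm_triangle_ineq4[of "g z" "g (of_real y)"] by (simp add: z)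
        show "R - y \<le> cmod (z - of_real y)" "R - y \<le> cmod (z + of_real y)"
          using norm_triangle_ineq2[of z "of_real y"] norm_triangle_ineq2[of z "- of_real y"] z y by simp_all
        show "0 \<le> A + B * sqrt R + cmod (g (of_real y))" using \<open>0 \<le> A + B * sqrt R\<close> by simp
      qed (use R in auto)
      finally show "cmod (k z) \<le> (A + B * sqrt R + cmod (g (of_real y))) / (R - y)\<^sup>2" by (simp add: power2_eq_square)
    qed
    then have b: "cmod (contour_integral arc k) \<le> E R" by (simp add: E_def)
    have kt: "k (Complex 0 t) = - ((g (Complex 0 t) - g (of_real y)) / (of_real (t\<^sup>2 + y\<^sup>2)))" for t
    proof -
      have ne: "Complex 0 t \<noteq> of_real y" using y by (auto simp: complex_eq_iff)
      have pr: "(Complex 0 t - of_real y) * (Complex 0 t + of_real y) = - of_real (t\<^sup>2 + y\<^sup>2)"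
        by (simp add: complex_eq_iff power2_eq_square)
      have "k (Complex 0 t) = (g (Complex 0 t) - g (of_real y)) / ((Complex 0 t - of_real y) * (Complex 0 t + of_real y))"
        using ne by (simp add: k_def f_def)
      then show ?thesis unfolding pr by (simp only: minus_divide_right)
    qed
    have "contour_integral seg k = \<i> * integral {-R..R} (\<lambda>t. k (Complex 0 t))"
      unfolding seg_def by (rule contour_integral_linepath_same_Re) (use R0 in auto)
    also have "\<dots> = - \<i> * integral {-R..R} (\<lambda>t. (g (Complex 0 t) - g (of_real y)) / (of_real (t\<^sup>2 + y\<^sup>2)))"
      unfolding kt integral_neg by simp
    finally have "cmod (contour_integral seg k) = cmod (integral {-R..R} (\<lambda>t. (g (Complex 0 t) - g (of_real y)) / (of_real (t\<^sup>2 + y\<^sup>2))))"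
      by (simp add: norm_mult)
    then show ?thesis using b eq by simp
  qed
  have "(E \<longlongrightarrow> 0) at_top" unfolding E_def using y by real_asymp
  then show ?thesis
    by (rule Lim_null_comparison[rotated]) (intro eventually_mono[OF eventually_gt_at_top[of y]] est)
qed

lemma abs_ln_le:
  fixes u :: real
  assumes "0 < m" "m \<le> u" "u \<le> v"
  shows "\<bar>ln u\<bar> \<le> \<bar>ln m\<bar> + ln (1 + v)"
proof -
  have "ln m \<le> ln u" "ln u \<le> ln (1 + v)" "0 \<le> ln (1 + v)" using assms by auto
  then show ?thesis by (auto simp: abs_le_iff)
qed

lemma ln_le_two_sqrt: "0 \<le> x \<Longrightarrow> ln (1 + x) \<le> 2 * sqrt (1 + x)" for x :: real
  using abs_ln_le_sqrt[of "1 + x"] by simp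

lemma cmod_square_sum_bounds:
  assumes s: "Re \<sigma> > 0"
  shows "(Re \<sigma>)\<^sup>2 \<le> cmod ((of_real t)\<^sup>2 + \<sigma>\<^sup>2)" "cmod ((of_real t)\<^sup>2 + \<sigma>\<^sup>2) \<le> t\<^sup>2 + (cmod \<sigma>)\<^sup>2"
proof -
  have "Re \<sigma> \<le> cmod (\<sigma> + \<i> * of_real t)" "Re \<sigma> \<le> cmod (\<sigma> - \<i> * of_real t)"
    using complex_Re_le_cmod[of "\<sigma> + \<i> * of_real t"] complex_Re_le_cmod[of "\<sigma> - \<i> * of_real t"] by auto
  then show "(Re \<sigma>)\<^sup>2 \<le> cmod ((of_real t)\<^sup>2 + \<sigma>\<^sup>2)"
    unfolding kernel_factor norm_mult power2_eq_square[of "Re \<sigma>"] using s by (intro mult_mono) auto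
  show "cmod ((of_real t)\<^sup>2 + \<sigma>\<^sup>2) \<le> t\<^sup>2 + (cmod \<sigma>)\<^sup>2"
    using norm_triangle_ineq[of "(of_real t)\<^sup>2" "\<sigma>\<^sup>2"] by (simp add: norm_power)
qed

lemma poisson_log_integrable:
  assumes s: "Re \<sigma> > 0" and y: "y > 0"
  shows "set_integrable lborel {0..} (\<lambda>t. ln (cmod ((of_real t)\<^sup>2 + \<sigma>\<^sup>2)) / (t\<^sup>2 + y\<^sup>2))"
proof -
  define c where "c = \<bar>ln ((Re \<sigma>)\<^sup>2)\<bar>"
  define C where "C = c + 4 * sqrt (2 + (cmod \<sigma>)\<^sup>2)"
  show ?thesis
  proof (rule set_integrable_powr_decay[where C=C])
    show "continuous_on {0..} (\<lambda>t. ln (cmod ((of_real t)\<^sup>2 + \<sigma>\<^sup>2)) / (t\<^sup>2 + y\<^sup>2))"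
      using y kernel_nonzero[OF s] by (intro continuous_intros) (auto simp: add_nonneg_eq_0_iff)
    fix t :: real assume t: "t \<ge> 1"
    have "\<bar>ln (cmod ((of_real t)\<^sup>2 + \<sigma>\<^sup>2))\<bar> \<le> c + ln (1 + (t\<^sup>2 + (cmod \<sigma>)\<^sup>2))"
      unfolding c_def by (rule abs_ln_le) (use s cmod_square_sum_bounds[OF s] in auto)
    also have "1 + (t\<^sup>2 + (cmod \<sigma>)\<^sup>2) \<le> (2 + (cmod \<sigma>)\<^sup>2) * t\<^sup>2"
    proof -
      have t1: "1 \<le> t\<^sup>2" using t by (simp add: one_le_power)
      then have "(cmod \<sigma>)\<^sup>2 * 1 \<le> (cmod \<sigma>)\<^sup>2 * t\<^sup>2" by (intro mult_left_mono) auto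
      then show ?thesis using t1 by (simp add: algebra_simps)
    qed
    then have "ln (1 + (t\<^sup>2 + (cmod \<sigma>)\<^sup>2)) \<le> ln ((2 + (cmod \<sigma>)\<^sup>2) * t\<^sup>2)" by (subst ln_le_cancel_iff) (use t in \<open>auto simp: add_pos_nonneg intro!: mult_pos_pos add_pos_nonneg\<close>)
    also have "\<dots> = 2 * ln (sqrt (2 + (cmod \<sigma>)\<^sup>2) * t)"
      using t by (simp add: ln_mult add_pos_nonneg ln_realpow ln_sqrt)
    also have "\<dots> \<le> 4 * sqrt (sqrt (2 + (cmod \<sigma>)\<^sup>2) * t)"
    proof -
      have "1 * 1 \<le> sqrt (2 + (cmod \<sigma>)\<^sup>2) * t" using t by (intro mult_mono) auto
      then show ?thesis using abs_ln_le_sqrt[of "sqrt (2 + (cmod \<sigma>)\<^sup>2) * t"] by simp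
    qed
    also have "\<dots> \<le> 4 * sqrt (2 + (cmod \<sigma>)\<^sup>2) * sqrt t"
    proof -
      have sq: "sqrt x \<le> x" if "1 \<le> x" for x :: real
        using that by (intro real_le_lsqrt) (auto simp: power2_eq_square)
      have "sqrt (sqrt (2 + (cmod \<sigma>)\<^sup>2)) \<le> sqrt (2 + (cmod \<sigma>)\<^sup>2)"
        by (rule sq) simp
      then show ?thesis using t by (simp add: real_sqrt_mult mult_right_mono)
    qed
    finally have "\<bar>ln (cmod ((of_real t)\<^sup>2 + \<sigma>\<^sup>2))\<bar> \<le> c + 4 * sqrt (2 + (cmod \<sigma>)\<^sup>2) * sqrt t" by simp
    also have "\<dots> \<le> C * sqrt t"
    proof -
      have "c * 1 \<le> c * sqrt t" using t by (intro mult_left_mono) (auto simp: c_def)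
      then show ?thesis by (simp add: C_def algebra_simps)
    qed
    finally have "\<bar>ln (cmod ((of_real t)\<^sup>2 + \<sigma>\<^sup>2))\<bar> / (t\<^sup>2 + y\<^sup>2) \<le> C * sqrt t / t\<^sup>2"
      using t y by (intro frac_le) (auto simp: add_pos_pos)
    also have "\<dots> = C * (t powr (1/2) * t powr (-2))"
      using t by (simp add: powr_half_sqrt powr_minus_divide powr_numeral)
    also have "t powr (1/2) * t powr (-2) = t powr (-3/2)" by (simp flip: powr_add)
    finally show "norm (ln (cmod ((of_real t)\<^sup>2 + \<sigma>\<^sup>2)) / (t\<^sup>2 + y\<^sup>2)) \<le> C * t powr (-3/2)"
      by (simp add: abs_div_pos add_nonneg_pos)
  qed
qed

lemma poisson_const:
  assumes "y > 0"
  shows "set_integrable lborel {0..} (\<lambda>t. c / (t\<^sup>2 + y\<^sup>2))" "2 * y / pi * (LBINT t:{0..}. c / (t\<^sup>2 + y\<^sup>2)) = c"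
proof -
  have w: "Re (complex_of_real y) > 0" using assms by simp
  note k = kernel_integrable[OF w] kernel_integral[OF w]
  have i: "set_integrable lborel {0..} (\<lambda>t. 2 * y / pi * (1 / (t\<^sup>2 + y\<^sup>2)))"
    using k(1) integrable_Re[of lborel "\<lambda>t. indicator {0..} t *\<^sub>R poisson_kernel (of_real y) t"]
    unfolding set_integrable_def by (simp add: Re_poisson_kernel_of_real)
  have I: "(LBINT t:{0..}. 2 * y / pi * (1 / (t\<^sup>2 + y\<^sup>2))) = 1"
    using k integral_Re[of lborel "\<lambda>t. indicator {0..} t *\<^sub>R poisson_kernel (of_real y) t"]
    unfolding set_integrable_def set_lebesgue_integral_def by (simp add: Re_poisson_kernel_of_real)
  have "set_integrable lborel {0..} (\<lambda>t. (c * pi / (2 * y)) * (2 * y / pi * (1 / (t\<^sup>2 + y\<^sup>2))))"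
    by (intro set_integrable_mult_right i)
  then show "set_integrable lborel {0..} (\<lambda>t. c / (t\<^sup>2 + y\<^sup>2))" using assms by simp
  have "(LBINT t:{0..}. 2 * y / pi * (c / (t\<^sup>2 + y\<^sup>2))) = (LBINT t:{0..}. c * (2 * y / pi * (1 / (t\<^sup>2 + y\<^sup>2))))"
    by (simp add: mult_ac)
  also have "\<dots> = c" by (subst set_integral_mult_right) (simp only: I mult_1_right)
  finally show "2 * y / pi * (LBINT t:{0..}. c / (t\<^sup>2 + y\<^sup>2)) = c" by (simp only: set_integral_mult_right)
qed

text \<open>Ln (z + \<sigma>) has real part ln |z + \<sigma>| and its singularity -\<sigma> lies in
  the open left half-plane. Folding the integral over [-R, R] at 0 multiplies |i t + \<sigma>| and
  |-i t + \<sigma>| into |t^2 + \<sigma>^2|, whence the factor 2 in the result.\<close>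

lemma poisson_log:
  assumes s: "Re \<sigma> > 0" and y: "y > 0"
  shows "2 * y / pi * (LBINT t:{0..}. ln (cmod ((of_real t)\<^sup>2 + \<sigma>\<^sup>2)) / (t\<^sup>2 + y\<^sup>2)) = 2 * ln (cmod (of_real y + \<sigma>))"
proof -
  define g where "g = (\<lambda>z. Ln (z + \<sigma>))"
  define L where "L = ln (cmod (of_real y + \<sigma>))"
  have notneg: "z + \<sigma> \<notin> \<real>\<^sub>\<le>\<^sub>0" "z + \<sigma> \<noteq> 0" if "- Re \<sigma> < Re z" for z
    using that by (auto simp: complex_nonpos_Reals_iff complex_eq_iff)
  have hol: "g holomorphic_on {z. - Re \<sigma> < Re z}"
    unfolding g_def by (intro holomorphic_intros) (use notneg in auto)
  define A where "A = \<bar>ln (Re \<sigma>)\<bar> + 2 * sqrt (1 + cmod \<sigma>) + pi"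
  have gr: "cmod (g z) \<le> A + 2 * sqrt (cmod z)" if z: "0 \<le> Re z" for z
  proof -
    have nz: "z + \<sigma> \<noteq> 0" using notneg(2)[of z] s z by simp
    have "cmod (g z) \<le> \<bar>Re (Ln (z + \<sigma>))\<bar> + \<bar>Im (Ln (z + \<sigma>))\<bar>" unfolding g_def by (rule cmod_le)
    moreover have "\<bar>Im (Ln (z + \<sigma>))\<bar> \<le> pi" using mpi_less_Im_Ln[OF nz] Im_Ln_le_pi[OF nz] by simp
    moreover have "\<bar>Re (Ln (z + \<sigma>))\<bar> \<le> \<bar>ln (Re \<sigma>)\<bar> + ln (1 + (cmod z + cmod \<sigma>))"
      unfolding Re_Ln[OF nz]
      by (rule abs_ln_le) (use s z complex_Re_le_cmod[of "z + \<sigma>"] norm_triangle_ineq in auto)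
    moreover have "ln (1 + (cmod z + cmod \<sigma>)) \<le> 2 * sqrt (1 + (cmod z + cmod \<sigma>))"
      by (rule ln_le_two_sqrt) simp
    moreover have "sqrt (1 + (cmod z + cmod \<sigma>)) \<le> sqrt (1 + cmod \<sigma>) + sqrt (cmod z)"
      using sqrt_add_le_add_sqrt[of "1 + cmod \<sigma>" "cmod z"] by (simp add: add_ac)
    ultimately show ?thesis unfolding A_def by linarith
  qed
  define h where "h = (\<lambda>t. ln (cmod ((of_real t)\<^sup>2 + \<sigma>\<^sup>2)) / (t\<^sup>2 + y\<^sup>2) - 2 * L / (t\<^sup>2 + y\<^sup>2))"
  have fold_h: "integral {0..R} h = Re (integral {-R..R} (\<lambda>t. (g (Complex 0 t) - g (of_real y)) / (of_real (t\<^sup>2 + y\<^sup>2))))" if R: "R > 0" for R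
  proof -
    define G where "G = (\<lambda>t. (g (Complex 0 t) - g (of_real y)) / (of_real (t\<^sup>2 + y\<^sup>2)))"
    define H where "H = (\<lambda>t. Re (G t))"
    have contG: "continuous_on A G" for A
    proof -
      have "continuous_on A (\<lambda>t. g (Complex 0 t))"
        by (rule continuous_on_compose2[OF holomorphic_on_imp_continuous_on[OF hol]])
           (use s in \<open>auto simp: Complex_eq intro!: continuous_intros\<close>)
      then show ?thesis unfolding G_def using y by (intro continuous_intros) (auto simp: add_nonneg_eq_0_iff complex_eq_iff)
    qed
    have contH: "continuous_on A H" for A unfolding H_def by (intro continuous_intros contG)
    have "Re (integral {-R..R} G) = integral {-R..R} H"
      unfolding H_def using integral_linear[OF integrable_continuous_real[OF contG] bounded_linear_Re] by (simp add: o_def)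
    also have "\<dots> = integral {-R..0} H + integral {0..R} H"
      by (rule Henstock_Kurzweil_Integration.integral_combine[symmetric]) (use R in \<open>auto intro: integrable_continuous_real contH\<close>)
    also have "integral {-R..0} H = integral {0..R} (\<lambda>t. H (-t))"
      using Henstock_Kurzweil_Integration.integral_reflect_real[of R 0 "\<lambda>t. H (-t)"] by simp
    also have "integral {0..R} (\<lambda>t. H (-t)) + integral {0..R} H = integral {0..R} (\<lambda>t. H (-t) + H t)"
      by (rule integral_add[symmetric]) (auto intro!: integrable_continuous_real contH continuous_on_compose2[OF contH[of UNIV]] continuous_intros)
    also have "(\<lambda>t. H (-t) + H t) = h"
    proof
      fix t
      have n1: "Complex 0 t + \<sigma> \<noteq> 0" "Complex 0 (-t) + \<sigma> \<noteq> 0" "of_real y + \<sigma> \<noteq> 0"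
        using s y by (auto simp: complex_eq_iff)
      have "H t = (ln (cmod (Complex 0 t + \<sigma>)) - L) / (t\<^sup>2 + y\<^sup>2)" for t
        unfolding H_def G_def g_def Re_divide_of_real using s y by (simp add: L_def Re_Ln complex_eq_iff)
      then have "H (-t) + H t = (ln (cmod (Complex 0 (-t) + \<sigma>)) + ln (cmod (Complex 0 t + \<sigma>)) - 2 * L) / (t\<^sup>2 + y\<^sup>2)"
        by (simp add: add_divide_distrib diff_divide_distrib)
      also have "ln (cmod (Complex 0 (-t) + \<sigma>)) + ln (cmod (Complex 0 t + \<sigma>)) = ln (cmod (Complex 0 (-t) + \<sigma>) * cmod (Complex 0 t + \<sigma>))"
        using n1 by (simp add: ln_mult)
      also have "cmod (Complex 0 (-t) + \<sigma>) * cmod (Complex 0 t + \<sigma>) = cmod ((of_real t)\<^sup>2 + \<sigma>\<^sup>2)"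
        unfolding kernel_factor norm_mult[symmetric] by (simp add: Complex_eq algebra_simps)
      finally show "H (-t) + H t = h t" by (simp add: h_def diff_divide_distrib)
    qed
    finally show ?thesis by (simp add: G_def)
  qed
  have int_h: "set_integrable lborel {0..} h"
    unfolding h_def by (intro set_integral_diff poisson_log_integrable poisson_const s y)
  have "((\<lambda>R. LBINT t:{0..R}. h t) \<longlongrightarrow> (LBINT t:{0..}. h t)) at_top"
    by (rule tendsto_set_lebesgue_integral_at_top[OF _ int_h]) auto
  moreover have "((\<lambda>R. LBINT t:{0..R}. h t) \<longlongrightarrow> 0) at_top"
  proof (rule Lim_transform_eventually)
    show "((\<lambda>R. Re (integral {-R..R} (\<lambda>t. (g (Complex 0 t) - g (of_real y)) / (of_real (t\<^sup>2 + y\<^sup>2))))) \<longlongrightarrow> 0) at_top"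
      using tendsto_Re[OF half_plane_poisson[OF s hol gr y]] by simp
    show "\<forall>\<^sub>F R in at_top. Re (integral {-R..R} (\<lambda>t. (g (Complex 0 t) - g (of_real y)) / (of_real (t\<^sup>2 + y\<^sup>2)))) = (LBINT t:{0..R}. h t)"
      using eventually_gt_at_top[of 0]
    proof eventually_elim
      case (elim R)
      have "(LBINT t:{0..R}. h t) = integral {0..R} h"
        by (rule set_borel_integral_eq_integral) (auto intro: set_integrable_subset[OF int_h])
      then show ?case using fold_h[OF elim] by simp
    qed
  qed
  ultimately have "(LBINT t:{0..}. h t) = 0" using tendsto_unique trivial_limit_at_top_linorder by blast
  moreover have "(LBINT t:{0..}. h t) = (LBINT t:{0..}. ln (cmod ((of_real t)\<^sup>2 + \<sigma>\<^sup>2)) / (t\<^sup>2 + y\<^sup>2)) - (LBINT t:{0..}. 2 * L / (t\<^sup>2 + y\<^sup>2))"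
    unfolding h_def by (intro set_integral_diff poisson_log_integrable poisson_const s y)
  ultimately have "(LBINT t:{0..}. ln (cmod ((of_real t)\<^sup>2 + \<sigma>\<^sup>2)) / (t\<^sup>2 + y\<^sup>2)) = (LBINT t:{0..}. 2 * L / (t\<^sup>2 + y\<^sup>2))" by simp
  then show ?thesis using poisson_const(2)[OF y, of "2 * L"] by (simp add: L_def)
qed

section \<open>Polynomials with prescribed size on the real line\<close>

text \<open>Each zero \<open>\<plusminus>\<i>\<sigma>\<close> of \<open>t\<^sup>2 + \<sigma>\<^sup>2\<close> in the upper half-plane is replaced by its complex conjugate.
  This does not change the modulus on the real line.\<close>

lemma outer_polynomial_multiset:
  fixes A :: "complex multiset"
  assumes "\<And>x. x \<in># A \<Longrightarrow> Im x = 0 \<Longrightarrow> Re x < 0"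
  shows "\<exists>Q. (\<forall>t::real. cmod (poly Q (of_real t)) = cmod (\<Prod>x\<in>#A. (of_real t)\<^sup>2 - x)) \<and>
    (\<forall>y>0. poly Q (\<i> * of_real y) \<noteq> 0 \<and>
      set_integrable lborel {0..} (\<lambda>t. ln (cmod (\<Prod>x\<in>#A. (of_real t)\<^sup>2 - x)) / (t\<^sup>2 + y\<^sup>2)) \<and>
      ln (cmod (poly Q (\<i> * of_real y))) = 2 * y / pi * (LBINT t:{0..}. ln (cmod (\<Prod>x\<in>#A. (of_real t)\<^sup>2 - x)) / (t\<^sup>2 + y\<^sup>2)))"
  using assms
proof (induction A)
  case empty
  show ?case by (rule exI[of _ 1]) (auto simp: set_integrable_def)
next
  case (add x A)
  define P where "P = (\<lambda>t::real. cmod (\<Prod>x\<in>#A. (of_real t)\<^sup>2 - x))"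
  obtain Q where Q: "\<And>t::real. cmod (poly Q (of_real t)) = P t"
    "\<And>y. y > 0 \<Longrightarrow> poly Q (\<i> * of_real y) \<noteq> 0"
    "\<And>y. y > 0 \<Longrightarrow> set_integrable lborel {0..} (\<lambda>t. ln (P t) / (t\<^sup>2 + y\<^sup>2))"
    "\<And>y. y > 0 \<Longrightarrow> ln (cmod (poly Q (\<i> * of_real y))) = 2 * y / pi * (LBINT t:{0..}. ln (P t) / (t\<^sup>2 + y\<^sup>2))"
    using add.IH add.prems unfolding P_def by force
  \<comment> \<open>The principal root has real part at least 0; real part 0 would make x real and
    nonnegative, giving a zero of t^2 - x on the real line.\<close>
  define \<sigma> where "\<sigma> = csqrt (- x)"
  have \<sigma>2: "\<sigma>\<^sup>2 = - x" by (simp add: \<sigma>_def)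
  have \<sigma>: "Re \<sigma> > 0"
  proof (rule ccontr)
    assume "\<not> Re \<sigma> > 0"
    then have "Re \<sigma> = 0" using csqrt_principal[of "-x"] unfolding \<sigma>_def by auto
    then have "\<sigma>\<^sup>2 = - of_real ((Im \<sigma>)\<^sup>2)" by (simp add: complex_eq_iff power2_eq_square)
    then have "x = of_real ((Im \<sigma>)\<^sup>2)" using \<sigma>2 by simp
    then have "Im x = 0" "Re x \<ge> 0" by simp_all
    then show False using add.prems[of x] by simp
  qed
  have eqP: "cmod (\<Prod>x\<in>#add_mset x A. (of_real t)\<^sup>2 - x) = cmod ((of_real t)\<^sup>2 + \<sigma>\<^sup>2) * P t" for t
    by (simp add: P_def norm_mult \<sigma>2)
  have P0: "P t > 0" for t
  proof -
    have "(complex_of_real t)\<^sup>2 - z \<noteq> 0" if "z \<in># A" for z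
    proof
      assume "(complex_of_real t)\<^sup>2 - z = 0"
      then have "z = of_real (t\<^sup>2)" by simp
      then have "Im z = 0" "Re z \<ge> 0" by simp_all
      then show False using add.prems[of z] that by simp
    qed
    then show ?thesis unfolding P_def by (auto simp: prod_mset_zero_iff)
  qed
  have lnP: "ln (cmod (\<Prod>x\<in>#add_mset x A. (of_real t)\<^sup>2 - x)) = ln (cmod ((of_real t)\<^sup>2 + \<sigma>\<^sup>2)) + ln (P t)" for t
    unfolding eqP using P0[of t] kernel_nonzero[OF \<sigma>, of t] by (subst ln_mult) auto
  \<comment> \<open>The zeros i \<sigma> and -i \<sigma> of t^2 + \<sigma>^2 become -i cnj \<sigma>
    and -i \<sigma>, both in the open lower half-plane.\<close>
  define Q' where "Q' = [: \<i> * \<sigma>, 1 :] * [: \<i> * cnj \<sigma>, 1 :] * Q"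
  have pQ': "poly Q' z = (z + \<i> * \<sigma>) * (z + \<i> * cnj \<sigma>) * poly Q z" for z
    by (simp add: Q'_def algebra_simps)
  show ?case
  proof (intro exI[of _ Q'] conjI allI impI)
    fix t :: real
    have "cmod (of_real t + \<i> * cnj \<sigma>) = cmod (of_real t - \<i> * \<sigma>)"
      by (subst complex_mod_cnj[symmetric]) simp
    then have "cmod (of_real t + \<i> * \<sigma>) * cmod (of_real t + \<i> * cnj \<sigma>) = cmod ((of_real t + \<i> * \<sigma>) * (of_real t - \<i> * \<sigma>))"
      by (simp add: norm_mult)
    also have "(of_real t + \<i> * \<sigma>) * (of_real t - \<i> * \<sigma>) = (of_real t)\<^sup>2 + \<sigma>\<^sup>2"
      by (simp add: algebra_simps power2_eq_square)
    finally show "cmod (poly Q' (of_real t)) = cmod (\<Prod>x\<in>#add_mset x A. (of_real t)\<^sup>2 - x)"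
      unfolding pQ' eqP by (simp add: norm_mult Q)
  next
    fix y :: real assume y: "y > 0"
    \<comment> \<open>At i y both new factors have modulus |y + \<sigma>|, matching the value 2 ln
      |y + \<sigma>| of the Poisson integral.\<close>
    have m1: "cmod (\<i> * of_real y + \<i> * \<sigma>) = cmod (of_real y + \<sigma>)"
      by (simp flip: distrib_left add: norm_mult)
    have m2: "cmod (\<i> * of_real y + \<i> * cnj \<sigma>) = cmod (of_real y + \<sigma>)"
    proof -
      have e: "\<i> * of_real y + \<i> * cnj \<sigma> = \<i> * cnj (of_real y + \<sigma>)" by (simp add: distrib_left)
      show ?thesis unfolding e norm_mult complex_mod_cnj by simp
    qed
    have nz: "cmod (of_real y + \<sigma>) > 0" using \<sigma> y by (auto simp: complex_eq_iff)
    have nQ: "cmod (poly Q' (\<i> * of_real y)) = cmod (of_real y + \<sigma>) * cmod (of_real y + \<sigma>) * cmod (poly Q (\<i> * of_real y))"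
      unfolding pQ' norm_mult m1 m2 ..
    have nzQ: "cmod (poly Q (\<i> * of_real y)) > 0" using Q(2)[OF y] by simp
    then have "cmod (poly Q' (\<i> * of_real y)) > 0" unfolding nQ using nz by simp
    then show "poly Q' (\<i> * of_real y) \<noteq> 0" by auto
    note i1 = poisson_log_integrable[OF \<sigma> y] and i2 = Q(3)[OF y]
    have eq: "(\<lambda>t. ln (cmod (\<Prod>x\<in>#add_mset x A. (of_real t)\<^sup>2 - x)) / (t\<^sup>2 + y\<^sup>2)) =
      (\<lambda>t. ln (cmod ((of_real t)\<^sup>2 + \<sigma>\<^sup>2)) / (t\<^sup>2 + y\<^sup>2) + ln (P t) / (t\<^sup>2 + y\<^sup>2))"
      unfolding lnP by (simp add: add_divide_distrib)
    show "set_integrable lborel {0..} (\<lambda>t. ln (cmod (\<Prod>x\<in>#add_mset x A. (of_real t)\<^sup>2 - x)) / (t\<^sup>2 + y\<^sup>2))"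
      unfolding eq by (intro set_integral_add i1 i2)
    have "ln (cmod (poly Q' (\<i> * of_real y))) = 2 * ln (cmod (of_real y + \<sigma>)) + ln (cmod (poly Q (\<i> * of_real y)))"
      unfolding nQ using nz nzQ by (simp add: ln_mult)
    also have "\<dots> = 2 * y / pi * (LBINT t:{0..}. ln (cmod ((of_real t)\<^sup>2 + \<sigma>\<^sup>2)) / (t\<^sup>2 + y\<^sup>2)) +
        2 * y / pi * (LBINT t:{0..}. ln (P t) / (t\<^sup>2 + y\<^sup>2))"
      unfolding poisson_log[OF \<sigma> y] Q(4)[OF y] ..
    also have "\<dots> = 2 * y / pi * (LBINT t:{0..}. ln (cmod (\<Prod>x\<in>#add_mset x A. (of_real t)\<^sup>2 - x)) / (t\<^sup>2 + y\<^sup>2))"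
      unfolding eq set_integral_add(2)[OF i1 i2] by (rule distrib_left[symmetric])
    finally show "ln (cmod (poly Q' (\<i> * of_real y))) =
      2 * y / pi * (LBINT t:{0..}. ln (cmod (\<Prod>x\<in>#add_mset x A. (of_real t)\<^sup>2 - x)) / (t\<^sup>2 + y\<^sup>2))" .
  qed
qed

text \<open>No complex zero of R lies in [0, \<infinity>), so every linear factor is admissible for
  the reflection; the leading coefficient adds a constant to ln R, which the Poisson integral
  reproduces.\<close>

lemma outer_polynomial:
  fixes R :: "real poly"
  assumes R: "\<And>x. x \<ge> 0 \<Longrightarrow> poly R x > 0"
  obtains Q :: "complex poly" where
    "\<And>t. cmod (poly Q (of_real t)) = poly R (t\<^sup>2)"
    "\<And>y. y > 0 \<Longrightarrow> poly Q (\<i> * of_real y) \<noteq> 0"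
    "\<And>y. y > 0 \<Longrightarrow> set_integrable lborel {0..} (\<lambda>t. ln (poly R (t\<^sup>2)) / (t\<^sup>2 + y\<^sup>2))"
    "\<And>y. y > 0 \<Longrightarrow> ln (cmod (poly Q (\<i> * of_real y))) = 2 * y / pi * (LBINT t:{0..}. ln (poly R (t\<^sup>2)) / (t\<^sup>2 + y\<^sup>2))"
proof -
  define RC :: "complex poly" where "RC = map_poly of_real R"
  have pRC: "poly RC (of_real x) = of_real (poly R x)" for x by (simp add: RC_def poly_altdef degree_map_poly coeff_map_poly)
  have "RC \<noteq> 0"
  proof
    assume "RC = 0"
    then have "poly RC (of_real 0) = 0" by simp
    then show False unfolding pRC using R[of 0] by simp
  qed
  define A where "A = proots RC"
  have A: "RC = smult (lead_coeff RC) (\<Prod>x\<in>#A. [:-x, 1:])"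
    unfolding A_def by (rule complex_poly_decompose_multiset[symmetric])
  define c where "c = lead_coeff RC"
  have c: "c \<noteq> 0" using \<open>RC \<noteq> 0\<close> by (simp add: c_def)
  have pRCz: "poly RC z = c * (\<Prod>x\<in>#A. z - x)" for z
  proof -
    have "poly RC z = c * poly (\<Prod>x\<in>#A. [:-x, 1:]) z" by (subst A) (simp add: c_def)
    also have "poly (\<Prod>x\<in>#A. [:-x, 1:]) z = (\<Prod>x\<in>#A. z - x)"
      by (induction A) (auto simp: algebra_simps)
    finally show ?thesis .
  qed
  have "Re x < 0" if "x \<in># A" "Im x = 0" for x
  proof (rule ccontr)
    assume "\<not> Re x < 0"
    then have x: "x = of_real (Re x)" "Re x \<ge> 0" using that by (auto simp: complex_eq_iff)
    have "poly RC x = 0" unfolding pRCz using that(1) by (auto simp: prod_mset_zero_iff)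
    then have "poly R (Re x) = 0" using pRC[of "Re x"] x(1) by simp
    then show False using R[OF x(2)] by simp
  qed
  from outer_polynomial_multiset[OF this] obtain Q where
    Q: "\<And>t::real. cmod (poly Q (of_real t)) = cmod (\<Prod>x\<in>#A. (of_real t)\<^sup>2 - x)"
    "\<And>y. y > 0 \<Longrightarrow> poly Q (\<i> * of_real y) \<noteq> 0"
    "\<And>y. y > 0 \<Longrightarrow> set_integrable lborel {0..} (\<lambda>t. ln (cmod (\<Prod>x\<in>#A. (of_real t)\<^sup>2 - x)) / (t\<^sup>2 + y\<^sup>2))"
    "\<And>y. y > 0 \<Longrightarrow> ln (cmod (poly Q (\<i> * of_real y))) = 2 * y / pi * (LBINT t:{0..}. ln (cmod (\<Prod>x\<in>#A. (of_real t)\<^sup>2 - x)) / (t\<^sup>2 + y\<^sup>2))"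
    by blast
  define l where "l = ln (cmod c)"
  have R2: "poly R (t\<^sup>2) = cmod c * cmod (\<Prod>x\<in>#A. (of_real t)\<^sup>2 - x)" for t
  proof -
    have "cmod (poly RC (of_real (t\<^sup>2))) = poly R (t\<^sup>2)" unfolding pRC using R[of "t\<^sup>2"] by simp
    then show ?thesis unfolding pRCz by (simp add: norm_mult)
  qed
  have lnR: "ln (poly R (t\<^sup>2)) / (t\<^sup>2 + y\<^sup>2) = l / (t\<^sup>2 + y\<^sup>2) + ln (cmod (\<Prod>x\<in>#A. (of_real t)\<^sup>2 - x)) / (t\<^sup>2 + y\<^sup>2)" for t y
  proof -
    have "cmod (\<Prod>x\<in>#A. (of_real t)\<^sup>2 - x) > 0" using R[of "t\<^sup>2"] c unfolding R2 by (simp add: zero_less_mult_iff)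
    then have "ln (poly R (t\<^sup>2)) = l + ln (cmod (\<Prod>x\<in>#A. (of_real t)\<^sup>2 - x))"
      unfolding R2 l_def using c by (subst ln_mult) auto
    then show ?thesis by (simp add: add_divide_distrib)
  qed
  show ?thesis
  proof
    show "cmod (poly (smult c Q) (of_real t)) = poly R (t\<^sup>2)" for t by (simp add: norm_mult Q R2)
    fix y :: real assume y: "y > 0"
    show "poly (smult c Q) (\<i> * of_real y) \<noteq> 0" using Q(2)[OF y] c by simp
    show "set_integrable lborel {0..} (\<lambda>t. ln (poly R (t\<^sup>2)) / (t\<^sup>2 + y\<^sup>2))"
      unfolding lnR by (intro set_integral_add poisson_const y Q)
    have "ln (cmod (poly (smult c Q) (\<i> * of_real y))) = l + ln (cmod (poly Q (\<i> * of_real y)))"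
      using c Q(2)[OF y] by (simp add: norm_mult ln_mult l_def)
    also have "\<dots> = 2 * y / pi * (LBINT t:{0..}. l / (t\<^sup>2 + y\<^sup>2)) + 2 * y / pi * (LBINT t:{0..}. ln (cmod (\<Prod>x\<in>#A. (of_real t)\<^sup>2 - x)) / (t\<^sup>2 + y\<^sup>2))"
      unfolding poisson_const(2)[OF y] Q(4)[OF y] ..
    also have "\<dots> = 2 * y / pi * (LBINT t:{0..}. ln (poly R (t\<^sup>2)) / (t\<^sup>2 + y\<^sup>2))"
      unfolding lnR set_integral_add(2)[OF poisson_const(1)[OF y] Q(3)[OF y]] by (rule distrib_left[symmetric])
    finally show "ln (cmod (poly (smult c Q) (\<i> * of_real y))) = 2 * y / pi * (LBINT t:{0..}. ln (poly R (t\<^sup>2)) / (t\<^sup>2 + y\<^sup>2))" .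
  qed
qed

section \<open>Polynomials built from maximal terms\<close>

lemma sum_inverse_squares_le: "(\<Sum>n\<le>N. 1 / (real n + 1)\<^sup>2) \<le> 2 - 1 / (real N + 1)"
proof (induction N)
  case (Suc N)
  have "1 / (real N + 2)\<^sup>2 \<le> 1 / (real N + 1) - 1 / (real N + 2)"
  proof -
    have "1 / (real N + 1) - 1 / (real N + 2) = 1 / ((real N + 1) * (real N + 2))" by (simp add: field_simps)
    moreover have "1 / (real N + 2)\<^sup>2 \<le> 1 / ((real N + 1) * (real N + 2))"
      unfolding power2_eq_square by (intro divide_left_mono mult_right_mono mult_pos_pos) auto
    ultimately show ?thesis by simp
  qed
  then show ?case using Suc by (simp add: add_ac)
qed simp

context weight begin

text \<open>The largest coefficient \<open>d\<close> with \<open>d * t ^ (2 * m) \<le> exp (p t)\<close> for all \<open>t > 0\<close>.\<close>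

definition max_coeff :: "nat \<Rightarrow> real" where
  "max_coeff m = exp (INF t\<in>{0<..}. p t - 2 * real m * ln t)"

lemma max_coeff_bdd: "bdd_below ((\<lambda>t. p t - 2 * real m * ln t) ` {0<..})"
proof -
  obtain T0 where T0: "\<And>t. t \<ge> T0 \<Longrightarrow> 2 * real m * ln t \<le> p t"
    using dominates_log[of "2 * real m"] by (auto simp: eventually_at_top_linorder)
  define T where "T = max T0 1"
  have T: "T \<ge> 1" "\<And>t. t \<ge> T \<Longrightarrow> 2 * real m * ln t \<le> p t" using T0 by (auto simp: T_def)
  show ?thesis
  proof (rule bdd_belowI2[where m="- (2 * real m * ln T)"])
    fix t :: real assume "t \<in> {0<..}"
    then have t: "t > 0" by simp
    show "- (2 * real m * ln T) \<le> p t - 2 * real m * ln t"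
    proof (cases "t \<ge> T")
      case True
      have "0 \<le> 2 * real m * ln T" using T by simp
      then show ?thesis using T(2)[OF True] by linarith
    next
      case False
      then have "2 * real m * ln t \<le> 2 * real m * ln T" using t by (intro mult_left_mono) auto
      then show ?thesis using nonneg[of t] by linarith
    qed
  qed
qed

lemma max_coeff_pos: "max_coeff m > 0" by (simp add: max_coeff_def)

lemma max_coeff_upper:
  assumes t: "t > 0" shows "max_coeff m * t ^ (2 * m) \<le> exp (p t)"
proof -
  have "(INF t\<in>{0<..}. p t - 2 * real m * ln t) \<le> p t - 2 * real m * ln t"
    by (rule cINF_lower[OF max_coeff_bdd]) (use t in auto)
  then have "max_coeff m \<le> exp (p t - 2 * real m * ln t)" by (simp add: max_coeff_def)
  also have "\<dots> = exp (p t) / t ^ (2 * m)"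
    using t exp_of_nat_mult[of "2 * m" "ln t"] by (simp add: exp_diff)
  finally show ?thesis using t by (simp add: pos_le_divide_eq)
qed

lemma max_coeff_lower:
  assumes "\<And>t. t > 0 \<Longrightarrow> b \<le> p t - 2 * real m * ln t" shows "exp b \<le> max_coeff m"
  unfolding max_coeff_def by (subst exp_le_cancel_iff, rule cINF_greatest) (use assms in auto)

text \<open>A discrete Legendre duality in ln t: since x \<mapsto> p (exp x) is convex, the supremum
  over m of \<open>max_coeff m * t ^ (2 * m)\<close> recovers exp (p t) up to powers of t. The decay
  1/(1 + t^2) is built in for the sake of the later Laplace transform. The loss of t^6 is majorised
  by (1 + t^2)^3, whose logarithm has Poisson integral 6 ln (1 + y). The degree depends on y, the
  constant \<open>K\<close> does not.\<close>

lemma polynomial_minorant: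
  obtains K where "\<And>y. y > 0 \<Longrightarrow> \<exists>Q :: complex poly.
    (\<forall>t. cmod (poly Q (of_real t)) \<le> exp (p t) / (1 + t\<^sup>2)) \<and> poly Q (\<i> * of_real y) \<noteq> 0 \<and>
    poisson y - 6 * ln (1 + y) - K \<le> ln (cmod (poly Q (\<i> * of_real y)))"
proof -
  \<comment> \<open>From max_coeff m \<le> exp (p 1) \<le> exp 1 it follows that \<delta> max_coeff
    m \<le> 1/4; as the inverse squares sum to at most 2, this leaves 1/2, which is at most 1/(1 +
    t^2) for |t| \<le> 1.\<close>
  define \<delta> :: real where "\<delta> = 1 / (4 * exp 1)"
  have \<delta>: "\<delta> > 0" by (simp add: \<delta>_def)
  \<comment> \<open>The shift of the index by one gives a n t^(2n) the extra factor 1/t^2; the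
    divisor (n + 1)^2 bounds the whole sum by a multiple of the largest term.\<close>
  define a where "a = (\<lambda>n. \<delta> * max_coeff (Suc n) / (real n + 1)\<^sup>2)"
  have a0: "a n > 0" for n unfolding a_def using \<delta> max_coeff_pos[of "Suc n"] by (intro divide_pos_pos mult_pos_pos) auto
  define R where "R = (\<lambda>N. \<Sum>n\<le>N. monom (a n) n)"
  have pR: "poly (R N) x = (\<Sum>n\<le>N. a n * x ^ n)" for N x by (simp add: R_def poly_sum poly_monom)
  have R_ge: "a n * x ^ n \<le> poly (R N) x" if "x \<ge> 0" "n \<le> N" for n N x
    unfolding pR by (rule member_le_sum) (use that a0 less_imp_le in \<open>auto intro!: mult_nonneg_nonneg\<close>)
  have R_pos: "poly (R N) x > 0" if "x \<ge> 0" for N x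
    using R_ge[OF that, of 0 N] a0[of 0] by simp
  have ss: "(\<Sum>n\<le>N. 1 / (real n + 1)\<^sup>2) \<le> 2" for N using sum_inverse_squares_le[of N] by (smt (verit) divide_nonneg_nonneg of_nat_0_le_iff)
  have upper: "poly (R N) (t\<^sup>2) \<le> exp (p t) / (1 + t\<^sup>2)" for N t
  proof -
    define u where "u = \<bar>t\<bar>"
    have u: "u \<ge> 0" "t\<^sup>2 = u\<^sup>2" "p t = p u" by (simp_all add: u_def p_abs)
    show ?thesis
    proof (cases "u \<ge> 1")
      case True
      have "poly (R N) (u\<^sup>2) = (\<Sum>n\<le>N. \<delta> / u\<^sup>2 * (max_coeff (Suc n) * u ^ (2 * Suc n)) * (1 / (real n + 1)\<^sup>2))"
        unfolding pR using True by (intro sum.cong refl) (simp add: a_def power_mult power2_eq_square field_simps)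
      also have "\<dots> \<le> (\<Sum>n\<le>N. \<delta> / u\<^sup>2 * exp (p u) * (1 / (real n + 1)\<^sup>2))"
        using True \<delta> by (intro sum_mono mult_right_mono mult_left_mono max_coeff_upper) auto
      also have "\<dots> = \<delta> / u\<^sup>2 * exp (p u) * (\<Sum>n\<le>N. 1 / (real n + 1)\<^sup>2)" by (simp add: sum_distrib_left)
      also have "\<dots> \<le> \<delta> / u\<^sup>2 * exp (p u) * 2" using ss True \<delta> by (intro mult_left_mono) auto
      also have "\<dots> = exp (p u) * (2 * \<delta> / u\<^sup>2)" by simp
      also have "\<dots> \<le> exp (p u) * (1 / (1 + u\<^sup>2))"
      proof (intro mult_left_mono)
        have "(4::real) * 1 \<le> 4 * exp 1" by (intro mult_left_mono) auto
        then have "2 * \<delta> \<le> 1/2" unfolding \<delta>_def by (simp add: divide_le_eq)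
        then have "2 * \<delta> / u\<^sup>2 \<le> (1/2) / u\<^sup>2" by (intro divide_right_mono) auto
        also have "\<dots> = 1 / (2 * u\<^sup>2)" by simp
        also have "\<dots> \<le> 1 / (1 + u\<^sup>2)" using True by (intro divide_left_mono) (auto simp: one_le_power add_pos_nonneg)
        finally show "2 * \<delta> / u\<^sup>2 \<le> 1 / (1 + u\<^sup>2)" .
      qed auto
      finally show ?thesis using u by simp
    next
      case False
      have "poly (R N) (u\<^sup>2) \<le> (\<Sum>n\<le>N. (1/4) * (1 / (real n + 1)\<^sup>2))"
        unfolding pR
      proof (intro sum_mono)
        fix n assume "n \<in> {..N}"
        have "max_coeff (Suc n) \<le> exp 1" using max_coeff_upper[of 1 "Suc n"] p_le[of 1] by (simp add: order_trans)
        then have "\<delta> * max_coeff (Suc n) \<le> \<delta> * exp 1" using \<delta> by (intro mult_left_mono) auto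
        then have "\<delta> * max_coeff (Suc n) \<le> 1/4" by (simp add: \<delta>_def)
        then have "a n \<le> (1/4) / (real n + 1)\<^sup>2" unfolding a_def by (intro divide_right_mono) auto
        moreover have "(u\<^sup>2) ^ n \<le> 1" using False u by (intro power_le_one) (auto simp: power_le_one)
        ultimately have "a n * (u\<^sup>2) ^ n \<le> (1/4) / (real n + 1)\<^sup>2 * 1" using a0[of n] by (intro mult_mono) auto
        then show "a n * (u\<^sup>2) ^ n \<le> (1/4) * (1 / (real n + 1)\<^sup>2)" by simp
      qed
      also have "\<dots> = (1/4) * (\<Sum>n\<le>N. 1 / (real n + 1)\<^sup>2)" by (simp only: sum_distrib_left)
      also have "\<dots> \<le> 1/2" using ss[of N] by simp
      also have "\<dots> \<le> 1 / (1 + u\<^sup>2)"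
      proof -
        have "u\<^sup>2 \<le> 1" using False u by (auto simp: power_le_one)
        then show ?thesis by (simp add: field_simps add_pos_nonneg)
      qed
      also have "\<dots> \<le> exp (p u) / (1 + u\<^sup>2)" using nonneg[of u] by (intro divide_right_mono) (auto simp: add_nonneg_nonneg)
      finally show ?thesis using u by simp
    qed
  qed
  obtain t0 where t0: "\<And>t. t \<ge> t0 \<Longrightarrow> 3 * ln t \<le> p t" using dominates_log[of 3] by (auto simp: eventually_at_top_linorder)
  define t1 where "t1 = max t0 (exp 1)"
  have t1: "t1 \<ge> exp 1" "\<And>t. t \<ge> t1 \<Longrightarrow> 3 * ln t \<le> p t" using t0 by (auto simp: t1_def)
  \<comment> \<open>Three losses of t^2 each: rounding the slope q to an even integer 2m, the shift
    of the index, and the divisor m^2 \<le> t^2.\<close>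
  have lower: "\<delta> * exp (p t) / t ^ 6 \<le> poly (R N) (t\<^sup>2)" if t: "t \<ge> t1" "t \<le> real N" for t N
  proof -
    have te: "t \<ge> exp 1" using t t1 by simp
    then have tt: "t > 0" by (smt (verit) exp_gt_zero)
    have t11: "t \<ge> 1" using te one_le_exp_iff[of 1] by linarith
    have lt: "ln t \<ge> 1" using te tt by (simp add: ln_ge_iff)
    obtain q where q: "q \<ge> 0" "\<And>x. x > 0 \<Longrightarrow> p t + q * ln (x / t) \<le> p x" using support_line[OF tt] by blast
    \<comment> \<open>Guarantees m \<ge> 1, so that m is one of the shifted indices; it follows from
      3 ln t \<le> p t and p 1 \<le> 1 \<le> ln t.\<close>
    have q2: "q \<ge> 2"
    proof -
      have "p t - p 1 \<le> q * ln t" using q(2)[of 1] tt by (simp add: ln_div)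
      moreover have "p 1 \<le> 1" using p_le[of 1] by simp
      ultimately have "2 * ln t \<le> q * ln t" using t1(2)[OF t(1)] lt by linarith
      then show ?thesis using lt by simp
    qed
    \<comment> \<open>The Lipschitz bound between t and e t limits the slope; it yields m \<le> t
      \<le> N, so the maximal term really occurs in \<open>R N\<close>.\<close>
    have qt: "q \<le> 2 * t"
    proof -
      have "p t + q \<le> p (exp 1 * t)" using q(2)[of "exp 1 * t"] tt by simp
      moreover have "p (exp 1 * t) - p t \<le> exp 1 * t - t" using tt t11 by (intro lipschitz) auto
      moreover have "exp 1 * t \<le> 3 * t" using tt exp_le by (intro mult_right_mono) auto
      ultimately show ?thesis by linarith
    qed
    define m where "m = nat \<lfloor>q / 2\<rfloor>"
    have m: "real m \<le> q / 2" "q / 2 < real m + 1" using q(1) of_int_floor_le[of "q/2"] floor_correct[of "q/2"] by (simp_all add: m_def)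
    have m1: "m \<ge> 1" using q2 by (simp add: m_def le_nat_iff le_floor_iff)
    have mt: "real m \<le> t" using m qt by simp
    have 1: "p t - 2 * real m * ln t - 2 * ln t \<le> p x - 2 * real m * ln x" if x: "x \<ge> 1" for x
    proof -
      define D where "D = ln (x / t)"
      have D: "ln x = ln t + D" "D \<ge> - ln t" using x tt by (simp_all add: D_def ln_div)
      have "(q - 2 * real m) * D \<ge> - 2 * ln t"
      proof (cases "D \<ge> 0")
        case True
        then have "(q - 2 * real m) * D \<ge> 0" using m by simp
        then show ?thesis using lt by linarith
      next
        case False
        then have "2 * D \<le> (q - 2 * real m) * D" using m by (intro mult_right_mono_neg) auto
        then show ?thesis using D by linarith
      qed
      moreover have "p t + q * D \<le> p x" using q(2)[of x] x by (simp add: D_def)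
      ultimately show ?thesis unfolding D(1) by (simp add: algebra_simps)
    qed
    have 2: "p t - 2 * real m * ln t - 2 * ln t \<le> p x - 2 * real m * ln x" if x: "x > 0" for x
    proof (cases "x \<ge> 1")
      case True then show ?thesis by (rule 1)
    next
      case False
      then have lx: "ln x \<le> 0" using x by simp
      have "p 1 - p x \<le> 1 - x" using False x by (intro lipschitz) auto
      moreover have "ln x \<le> x - 1" using x by (rule ln_le_minus_one)
      moreover have "2 * real m * ln x \<le> 1 * ln x" using m1 lx by (intro mult_right_mono_neg) auto
      ultimately have "p 1 \<le> p x - 2 * real m * ln x" by linarith
      then show ?thesis using 1[of 1] by simp
    qed
    have "exp (p t) / (t ^ 2 * t ^ (2 * m)) = exp (p t - 2 * real m * ln t - 2 * ln t)"
    proof -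
      have e: "exp (2 * real m * ln t) = t ^ (2 * m)" "exp (2 * ln t) = t ^ 2"
        using exp_of_nat_mult[of "2 * m" "ln t"] exp_of_nat_mult[of 2 "ln t"] tt by simp_all
      show ?thesis unfolding e[symmetric] by (simp add: exp_diff)
    qed
    also have "\<dots> \<le> max_coeff m" by (rule max_coeff_lower) (rule 2)
    finally have mc: "exp (p t) / (t ^ 2 * t ^ (2 * m)) \<le> max_coeff m" .
    obtain n where n: "m = Suc n" using m1 by (cases m) auto
    have "\<delta> * exp (p t) / t ^ 6 = \<delta> * (exp (p t) / (t ^ 2 * t ^ (2 * m))) / t\<^sup>2 * t ^ (2 * n)"
      using tt unfolding n by (simp add: field_simps power_add[symmetric] eval_nat_numeral)
    also have "\<dots> \<le> \<delta> * max_coeff m / (real n + 1)\<^sup>2 * t ^ (2 * n)"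
      using mc \<delta> tt mt n max_coeff_pos[of m] by (intro mult_right_mono frac_le mult_left_mono power_mono) auto
    also have "\<dots> = a n * (t\<^sup>2) ^ n" by (simp add: a_def n power_mult)
    also have "\<dots> \<le> poly (R N) (t\<^sup>2)" using mt t n by (intro R_ge) auto
    finally show ?thesis .
  qed
  \<comment> \<open>Below t1 the weight is at most t1 and the constant term \<open>a 0\<close> alone
    is used; beyond N the indicator removes the weight.\<close>
  define K0 where "K0 = t1 + \<bar>ln \<delta>\<bar> + \<bar>ln (a 0)\<bar>"
  have t10: "t1 > 0" using t1(1) exp_gt_zero[of "1::real"] by linarith
  have lnR: "indicator {0..real N} t * p t - 3 * ln (cmod ((of_real t)\<^sup>2 + 1\<^sup>2)) - K0 \<le> ln (poly (R N) (t\<^sup>2))" if t: "t \<ge> 0" for N t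
  proof -
    have c1: "cmod ((of_real t)\<^sup>2 + 1\<^sup>2) = 1 + t\<^sup>2"
    proof -
      have "cmod ((of_real t)\<^sup>2 + 1\<^sup>2) = cmod (of_real (1 + t\<^sup>2))" by (simp add: add.commute)
      then show ?thesis by (simp only: norm_of_real) (simp add: add_nonneg_nonneg)
    qed
    have l0: "ln (1 + t\<^sup>2) \<ge> 0" by simp
    have "a 0 \<le> poly (R N) (t\<^sup>2)" using R_ge[of "t\<^sup>2" 0 N] by simp
    then have la: "ln (a 0) \<le> ln (poly (R N) (t\<^sup>2))" using a0[of 0] R_pos[of "t\<^sup>2" N] by (subst ln_le_cancel_iff) auto
    show ?thesis
    proof (cases "t1 \<le> t \<and> t \<le> real N")
      case True
      then have tt: "t > 0" using t10 by linarith
      have "ln (\<delta> * exp (p t) / t ^ 6) \<le> ln (poly (R N) (t\<^sup>2))"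
        using lower[of t N] True tt \<delta> R_pos[of "t\<^sup>2" N] by (subst ln_le_cancel_iff) auto
      moreover have "ln (\<delta> * exp (p t) / t ^ 6) = ln \<delta> + p t - 6 * ln t"
        using tt \<delta> by (simp add: ln_div ln_mult ln_realpow)
      moreover have "6 * ln t \<le> 3 * ln (1 + t\<^sup>2)"
      proof -
        have "ln (t\<^sup>2) \<le> ln (1 + t\<^sup>2)" using tt by (subst ln_le_cancel_iff) (auto simp: add_pos_nonneg)
        then show ?thesis using tt by (simp add: ln_realpow)
      qed
      ultimately show ?thesis unfolding c1 K0_def using True t t10 by simp
    next
      case False
      have "indicator {0..real N} t * p t \<le> t1"
        using False t p_le[OF t] t10 by (auto simp: indicator_def)
      then show ?thesis unfolding c1 K0_def using la l0 by linarith
    qed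
  qed
  show ?thesis
  proof
    fix y :: real assume y: "y > 0"
    have "((\<lambda>b. LBINT t:{0..b}. p t / (t\<^sup>2 + y\<^sup>2)) \<longlongrightarrow> poisson_mean y) at_top"
      unfolding poisson_mean_def by (rule tendsto_set_lebesgue_integral_at_top) (use p_integrable[OF y] in auto)
    then have "((\<lambda>N. LBINT t:{0..real N}. p t / (t\<^sup>2 + y\<^sup>2)) \<longlongrightarrow> poisson_mean y) sequentially"
      by (rule filterlim_compose[OF _ filterlim_real_sequentially])
    then have "((\<lambda>N. 2 * y / pi * (LBINT t:{0..real N}. p t / (t\<^sup>2 + y\<^sup>2))) \<longlongrightarrow> 2 * y / pi * poisson_mean y) sequentially"
      by (intro tendsto_intros)
    then have "\<forall>\<^sub>F N in sequentially. poisson y - 1 < 2 * y / pi * (LBINT t:{0..real N}. p t / (t\<^sup>2 + y\<^sup>2))"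
      by (intro order_tendstoD(1)) (auto simp: poisson_def)
    \<comment> \<open>Cutting the weight off at N costs less than 1 in the Poisson integral at i
      y.\<close>
    then obtain N where N: "poisson y - 1 < 2 * y / pi * (LBINT t:{0..real N}. p t / (t\<^sup>2 + y\<^sup>2))"
      by (auto simp: eventually_sequentially)
    obtain Q :: "complex poly" where Q: "\<And>t. cmod (poly Q (of_real t)) = poly (R N) (t\<^sup>2)"
      "poly Q (\<i> * of_real y) \<noteq> 0"
      "set_integrable lborel {0..} (\<lambda>t. ln (poly (R N) (t\<^sup>2)) / (t\<^sup>2 + y\<^sup>2))"
      "ln (cmod (poly Q (\<i> * of_real y))) = 2 * y / pi * (LBINT t:{0..}. ln (poly (R N) (t\<^sup>2)) / (t\<^sup>2 + y\<^sup>2))"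
    proof (rule outer_polynomial[OF R_pos[of _ N]], goal_cases)
      case (2 Q)
      show ?case by (rule 2(1)[of Q]) (use 2 y in auto)
    qed
    have i1: "set_integrable lborel {0..} (\<lambda>t. indicator {0..real N} t * (p t / (t\<^sup>2 + y\<^sup>2)))"
      unfolding set_integrable_def
      using set_integrable_subset[OF p_integrable[OF y], of "{0..real N}"]
      by (simp add: set_integrable_def indicator_inter_arith[symmetric] mult.assoc[symmetric] Int_absorb1 atLeastAtMost_def)
    have e1: "(LBINT t:{0..}. indicator {0..real N} t * (p t / (t\<^sup>2 + y\<^sup>2))) = (LBINT t:{0..real N}. p t / (t\<^sup>2 + y\<^sup>2))"
      unfolding set_lebesgue_integral_def by (rule Bochner_Integration.integral_cong) (auto simp: indicator_def)
    have i2: "set_integrable lborel {0..} (\<lambda>t. 3 * (ln (cmod ((of_real t)\<^sup>2 + 1\<^sup>2)) / (t\<^sup>2 + y\<^sup>2)))"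
      by (intro set_integrable_mult_right poisson_log_integrable y) auto
    have i3: "set_integrable lborel {0..} (\<lambda>t. K0 / (t\<^sup>2 + y\<^sup>2))" by (rule poisson_const[OF y])
    have p2: "2 * y / pi * (LBINT t:{0..}. 3 * (ln (cmod ((of_real t)\<^sup>2 + 1\<^sup>2)) / (t\<^sup>2 + y\<^sup>2))) = 6 * ln (1 + y)"
    proof -
      have "cmod (of_real y + 1) = 1 + y" using y by (metis abs_of_pos add.commute add_pos_pos norm_of_real of_real_1 of_real_add zero_less_one)
      then have "2 * y / pi * (LBINT t:{0..}. ln (cmod ((of_real t)\<^sup>2 + 1\<^sup>2)) / (t\<^sup>2 + y\<^sup>2)) = 2 * ln (1 + y)"
        using poisson_log[of 1 y] y by simp
      moreover have "(LBINT t:{0..}. 3 * (ln (cmod ((of_real t)\<^sup>2 + 1\<^sup>2)) / (t\<^sup>2 + y\<^sup>2))) = 3 * (LBINT t:{0..}. ln (cmod ((of_real t)\<^sup>2 + 1\<^sup>2)) / (t\<^sup>2 + y\<^sup>2))"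
        by (rule set_integral_mult_right)
      moreover have "2 * y / pi * (3 * X) = 3 * (2 * y / pi * X)" for X by simp
      ultimately show ?thesis by (simp only:)
    qed
    have "poisson y - 1 - 6 * ln (1 + y) - K0 \<le>
      2 * y / pi * (LBINT t:{0..}. indicator {0..real N} t * (p t / (t\<^sup>2 + y\<^sup>2))) -
      2 * y / pi * (LBINT t:{0..}. 3 * (ln (cmod ((of_real t)\<^sup>2 + 1\<^sup>2)) / (t\<^sup>2 + y\<^sup>2))) -
      2 * y / pi * (LBINT t:{0..}. K0 / (t\<^sup>2 + y\<^sup>2))"
      using N unfolding e1 p2 poisson_const(2)[OF y] by linarith
    also have "\<dots> = 2 * y / pi * (LBINT t:{0..}. indicator {0..real N} t * (p t / (t\<^sup>2 + y\<^sup>2)) -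
        3 * (ln (cmod ((of_real t)\<^sup>2 + 1\<^sup>2)) / (t\<^sup>2 + y\<^sup>2)) - K0 / (t\<^sup>2 + y\<^sup>2))"
      unfolding set_integral_diff(2)[OF set_integral_diff(1)[OF i1 i2] i3] set_integral_diff(2)[OF i1 i2] by (simp only: right_diff_distrib)
    also have "\<dots> \<le> 2 * y / pi * (LBINT t:{0..}. ln (poly (R N) (t\<^sup>2)) / (t\<^sup>2 + y\<^sup>2))"
    proof (intro mult_left_mono set_integral_mono)
      show "set_integrable lborel {0..} (\<lambda>t. indicator {0..real N} t * (p t / (t\<^sup>2 + y\<^sup>2)) -
        3 * (ln (cmod ((of_real t)\<^sup>2 + 1\<^sup>2)) / (t\<^sup>2 + y\<^sup>2)) - K0 / (t\<^sup>2 + y\<^sup>2))"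
        by (intro set_integral_diff(1) i1 i2 i3)
      fix t :: real assume "t \<in> {0..}"
      then have "(indicator {0..real N} t * p t - 3 * ln (cmod ((of_real t)\<^sup>2 + 1\<^sup>2)) - K0) / (t\<^sup>2 + y\<^sup>2) \<le> ln (poly (R N) (t\<^sup>2)) / (t\<^sup>2 + y\<^sup>2)"
        using lnR[of t N] by (intro divide_right_mono) (auto simp: add_nonneg_nonneg)
      then show "indicator {0..real N} t * (p t / (t\<^sup>2 + y\<^sup>2)) - 3 * (ln (cmod ((of_real t)\<^sup>2 + 1\<^sup>2)) / (t\<^sup>2 + y\<^sup>2)) - K0 / (t\<^sup>2 + y\<^sup>2)
        \<le> ln (poly (R N) (t\<^sup>2)) / (t\<^sup>2 + y\<^sup>2)" by (simp add: diff_divide_distrib)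
    qed (use Q(3) y in auto)
    also have "\<dots> = ln (cmod (poly Q (\<i> * of_real y)))" using Q(4) by simp
    finally have "poisson y - 6 * ln (1 + y) - (K0 + 1) \<le> ln (cmod (poly Q (\<i> * of_real y)))" by simp
    moreover have "\<forall>t. cmod (poly Q (of_real t)) \<le> exp (p t) / (1 + t\<^sup>2)" using Q(1) upper by simp
    ultimately show "\<exists>Q :: complex poly.
      (\<forall>t. cmod (poly Q (of_real t)) \<le> exp (p t) / (1 + t\<^sup>2)) \<and> poly Q (\<i> * of_real y) \<noteq> 0 \<and>
      poisson y - 6 * ln (1 + y) - (K0 + 1) \<le> ln (cmod (poly Q (\<i> * of_real y)))"
      using Q(2) by blast
  qed
qed

end

section \<open>The weight of a majorant\<close>

locale majorant =
  fixes M :: "real \<Rightarrow> real"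
  assumes pos: "\<And>\<xi>. 0 < \<xi> \<Longrightarrow> \<xi> < 1 \<Longrightarrow> 0 < M \<xi>"
    and nonincreasing: "antimono_on {0<..<1} M"
    and loglog: "loglog_integrable_at_0 M"
    and growth: "\<And>N::real. filterlim (\<lambda>\<xi>. \<xi> powr N * M \<xi>) at_top (at_right 0)"
    and convex_exp: "convex_on {0<..} (\<lambda>s. ln (M (exp (- s))))"
    and convex: "convex_on {0<..<1} (\<lambda>\<xi>. ln (M \<xi>))"
begin

lemma antimono: "0 < a \<Longrightarrow> a \<le> b \<Longrightarrow> b < 1 \<Longrightarrow> M b \<le> M a"
  using nonincreasing by (auto simp: monotone_on_def)

lemma ln_antimono: "0 < a \<Longrightarrow> a \<le> b \<Longrightarrow> b < 1 \<Longrightarrow> ln (M b) \<le> ln (M a)"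
  using antimono[of a b] pos[of b] by (subst ln_le_cancel_iff) auto

text \<open>By convexity, ln M stays above the continuation beyond 1/2 of its chord over [1/4, 1/2],
  which has slope -4d; up to 1 this loses at most 2d. It makes M(1-0) positive, so that its
  logarithm is meaningful.\<close>

lemma ln_bounded_below:
  obtains b where "\<And>\<xi>. 0 < \<xi> \<Longrightarrow> \<xi> < 1 \<Longrightarrow> b \<le> ln (M \<xi>)"
proof -
  define d where "d = ln (M (1/4)) - ln (M (1/2))"
  have d: "d \<ge> 0" using ln_antimono[of "1/4" "1/2"] by (simp add: d_def)
  have "ln (M (1/2)) - 2 * d \<le> ln (M \<xi>)" if x: "0 < \<xi>" "\<xi> < 1" for \<xi>
  proof (cases "\<xi> \<le> 1/2")
    case True
    then show ?thesis using ln_antimono[of \<xi> "1/2"] x d by simp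
  next
    case False
    define u where "u = (1/4) / (\<xi> - 1/4)"
    have u: "0 < u" "u \<le> 1" "1/3 \<le> u" using x False by (auto simp: u_def field_simps)
    have "u * (\<xi> - 1/4) = 1/4" using False by (simp add: u_def)
    moreover have "(1 - u) * (1/4) + u * \<xi> = 1/4 + u * (\<xi> - 1/4)" by (simp add: field_simps)
    ultimately have e: "(1 - u) * (1/4) + u * \<xi> = 1/2" by simp
    have "ln (M ((1 - u) *\<^sub>R (1/4) + u *\<^sub>R \<xi>)) \<le> (1 - u) * ln (M (1/4)) + u * ln (M \<xi>)"
      by (rule convex_onD[OF convex]) (use u x in auto)
    then have "ln (M (1/2)) \<le> (1 - u) * ln (M (1/4)) + u * ln (M \<xi>)"
      by (simp only: real_scaleR_def e)
    then have "u * (ln (M (1/4)) - ln (M \<xi>)) \<le> d" by (simp add: d_def algebra_simps)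
    moreover have "1/3 * (ln (M (1/4)) - ln (M \<xi>)) \<le> u * (ln (M (1/4)) - ln (M \<xi>))"
      using u ln_antimono[of "1/4" \<xi>] x False by (intro mult_right_mono) auto
    ultimately show ?thesis by (simp add: d_def)
  qed
  then show ?thesis using that by blast
qed

text \<open>The left limit M(1-0), as an infimum because \<open>M\<close> does not increase.\<close>

definition M1 :: real where "M1 = Inf (M ` {0<..<1})"

lemma M1: "M1 > 0" "0 < \<xi> \<Longrightarrow> \<xi> < 1 \<Longrightarrow> M1 \<le> M \<xi>"
proof -
  obtain b where b: "\<And>\<xi>. 0 < \<xi> \<Longrightarrow> \<xi> < 1 \<Longrightarrow> b \<le> ln (M \<xi>)" using ln_bounded_below by blast
  have eb: "exp b \<le> M \<xi>" if "0 < \<xi>" "\<xi> < 1" for \<xi>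
    using b[OF that] pos[OF that] by (simp add: ln_ge_iff)
  have "exp b \<le> M1" unfolding M1_def by (rule cINF_greatest) (use eb in auto)
  then show "M1 > 0" using exp_gt_zero[of b] by linarith
  show "0 < \<xi> \<Longrightarrow> \<xi> < 1 \<Longrightarrow> M1 \<le> M \<xi>"
    unfolding M1_def by (rule cINF_lower) (use eb in \<open>auto intro!: bdd_belowI2[where m="exp b"]\<close>)
qed

lemma tendsto_M1: "(M \<longlongrightarrow> M1) (at_left 1)"
proof (rule order_tendstoI)
  fix a assume a: "a < M1"
  have "\<forall>\<^sub>F x in at_left (1::real). x \<in> {0<..<1}" by (rule eventually_at_left_real) simp
  then show "\<forall>\<^sub>F x in at_left 1. a < M x"
    by eventually_elim (use a M1(2) in \<open>auto intro: less_le_trans\<close>)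
next
  fix a assume a: "M1 < a"
  have "bdd_below (M ` {0<..<1})" using M1(2) by (intro bdd_belowI2[where m=M1]) auto
  then obtain x0 where x0: "0 < x0" "x0 < 1" "M x0 < a"
    using a unfolding M1_def by (subst (asm) cINF_less_iff) auto
  have "\<forall>\<^sub>F x in at_left (1::real). x \<in> {x0<..<1}" by (rule eventually_at_left_real) (use x0 in simp)
  then show "\<forall>\<^sub>F x in at_left 1. M x < a"
  proof eventually_elim
    case (elim x)
    then show ?case using antimono[of x0 x] x0 by simp
  qed
qed

lemma extend_majorant: "extend_majorant M \<xi> = (if \<xi> < 1 then M \<xi> else M1)"
  using tendsto_Lim[OF _ tendsto_M1] by (simp add: extend_majorant_def trivial_limit_at_left_real)

section \<open>The function phi: monotonicity, log-convexity and growth\<close>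

lemma phi_bdd:
  assumes r: "r \<ge> 0" shows "bdd_below ((\<lambda>\<xi>. ln (extend_majorant M \<xi>) + r * \<xi>) ` {0<..})"
proof (rule bdd_belowI2[where m="ln M1"])
  fix \<xi> :: real assume "\<xi> \<in> {0<..}"
  then have x: "\<xi> > 0" by simp
  have "ln M1 \<le> ln (extend_majorant M \<xi>)"
    using M1 x pos[OF x] by (auto simp: extend_majorant)
  moreover have "0 \<le> r * \<xi>" using r x by simp
  ultimately show "ln M1 \<le> ln (extend_majorant M \<xi>) + r * \<xi>" by linarith
qed

lemma phi_le: "r \<ge> 0 \<Longrightarrow> 0 < \<xi> \<Longrightarrow> \<xi> < 1 \<Longrightarrow> phi M r \<le> ln (M \<xi>) + r * \<xi>"
  using cINF_lower[OF phi_bdd, of r \<xi>] by (simp add: phi_def extend_majorant)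

text \<open>A bound on (0, 1) passes to the left limit at 1, and for \<xi> \<ge> 1 the expression
  does not decrease, since the extended majorant is constant there. Thus phi is an infimum over (0,
  1).\<close>

lemma phi_ge:
  assumes r: "r \<ge> 0" and c: "\<And>\<xi>. 0 < \<xi> \<Longrightarrow> \<xi> < 1 \<Longrightarrow> c \<le> ln (M \<xi>) + r * \<xi>"
  shows "c \<le> phi M r"
  unfolding phi_def
proof (rule cINF_greatest)
  have lim: "((\<lambda>\<xi>. ln (M \<xi>) + r * \<xi>) \<longlongrightarrow> ln M1 + r * 1) (at_left 1)"
    using M1(1) by (intro tendsto_intros tendsto_M1) auto
  have "\<forall>\<^sub>F x in at_left (1::real). x \<in> {0<..<1}" by (rule eventually_at_left_real) simp
  then have "\<forall>\<^sub>F x in at_left 1. c \<le> ln (M x) + r * x" by eventually_elim (use c in auto)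
  from tendsto_lowerbound[OF lim this] have c1: "c \<le> ln M1 + r" by (simp add: trivial_limit_at_left_real)
  fix \<xi> :: real assume "\<xi> \<in> {0<..}"
  then have x: "\<xi> > 0" by simp
  show "c \<le> ln (extend_majorant M \<xi>) + r * \<xi>"
  proof (cases "\<xi> < 1")
    case True then show ?thesis using c[OF x] by (simp add: extend_majorant)
  next
    case False
    then have "r * 1 \<le> r * \<xi>" using r by (intro mult_left_mono) auto
    then show ?thesis using c1 False by (simp add: extend_majorant)
  qed
qed auto

lemma phi_near_min:
  assumes r: "r \<ge> 0" and e: "\<epsilon> > 0"
  shows "\<exists>\<xi>>0. \<xi> < 1 \<and> ln (M \<xi>) + r * \<xi> < phi M r + \<epsilon>"
proof (rule ccontr)
  assume *: "\<not> ?thesis"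
  have "phi M r + \<epsilon> \<le> phi M r"
  proof (rule phi_ge[OF r])
    fix \<xi> :: real assume "0 < \<xi>" "\<xi> < 1"
    then show "phi M r + \<epsilon> \<le> ln (M \<xi>) + r * \<xi>" using * not_le by blast
  qed
  then show False using e by simp
qed

lemma phi_mono:
  assumes "0 \<le> a" "a \<le> b" shows "phi M a \<le> phi M b"
proof (rule phi_ge)
  fix \<xi> :: real assume x: "0 < \<xi>" "\<xi> < 1"
  have "a * \<xi> \<le> b * \<xi>" using assms x by (intro mult_right_mono) auto
  then show "phi M a \<le> ln (M \<xi>) + b * \<xi>" using phi_le[OF assms(1) x] by linarith
qed (use assms in simp)

text \<open>Only \<xi> < 1 matters for the infimum, and for such \<xi> the affine function t
  \<mapsto> ln (M \<xi>) + t \<xi> has slope below 1.\<close>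

lemma phi_lipschitz:
  assumes "0 \<le> a" "a \<le> b" shows "phi M b - phi M a \<le> b - a"
proof -
  have "phi M b - (b - a) \<le> phi M a"
  proof (rule phi_ge)
    fix \<xi> :: real assume x: "0 < \<xi>" "\<xi> < 1"
    have "(b - a) * \<xi> \<le> (b - a) * 1" using assms x by (intro mult_left_mono) auto
    then show "phi M b - (b - a) \<le> ln (M \<xi>) + a * \<xi>" using phi_le[of b \<xi>] x assms by (simp add: algebra_simps)
  qed (use assms in simp)
  then show ?thesis by simp
qed

text \<open>With \<xi> = exp (-s) and r = exp x the expression ln (M (exp (-s))) + exp (x - s) is
  jointly convex in (x, s), and a partial infimum of a jointly convex function is convex. In the
  proof \<open>exp (- s)\<close> is the weighted geometric mean of two near-minimisers.\<close>

lemma phi_log_convex: "convex_on UNIV (\<lambda>x. phi M (exp x))"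
proof (intro convex_onI)
  fix u x y :: real assume u: "0 < u" "u < 1"
  show "phi M (exp ((1 - u) *\<^sub>R x + u *\<^sub>R y)) \<le> (1 - u) * phi M (exp x) + u * phi M (exp y)"
  proof (rule field_le_epsilon)
    fix e :: real assume e: "e > 0"
    obtain a where a: "0 < a" "a < 1" "ln (M a) + exp x * a < phi M (exp x) + e" using phi_near_min[of "exp x" e] e by (auto simp del: exp_ln)
    obtain b where b: "0 < b" "b < 1" "ln (M b) + exp y * b < phi M (exp y) + e" using phi_near_min[of "exp y" e] e by auto
    define s where "s = (1 - u) * (- ln a) + u * (- ln b)"
    have s: "s > 0" unfolding s_def using a b u by (intro add_pos_pos mult_pos_pos) auto
    have "ln (M (exp (- s))) \<le> (1 - u) * ln (M (exp (- (- ln a)))) + u * ln (M (exp (- (- ln b))))"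
      using convex_onD[OF convex_exp, of u "- ln a" "- ln b"] u a b by (simp add: s_def)
    then have 1: "ln (M (exp (- s))) \<le> (1 - u) * ln (M a) + u * ln (M b)" using a b by simp
    have "exp ((1 - u) * (x + ln a) + u * (y + ln b)) \<le> (1 - u) * exp (x + ln a) + u * exp (y + ln b)"
      using convex_onD[OF exp_convex, of u "x + ln a" "y + ln b"] u by simp
    moreover have e: "(1 - u) * (x + ln a) + u * (y + ln b) = ((1 - u) * x + u * y) + (- s)" by (simp add: s_def algebra_simps)
    moreover have "exp (x + ln a) = exp x * a" "exp (y + ln b) = exp y * b" using a b by (simp_all add: exp_add)
    ultimately have 2: "exp ((1 - u) * x + u * y) * exp (- s) \<le> (1 - u) * (exp x * a) + u * (exp y * b)"
      unfolding exp_add[of _ "- s", symmetric] by simp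
    have "phi M (exp ((1 - u) * x + u * y)) \<le> ln (M (exp (- s))) + exp ((1 - u) * x + u * y) * exp (- s)"
      using s by (intro phi_le) auto
    also have "\<dots> \<le> (1 - u) * (ln (M a) + exp x * a) + u * (ln (M b) + exp y * b)"
      using 1 2 by (simp add: algebra_simps)
    also have "\<dots> \<le> (1 - u) * (phi M (exp x) + e) + u * (phi M (exp y) + e)"
    proof (rule add_mono)
      show "(1 - u) * (ln (M a) + exp x * a) \<le> (1 - u) * (phi M (exp x) + e)"
        by (rule mult_left_mono) (use a u in auto)
      show "u * (ln (M b) + exp y * b) \<le> u * (phi M (exp y) + e)"
        by (rule mult_left_mono) (use b u in auto)
    qed
    also have "\<dots> = (1 - u) * phi M (exp x) + u * phi M (exp y) + e" by (simp add: algebra_simps)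
    finally show "phi M (exp ((1 - u) *\<^sub>R x + u *\<^sub>R y)) \<le> (1 - u) * phi M (exp x) + u * phi M (exp y) + e" by simp
  qed
qed simp

lemma ln_growth:
  assumes A: "A > 0"
  obtains C where "\<And>\<xi>. 0 < \<xi> \<Longrightarrow> \<xi> < 1 \<Longrightarrow> - A * ln \<xi> - C \<le> ln (M \<xi>)"
proof -
  have "\<forall>\<^sub>F \<xi> in at_right 0. 1 \<le> \<xi> powr A * M \<xi>" using growth[of A] by (simp add: filterlim_at_top)
  then obtain d where d: "d > 0" "\<And>\<xi>. 0 < \<xi> \<Longrightarrow> \<xi> < d \<Longrightarrow> 1 \<le> \<xi> powr A * M \<xi>"
    by (auto simp: eventually_at_right_field)
  define \<eta> where "\<eta> = min d 1"
  have eta: "0 < \<eta>" "\<eta> \<le> 1" "\<eta> \<le> d" using d by (auto simp: \<eta>_def)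
  define C where "C = - A * ln \<eta> + \<bar>ln M1\<bar>"
  have C: "C \<ge> 0" "- A * ln \<eta> \<ge> 0"
  proof -
    show "- A * ln \<eta> \<ge> 0" using A eta by (simp add: mult_nonneg_nonpos)
    then show "C \<ge> 0" by (simp add: C_def)
  qed
  have "- A * ln \<xi> - C \<le> ln (M \<xi>)" if x: "0 < \<xi>" "\<xi> < 1" for \<xi>
  proof (cases "\<xi> < \<eta>")
    case True
    have "ln 1 \<le> ln (\<xi> powr A * M \<xi>)" using d(2)[of \<xi>] x True eta pos[OF x] by (subst ln_le_cancel_iff) auto
    also have "\<dots> = A * ln \<xi> + ln (M \<xi>)" using x pos[OF x] by (simp add: ln_mult ln_powr)
    finally show ?thesis using C by simp
  next
    case False
    then have "ln \<eta> \<le> ln \<xi>" using eta x by (subst ln_le_cancel_iff) auto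
    then have "A * ln \<eta> \<le> A * ln \<xi>" using A by (intro mult_left_mono) auto
    moreover have "ln M1 \<le> ln (M \<xi>)" using M1 x pos[OF x] by (subst ln_le_cancel_iff) auto
    ultimately show ?thesis unfolding C_def by linarith
  qed
  then show ?thesis using that by blast
qed

text \<open>The minimum of - A' ln \<xi> + t \<xi> lies at \<xi> = A' / t, expressed by ln x \<le> x
  - 1 at x = t \<xi> / A'. The extra 1 in \<open>A'\<close> leaves a spare ln t that absorbs all
  constants.\<close>

lemma phi_dominates_log: "\<forall>\<^sub>F t in at_top. A * ln t + B \<le> phi M t"
proof -
  define A' where "A' = \<bar>A\<bar> + 1"
  have A': "A' > 0" by (simp add: A'_def)
  obtain C where C: "\<And>\<xi>. 0 < \<xi> \<Longrightarrow> \<xi> < 1 \<Longrightarrow> - A' * ln \<xi> - C \<le> ln (M \<xi>)" using ln_growth[OF A'] by blast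
  have lower: "A' * ln t - A' * ln A' - C \<le> phi M t" if t: "t > 0" for t
  proof (rule phi_ge)
    fix \<xi> :: real assume x: "0 < \<xi>" "\<xi> < 1"
    have "ln (t * \<xi> / A') \<le> t * \<xi> / A' - 1" using t x A' by (intro ln_le_minus_one) auto
    then have "ln t + ln \<xi> - ln A' \<le> t * \<xi> / A' - 1" using t x A' by (simp add: ln_div ln_mult)
    then have "A' * (ln t + ln \<xi> - ln A') \<le> A' * (t * \<xi> / A' - 1)" using A' by (intro mult_left_mono) auto
    then have "A' * ln t + A' * ln \<xi> - A' * ln A' \<le> t * \<xi>" using A' by (simp add: algebra_simps)
    then show "A' * ln t - A' * ln A' - C \<le> ln (M \<xi>) + t * \<xi>" using C[OF x] by (simp add: algebra_simps)
  qed (use t in simp)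
  have "\<forall>\<^sub>F t in at_top. A' * ln A' + C + B \<le> ln (t::real)"
    using ln_at_top by (simp add: filterlim_at_top)
  then show ?thesis
    using eventually_ge_at_top[of 1]
  proof eventually_elim
    case (elim t)
    have "A * ln t + B \<le> \<bar>A\<bar> * ln t + B" using elim by (intro add_right_mono mult_right_mono) auto
    also have "\<dots> \<le> A' * ln t - A' * ln A' - C" using elim by (simp add: A'_def algebra_simps)
    also have "\<dots> \<le> phi M t" using elim by (intro lower) simp
    finally show ?case .
  qed
qed

text \<open>The double logarithm enters only through the widths \<open>w j\<close> of the strips where \<open>ln M > 2 ^ j\<close>:
  summation by layers bounds their sum by the integral of \<open>ln (ln M) / ln 2\<close>.\<close>

lemma summable_widths:
  obtains w :: "nat \<Rightarrow> real" and J where "summable w" "\<And>j. 0 < w j"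
    "\<And>j. J \<le> j \<Longrightarrow> w j \<le> 1/2 \<and> ln (M (w j)) \<le> 2 ^ j"
proof -
  obtain \<delta> where d: "0 < \<delta>" "\<delta> < 1" "\<And>\<xi>. 0 < \<xi> \<Longrightarrow> \<xi> < \<delta> \<Longrightarrow> 1 < M \<xi>"
    and int: "set_integrable lborel {0<..<\<delta>} (\<lambda>\<xi>. ln (ln (M \<xi>)))"
    using loglog by (auto simp: loglog_integrable_at_0_def)
  define E where "E = (\<lambda>j::nat. {\<xi>\<in>{0<..<\<delta>}. 2 ^ j < ln (M \<xi>)})"
  \<comment> \<open>The width of the strip on which ln M exceeds 2^j; the endpoint itself is left
    undecided by \<open>below\<close> and \<open>above\<close>.\<close>
  define W where "W = (\<lambda>j. Sup (E j))"
  have E_ne: "E j \<noteq> {}" for j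
  proof -
    have "\<forall>\<^sub>F \<xi> in at_right 0. exp (2 ^ j) < \<xi> powr 0 * M \<xi>" using growth[of 0] by (simp add: filterlim_at_top_dense)
    moreover have "\<forall>\<^sub>F \<xi> in at_right 0. \<xi> \<in> {0<..<\<delta>}" by (rule eventually_at_right_real[OF d(1)])
    ultimately have "\<forall>\<^sub>F \<xi> in at_right (0::real). \<xi> \<in> E j"
    proof eventually_elim
      case (elim \<xi>)
      then have "exp (2 ^ j) < M \<xi>" by auto
      then have "ln (exp (2 ^ j)) < ln (M \<xi>)" using pos[of \<xi>] elim d by (subst ln_less_cancel_iff) auto
      then show ?case using elim by (simp add: E_def)
    qed
    then show ?thesis using eventually_happens'[OF trivial_limit_at_right_real] by blast
  qed
  have E_bdd: "bdd_above (E j)" for j by (rule bdd_aboveI[where M=\<delta>]) (auto simp: E_def)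
  have W0: "W j > 0" "W j \<le> \<delta>" for j
  proof -
    obtain x where x: "x \<in> E j" using E_ne by blast
    then have "x \<le> W j" unfolding W_def by (rule cSup_upper[OF _ E_bdd])
    then show "W j > 0" using x by (auto simp: E_def)
    show "W j \<le> \<delta>" unfolding W_def by (rule cSup_least[OF E_ne]) (auto simp: E_def)
  qed
  have below: "2 ^ j < ln (M \<xi>)" if x: "0 < \<xi>" "\<xi> < W j" for j \<xi>
  proof -
    obtain e where e: "e \<in> E j" "\<xi> < e" using x(2) unfolding W_def by (subst (asm) less_cSup_iff[OF E_ne E_bdd]) auto
    then show ?thesis using ln_antimono[of \<xi> e] x d by (auto simp: E_def)
  qed
  have above: "ln (M \<xi>) \<le> 2 ^ j" if "W j < \<xi>" "\<xi> < \<delta>" for j \<xi>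
  proof (rule ccontr)
    assume "\<not> ln (M \<xi>) \<le> 2 ^ j"
    then have "\<xi> \<in> E j" using that W0[of j] by (auto simp: E_def)
    then have "\<xi> \<le> W j" unfolding W_def by (rule cSup_upper[OF _ E_bdd])
    then show False using that by simp
  qed
  define C where "C = (LBINT \<xi>:{0<..<\<delta>}. \<bar>ln (ln (M \<xi>))\<bar> / ln 2)"
  have bound: "(\<Sum>j<n. W (Suc j)) \<le> C" for n
  proof -
    \<comment> \<open>If m is the largest j < n with \<xi> < W (j + 1), at most m + 1 layers contain
      \<xi>, while 2^(m+1) < ln (M \<xi>). Counting layers from 1 avoids an additive
      constant.\<close>
    have layer: "(\<Sum>j<n. indicator {0<..<W (Suc j)} \<xi>) \<le> \<bar>ln (ln (M \<xi>))\<bar> / ln 2" if x: "0 < \<xi>" "\<xi> < \<delta>" for \<xi>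
    proof -
      define S where "S = {j\<in>{..<n}. \<xi> < W (Suc j)}"
      have S: "finite S" by (simp add: S_def)
      have "(\<Sum>j<n. indicator {0<..<W (Suc j)} \<xi>) = (\<Sum>j\<in>S. 1::real)"
        unfolding S_def using x by (intro sum.mono_neutral_cong_right) (auto simp: indicator_def)
      also have "\<dots> = real (card S)" by simp
      also have "\<dots> \<le> \<bar>ln (ln (M \<xi>))\<bar> / ln 2"
      proof (cases "S = {}")
        case False
        define m where "m = Max S"
        have mS: "m \<in> S" using False S by (simp add: m_def)
        have "S \<subseteq> {..m}" using S by (auto simp: m_def)
        then have "card S \<le> Suc m" using card_mono[of "{..m}" S] by simp
        moreover have "real (Suc m) \<le> \<bar>ln (ln (M \<xi>))\<bar> / ln 2"
        proof -
          have lt: "2 ^ Suc m < ln (M \<xi>)" using below[of \<xi> "Suc m"] mS x by (auto simp: S_def)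
          have "ln ((2::real) ^ Suc m) \<le> ln (ln (M \<xi>))"
            using lt by (subst ln_le_cancel_iff) (auto intro: less_trans[of _ "2 ^ Suc m"] simp del: power_Suc)
          then have "real (Suc m) * ln 2 \<le> ln (ln (M \<xi>))" by (simp add: ln_realpow del: power_Suc of_nat_Suc)
          then show ?thesis by (simp add: le_divide_eq del: of_nat_Suc)
        qed
        ultimately show ?thesis by linarith
      qed auto
      finally show ?thesis .
    qed
    have i1: "integrable lborel (\<lambda>\<xi>. indicator {0<..<W (Suc j)} \<xi> :: real)" for j
      by (rule integrable_real_indicator) (auto simp: emeasure_lborel_Ioo less_imp_le[OF W0(1)])
    have i2: "integrable lborel (\<lambda>\<xi>. indicator {0<..<\<delta>} \<xi> *\<^sub>R (\<bar>ln (ln (M \<xi>))\<bar> / ln 2))"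
      using set_integrable_divide[OF set_integrable_abs[OF int], of "ln 2"] by (simp add: set_integrable_def)
    have "(\<Sum>j<n. W (Suc j)) = (\<Sum>j<n. integral\<^sup>L lborel (\<lambda>\<xi>. indicator {0<..<W (Suc j)} \<xi>))"
      using W0 by (intro sum.cong refl) (simp add: less_imp_le)
    also have "\<dots> = integral\<^sup>L lborel (\<lambda>\<xi>. \<Sum>j<n. indicator {0<..<W (Suc j)} \<xi>)"
      by (rule Bochner_Integration.integral_sum[symmetric]) (rule i1)
    also have "\<dots> \<le> integral\<^sup>L lborel (\<lambda>\<xi>. indicator {0<..<\<delta>} \<xi> *\<^sub>R (\<bar>ln (ln (M \<xi>))\<bar> / ln 2))"
    proof (rule integral_mono[OF _ i2])
      show "integrable lborel (\<lambda>\<xi>. \<Sum>j<n. indicator {0<..<W (Suc j)} \<xi> :: real)" using i1 by (rule Bochner_Integration.integrable_sum)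
      fix \<xi> :: real
      show "(\<Sum>j<n. indicator {0<..<W (Suc j)} \<xi>) \<le> indicator {0<..<\<delta>} \<xi> *\<^sub>R (\<bar>ln (ln (M \<xi>))\<bar> / ln 2)"
      proof (cases "\<xi> \<in> {0<..<\<delta>}")
        case True then show ?thesis using layer[of \<xi>] by simp
      next
        case False
        then have "indicator {0<..<W (Suc j)} \<xi> = (0::real)" for j using W0(2)[of "Suc j"] by (auto simp: indicator_def)
        then show ?thesis using False by simp
      qed
    qed
    finally show ?thesis by (simp add: C_def set_lebesgue_integral_def)
  qed
  have "summable (\<lambda>j. W (Suc j))"
    by (rule summableI_nonneg_bounded[OF _ bound]) (use W0 less_imp_le in blast)
  then have "summable W" by (simp add: summable_Suc_iff)
  \<comment> \<open>The summable surplus (1/2)^j moves the point strictly beyond \<open>W j\<close>,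
    where ln M \<le> 2^j is available.\<close>
  define w where "w = (\<lambda>j. W j + (1/2) ^ j)"
  have sw: "summable w" unfolding w_def using \<open>summable W\<close> by (intro summable_add summable_geometric) auto
  then have "w \<longlonglongrightarrow> 0" by (rule summable_LIMSEQ_zero)
  then have "\<forall>\<^sub>F j in sequentially. w j < min \<delta> (1/2)" using d by (intro order_tendstoD) auto
  then obtain J where J: "\<And>j. j \<ge> J \<Longrightarrow> w j < min \<delta> (1/2)" by (auto simp: eventually_sequentially)
  show ?thesis
  proof
    show "summable w" by (rule sw)
    show "0 < w j" for j using W0[of j] by (simp add: w_def add_pos_pos)
    show "w j \<le> 1/2 \<and> ln (M (w j)) \<le> 2 ^ j" if "J \<le> j" for j
      using J[OF that] above[of j "w j"] by (auto simp: w_def)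
  qed
qed

text \<open>On the block 4^j \<le> t < 4^(j+1) the trial value \<xi> = w j gives phi t \<le> 2^j +
  4^(j+1) w j. Divided by 16^j \<le> 1 + t^2 and multiplied by the length 3 4^j of the block, this
  is 3 2^(-j) + 12 w j, which is summable; so is the contribution of the constant phi(0).\<close>

lemma phi_integrable: "set_integrable lborel {0..} (\<lambda>t. (phi M \<bar>t\<bar> - phi M 0) / (1 + t\<^sup>2))"
proof -
  define f where "f = (\<lambda>t. (phi M \<bar>t\<bar> - phi M 0) / (1 + t\<^sup>2))"
  have lip': "\<bar>phi M a - phi M b\<bar> \<le> \<bar>a - b\<bar>" if "0 \<le> a" "0 \<le> b" for a b
    using that phi_lipschitz[of a b] phi_lipschitz[of b a] phi_mono[of a b] phi_mono[of b a] by (cases "a \<le> b") auto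
  have lip: "\<bar>phi M \<bar>a\<bar> - phi M \<bar>b\<bar>\<bar> \<le> \<bar>a - b\<bar>" for a b
    by (rule order_trans[OF lip' abs_triangle_ineq3]) auto
  have "1-lipschitz_on UNIV (\<lambda>t. phi M \<bar>t\<bar>)" using lip by (intro lipschitz_onI) (auto simp: dist_real_def)
  then have cphi: "continuous_on UNIV (\<lambda>t. phi M \<bar>t\<bar>)" by (rule lipschitz_on_continuous_on)
  have cont: "continuous_on A f" for A
    unfolding f_def by (intro continuous_intros continuous_on_subset[OF cphi]) (auto simp: add_nonneg_eq_0_iff)
  have f0: "f t \<ge> 0" for t unfolding f_def using phi_mono[of 0 "\<bar>t\<bar>"] by simp
  have fm [measurable]: "f \<in> borel_measurable borel" by (rule borel_measurable_continuous_onI[OF cont])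
  obtain w J where w: "summable w" "\<And>j. 0 < w j" "\<And>j. J \<le> j \<Longrightarrow> w j \<le> 1/2 \<and> ln (M (w j)) \<le> 2 ^ j"
    using summable_widths by blast
  define c where "c = (\<lambda>j. (2 ^ j + \<bar>phi M 0\<bar> + 4 ^ Suc j * w j) / 16 ^ j)"
  have c0: "c j \<ge> 0" for j unfolding c_def using w(2)[of j] by (intro divide_nonneg_nonneg add_nonneg_nonneg mult_nonneg_nonneg) auto
  have fc: "f t \<le> c j" if j: "J \<le> j" and t: "4 ^ j \<le> t" "t < 4 ^ Suc j" for j t
  proof -
    have t0: "t \<ge> 0" using t(1) by (smt (verit) zero_le_power)
    have "phi M t \<le> ln (M (w j)) + t * w j" using t0 w(2)[of j] w(3)[OF j] by (intro phi_le) auto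
    also have "\<dots> \<le> 2 ^ j + 4 ^ Suc j * w j" using w(3)[OF j] w(2)[of j] t by (intro add_mono mult_right_mono) auto
    finally have "phi M t - phi M 0 \<le> 2 ^ j + \<bar>phi M 0\<bar> + 4 ^ Suc j * w j" by linarith
    moreover have "16 ^ j \<le> 1 + t\<^sup>2"
    proof -
      have "(4 ^ j)\<^sup>2 \<le> t\<^sup>2" using t by (intro power_mono) auto
      then show ?thesis by (simp add: power_mult_distrib[symmetric] power2_eq_square)
    qed
    moreover have "phi M 0 \<le> phi M t" using phi_mono[of 0 t] t0 by simp
    ultimately show ?thesis unfolding f_def c_def using t0 by (intro frac_le) auto
  qed
  have i1: "set_integrable lborel {0..4 ^ J} f" by (rule borel_integrable_atLeastAtMost'[OF cont])
  have i2: "set_integrable lborel {4 ^ J..} f"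
  proof -
    have meas: "(\<lambda>t. indicator {4 ^ J..} t *\<^sub>R f t) \<in> borel_measurable lborel" by measurable
    have "(\<integral>\<^sup>+t. ennreal (norm (indicator {4 ^ J..} t *\<^sub>R f t)) \<partial>lborel) \<le> (\<integral>\<^sup>+t. (\<Sum>j. ennreal (c j) * indicator {(4::real) ^ j..<4 ^ Suc j} t) \<partial>lborel)"
    proof (rule nn_integral_mono)
      fix t :: real
      show "ennreal (norm (indicator {4 ^ J..} t *\<^sub>R f t)) \<le> (\<Sum>j. ennreal (c j) * indicator {(4::real) ^ j..<4 ^ Suc j} t)"
      proof (cases "t \<ge> 4 ^ J")
        case True
        then have t1: "t \<ge> 1" using one_le_power[of "4::real" J] by linarith
        define j where "j = nat \<lfloor>log 4 t\<rfloor>"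
        have l0: "log 4 t \<ge> 0" using t1 by simp
        have fl: "real j \<le> log 4 t" "log 4 t < real j + 1" using l0 by (simp_all add: j_def)
        have "4 powr (real j) \<le> t" using fl(1) t1 by (simp add: le_log_iff)
        then have j1: "4 ^ j \<le> t" by (simp add: powr_realpow)
        have "t < 4 powr (real (Suc j))" using fl(2) t1 by (simp add: log_less_iff add.commute)
        then have j2: "t < 4 ^ Suc j" by (simp only: powr_realpow zero_less_numeral)
        have "(4::real) ^ J < 4 ^ Suc j" using True j2 by linarith
        then have J: "J \<le> j" using power_less_imp_less_exp[of "4::real" J "Suc j"] by simp
        have "ennreal (norm (indicator {4 ^ J..} t *\<^sub>R f t)) \<le> ennreal (c j) * indicator {(4::real) ^ j..<4 ^ Suc j} t"
          using True f0[of t] fc[OF J j1 j2] j1 j2 by (simp add: ennreal_leI)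
        also have "\<dots> \<le> (\<Sum>j. ennreal (c j) * indicator {(4::real) ^ j..<4 ^ Suc j} t)"
          using sum_le_suminf[of "\<lambda>j. ennreal (c j) * indicator {(4::real) ^ j..<4 ^ Suc j} t" "{j}"] by (simp del: sum_mult_indicator power_Suc)
        finally show ?thesis .
      qed simp
    qed
    also have "\<dots> = (\<Sum>j. \<integral>\<^sup>+t. ennreal (c j) * indicator {(4::real) ^ j..<4 ^ Suc j} t \<partial>lborel)"
      by (rule nn_integral_suminf) auto
    also have "\<dots> = (\<Sum>j. ennreal (c j * (3 * 4 ^ j)))"
    proof (intro suminf_cong)
      fix j
      have "(4::real) ^ Suc j - 4 ^ j = 3 * 4 ^ j" by simp
      then have "emeasure lborel {(4::real) ^ j..<4 ^ Suc j} = ennreal (3 * 4 ^ j)" by (subst emeasure_lborel_Ico) auto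
      then show "(\<integral>\<^sup>+t. ennreal (c j) * indicator {(4::real) ^ j..<4 ^ Suc j} t \<partial>lborel) = ennreal (c j * (3 * 4 ^ j))"
        using c0[of j] by (simp add: nn_integral_cmult ennreal_mult)
    qed
    also have "\<dots> < \<infinity>"
    proof -
      have "c j * (3 * 4 ^ j) = 3 * (1/2) ^ j + 3 * \<bar>phi M 0\<bar> * (1/4) ^ j + 12 * w j" for j
      proof -
        have "(16::real) ^ j = 4 ^ j * 4 ^ j" "(4::real) ^ j = 2 ^ j * 2 ^ j" by (simp_all add: power_mult_distrib[symmetric])
        then show ?thesis by (simp add: c_def field_simps power_one_over)
      qed
      moreover have "summable (\<lambda>j. 3 * (1/2) ^ j + 3 * \<bar>phi M 0\<bar> * (1/4) ^ j + 12 * w j)"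
        by (intro summable_add summable_mult summable_geometric w) auto
      ultimately have "summable (\<lambda>j. c j * (3 * 4 ^ j))" by simp
      then have "(\<Sum>j. ennreal (c j * (3 * 4 ^ j))) \<noteq> top" by (rule ennreal_suminf_neq_top) (use c0 in simp)
      then show ?thesis by (simp add: less_top)
    qed
    finally show ?thesis unfolding set_integrable_def using meas by (intro integrableI_bounded) auto
  qed
  have "{0..} = {0..4 ^ J} \<union> {(4::real) ^ J..}" by (auto intro: order_trans[rotated])
  with set_integrable_Un[OF i1 i2] show ?thesis unfolding f_def by simp
qed

sublocale weight "\<lambda>t. phi M \<bar>t\<bar> - phi M 0"
proof
  fix t a b A :: real
  show "phi M \<bar>- t\<bar> - phi M 0 = phi M \<bar>t\<bar> - phi M 0" by simp
  show "phi M \<bar>0\<bar> - phi M 0 = 0" by simp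
  show "phi M \<bar>a\<bar> - phi M 0 \<le> phi M \<bar>b\<bar> - phi M 0" if "0 \<le> a" "a \<le> b" using phi_mono[OF that] that by simp
  show "phi M \<bar>b\<bar> - phi M 0 - (phi M \<bar>a\<bar> - phi M 0) \<le> b - a" if "0 \<le> a" "a \<le> b" using phi_lipschitz[OF that] that by simp
  show "convex_on UNIV (\<lambda>x. phi M \<bar>exp x\<bar> - phi M 0)"
    using convex_on_add[OF phi_log_convex, of "\<lambda>_. - phi M 0"] by (simp add: convex_on_const)
  show "set_integrable lborel {0..} (\<lambda>t. (phi M \<bar>t\<bar> - phi M 0) / (1 + t\<^sup>2))" by (rule phi_integrable)
  show "\<forall>\<^sub>F t in at_top. A * ln t \<le> phi M \<bar>t\<bar> - phi M 0"
    using phi_dominates_log[of A "phi M 0"] eventually_ge_at_top[of 0] by eventually_elim auto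
qed

lemma phi_quotient_integrable:
  assumes y: "y > 0"
  shows "set_integrable lborel {0..} (\<lambda>t. phi M t / (t\<^sup>2 + y\<^sup>2))"
    and "2 * y / pi * (LBINT t:{0..}. phi M t / (t\<^sup>2 + y\<^sup>2)) = phi M 0 + poisson y"
proof -
  define p where "p = (\<lambda>t. phi M \<bar>t\<bar> - phi M 0)"
  have i1: "set_integrable lborel {0..} (\<lambda>t. p t / (t\<^sup>2 + y\<^sup>2))" using p_integrable[OF y] by (simp add: p_def)
  note i2 = poisson_const[OF y, of "phi M 0"]
  have eq: "phi M t / (t\<^sup>2 + y\<^sup>2) = phi M 0 / (t\<^sup>2 + y\<^sup>2) + p t / (t\<^sup>2 + y\<^sup>2)" if "t \<in> {0..}" for t
    using that by (simp add: p_def flip: add_divide_distrib)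
  have "set_integrable lborel {0..} (\<lambda>t. phi M 0 / (t\<^sup>2 + y\<^sup>2) + p t / (t\<^sup>2 + y\<^sup>2))"
    by (intro set_integral_add i1 i2)
  then show "set_integrable lborel {0..} (\<lambda>t. phi M t / (t\<^sup>2 + y\<^sup>2))"
    by (subst set_integrable_cong[OF refl refl eq]) auto
  have "(LBINT t:{0..}. phi M t / (t\<^sup>2 + y\<^sup>2)) = (LBINT t:{0..}. phi M 0 / (t\<^sup>2 + y\<^sup>2) + p t / (t\<^sup>2 + y\<^sup>2))"
    by (rule set_lebesgue_integral_cong) (use eq in auto)
  also have "\<dots> = (LBINT t:{0..}. phi M 0 / (t\<^sup>2 + y\<^sup>2)) + (LBINT t:{0..}. p t / (t\<^sup>2 + y\<^sup>2))"
    by (intro set_integral_add i1 i2)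
  finally have "2 * y / pi * (LBINT t:{0..}. phi M t / (t\<^sup>2 + y\<^sup>2)) =
    2 * y / pi * (LBINT t:{0..}. phi M 0 / (t\<^sup>2 + y\<^sup>2)) + 2 * y / pi * (LBINT t:{0..}. p t / (t\<^sup>2 + y\<^sup>2))"
    by (simp only: distrib_left)
  also have "2 * y / pi * (LBINT t:{0..}. phi M 0 / (t\<^sup>2 + y\<^sup>2)) = phi M 0" by (rule i2)
  finally show "2 * y / pi * (LBINT t:{0..}. phi M t / (t\<^sup>2 + y\<^sup>2)) = phi M 0 + poisson y"
    by (simp add: poisson_def poisson_mean_def p_def)
qed

text \<open>The Poisson integral reproduces the constant phi(0), which therefore comes out of the
  supremum.\<close>

lemma Q_eq:
  assumes s: "s > 0" shows "Q M s = ereal (phi M 0 + legendre s)"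
proof -
  have "Q M s = (SUP y\<in>{0<..}. ereal (phi M 0 + (poisson y - y * s)))"
    unfolding Q_def by (rule SUP_cong[OF refl], subst phi_quotient_integrable(2)) (simp_all add: algebra_simps)
  also have "\<dots> = ereal (SUP y\<in>{0<..}. phi M 0 + (poisson y - y * s))"
  proof (subst ereal_SUP)
    obtain B where B: "\<And>y. y \<in> {0<..} \<Longrightarrow> poisson y - y * s \<le> B" using legendre_bdd[OF s] by (auto simp: bdd_above_def)
    have "(SUP y\<in>{0<..}. ereal (phi M 0 + (poisson y - y * s))) \<le> ereal (phi M 0 + B)"
      by (rule SUP_least) (use B in auto)
    moreover have "ereal (phi M 0 + (poisson 1 - 1 * s)) \<le> (SUP y\<in>{0<..}. ereal (phi M 0 + (poisson y - y * s)))"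
      by (rule SUP_upper) auto
    ultimately show "\<bar>SUP y\<in>{0<..}. ereal (phi M 0 + (poisson y - y * s))\<bar> \<noteq> \<infinity>" by auto
  qed simp
  also have "(SUP y\<in>{0<..}. phi M 0 + (poisson y - y * s)) = phi M 0 + legendre s"
  proof (rule antisym)
    show "(SUP y\<in>{0<..}. phi M 0 + (poisson y - y * s)) \<le> phi M 0 + legendre s"
      by (rule cSUP_least) (use legendre_upper[OF s] in auto)
    have bdd: "bdd_above ((\<lambda>y. phi M 0 + (poisson y - y * s)) ` {0<..})"
      by (rule bdd_aboveI2[where M="phi M 0 + legendre s"]) (use legendre_upper[OF s] in auto)
    have "legendre s \<le> (SUP y\<in>{0<..}. phi M 0 + (poisson y - y * s)) - phi M 0"
      unfolding legendre_def
    proof (rule cSUP_least)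
      fix y :: real assume "y \<in> {0<..}"
      then show "poisson y - y * s \<le> (SUP y\<in>{0<..}. phi M 0 + (poisson y - y * s)) - phi M 0"
        using cSUP_upper[OF _ bdd, of y] by linarith
    qed auto
    then show "phi M 0 + legendre s \<le> (SUP y\<in>{0<..}. phi M 0 + (poisson y - y * s))" by simp
  qed
  finally show ?thesis .
qed

end

section \<open>Levinson's theorem and the Borel transform\<close>

context weight begin

text \<open>The quotient of f by exp (outer (-i v)) is studied on Im v \<ge> 1. On the line Im v = 1
  both the strip bound and p |v| \<le> Re (outer (-i v)) are at hand, so no boundary values of
  \<open>outer\<close> are involved. As Re outer \<ge> 0, the quotient keeps exponential type zero,
  and Re outer \<le> poisson |v| turns the result into a radial bound.\<close>

lemma entire_bound_half_plane:
  fixes f :: "complex \<Rightarrow> complex"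
  assumes hol: "f holomorphic_on UNIV"
    and type0: "\<And>\<epsilon>. \<epsilon> > 0 \<Longrightarrow> \<exists>K. \<forall>v. cmod (f v) \<le> K * exp (\<epsilon> * cmod v)"
    and strip: "\<And>v. cmod (f v) \<le> C * exp (p (Re v) + \<bar>Im v\<bar>)"
    and v: "1 \<le> Im v"
  shows "cmod (f v) \<le> C * exp 1 * exp (poisson (cmod v))"
proof -
  define G where "G = (\<lambda>z. f (\<i> * (z + 1)) * exp (- outer (z + 1)))"
  have C0: "C \<ge> 0" using strip[of 0] by (simp add: zero order_trans[OF norm_ge_zero])
  have hG: "G holomorphic_on {z. -1 < Re z}"
    unfolding G_def
    by (intro holomorphic_intros holomorphic_on_compose_gen[OF _ hol, unfolded o_def]
        holomorphic_on_compose_gen[OF _ outer_holomorphic, unfolded o_def]) auto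
  have nG: "cmod (G z) = cmod (f (\<i> * (z + 1))) * exp (- Re (outer (z + 1)))" for z
    by (simp add: G_def norm_mult)
  have RO: "p (cmod (z + 1)) \<le> Re (outer (z + 1))" if "0 \<le> Re z" for z
    using that by (intro outer_Re_ge) auto
  define z where "z = - \<i> * v - 1"
  have z: "0 \<le> Re z" "\<i> * (z + 1) = v" "cmod (z + 1) = cmod v" using v by (simp_all add: z_def norm_mult)
  have "cmod (G z) \<le> C * exp 1"
  proof (rule phragmen_lindelof_half_plane[OF hG _ _ _ z(1)])
    show "u \<in> {z. - 1 < Re z}" if "0 \<le> Re u" for u using that by simp
    show "\<exists>K. \<forall>u. 0 \<le> Re u \<longrightarrow> cmod (G u) \<le> K * exp (\<epsilon> * cmod u)" if e: "\<epsilon> > 0" for \<epsilon>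
    proof -
      obtain K where K: "\<And>v. cmod (f v) \<le> K * exp (\<epsilon> * cmod v)" using type0[OF e] by blast
      have K0: "K \<ge> 0" using K[of 0] by (simp add: order_trans[OF norm_ge_zero])
      have "cmod (G u) \<le> K * exp \<epsilon> * exp (\<epsilon> * cmod u)" if u: "0 \<le> Re u" for u
      proof -
        have "0 \<le> Re (outer (u + 1))" using RO[OF u] nonneg[of "cmod (u + 1)"] by linarith
        then have "cmod (G u) \<le> K * exp (\<epsilon> * cmod (\<i> * (u + 1))) * 1"
          unfolding nG using K[of "\<i> * (u + 1)"] K0 by (intro mult_mono) auto
        also have "\<dots> \<le> K * exp (\<epsilon> * (cmod u + 1))"
          using K0 e norm_triangle_ineq[of u 1] by (auto simp: norm_mult intro!: mult_left_mono)
        also have "\<dots> = K * exp \<epsilon> * exp (\<epsilon> * cmod u)" by (simp add: distrib_left exp_add)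
        finally show ?thesis .
      qed
      then show ?thesis by blast
    qed
    show "cmod (G u) \<le> C * exp 1" if u: "Re u = 0" for u
    proof -
      have f: "cmod (f (\<i> * (u + 1))) \<le> C * exp (p (Im u) + 1)" using strip[of "\<i> * (u + 1)"] u by (simp add: even)
      have "p (Im u) = p \<bar>Im (u + 1)\<bar>" by (simp add: p_abs)
      also have "\<dots> \<le> p (cmod (u + 1))" by (rule mono) (use abs_Im_le_cmod[of "u + 1"] in auto)
      finally have "p (Im u) \<le> Re (outer (u + 1))" using RO[of u] u by simp
      then have "cmod (G u) \<le> C * exp (p (Im u) + 1) * exp (- p (Im u))"
        unfolding nG using f C0 by (intro mult_mono) auto
      also have "\<dots> = C * exp 1" by (simp add: mult.assoc flip: exp_add)
      finally show ?thesis .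
    qed
  qed
  then have "cmod (f v) \<le> C * exp 1 * exp (Re (outer (z + 1)))"
    unfolding nG z(2) by (simp add: exp_minus field_simps)
  also have "\<dots> \<le> C * exp 1 * exp (poisson (cmod v))"
    using outer_Re_le[of "z + 1"] z C0 by (intro mult_left_mono) auto
  finally show ?thesis .
qed

text \<open>The reflection v \<mapsto> -v covers the lower half-plane because \<open>p\<close> is
  even; for |Im v| \<le> 1 the strip bound suffices, as p \<le> poisson.\<close>

lemma entire_bound:
  fixes f :: "complex \<Rightarrow> complex"
  assumes hol: "f holomorphic_on UNIV"
    and type0: "\<And>\<epsilon>. \<epsilon> > 0 \<Longrightarrow> \<exists>K. \<forall>v. cmod (f v) \<le> K * exp (\<epsilon> * cmod v)"
    and strip: "\<And>v. cmod (f v) \<le> C * exp (p (Re v) + \<bar>Im v\<bar>)"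
  shows "cmod (f v) \<le> C * exp 1 * exp (poisson (cmod v))"
proof -
  have C0: "C \<ge> 0" using strip[of 0] by (simp add: zero order_trans[OF norm_ge_zero])
  consider "1 \<le> Im v" | "Im v \<le> -1" | "\<bar>Im v\<bar> \<le> 1" by linarith
  then show ?thesis
  proof cases
    case 1
    show ?thesis by (rule entire_bound_half_plane[OF hol type0 strip 1])
  next
    case 2
    have "cmod ((\<lambda>v. f (- v)) (- v)) \<le> C * exp 1 * exp (poisson (cmod (- v)))"
    proof (rule entire_bound_half_plane)
      show "(\<lambda>v. f (- v)) holomorphic_on UNIV"
        by (rule holomorphic_on_compose_gen[OF _ hol, unfolded o_def]) (auto intro: holomorphic_intros)
      show "\<exists>K. \<forall>v. cmod (f (- v)) \<le> K * exp (\<epsilon> * cmod v)" if "\<epsilon> > 0" for \<epsilon>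
        using type0[OF that] by (metis norm_minus_cancel)
      show "cmod (f (- v)) \<le> C * exp (p (Re v) + \<bar>Im v\<bar>)" for v
        using strip[of "- v"] by (simp add: even)
    qed (use 2 in simp)
    then show ?thesis by simp
  next
    case 3
    have pp: "p (cmod v) \<le> poisson (cmod v)"
    proof (cases "v = 0")
      case True then show ?thesis by (simp add: zero poisson_def)
    next
      case False then show ?thesis by (intro poisson_ge) simp
    qed
    have "p (Re v) = p \<bar>Re v\<bar>" by (simp add: p_abs)
    also have "\<dots> \<le> p (cmod v)" by (rule mono) (auto intro: abs_Re_le_cmod)
    finally have "p (Re v) + \<bar>Im v\<bar> \<le> 1 + poisson (cmod v)" using pp 3 by linarith
    then have "C * exp (p (Re v) + \<bar>Im v\<bar>) \<le> C * exp (1 + poisson (cmod v))" using C0 by (intro mult_left_mono) auto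
    then show ?thesis using strip[of v] by (simp add: exp_add mult.assoc)
  qed
qed

end

section \<open>Bounds for admissible functions near the imaginary axis, away from the origin\<close>

lemma open_unit_square: "open unit_square"
  unfolding unit_square_def by (intro open_Collect_conj open_Collect_less continuous_intros)

lemma open_punctured_square: "open punctured_square"
  unfolding punctured_square_def by (intro open_Diff open_unit_square) auto

lemma unit_square_box: "unit_square = box (Complex (-1) (-1)) (Complex 1 1)"
  by (auto simp: unit_square_def in_box_complex_iff)

lemma cball_subset_unit_square: "r < 1 \<Longrightarrow> cball 0 r \<subseteq> unit_square"
  using abs_Re_le_cmod abs_Im_le_cmod by (force simp: unit_square_def intro: le_less_trans)

context majorant begin

lemma majorized_holomorphic: "F \<in> majorized M \<Longrightarrow> F holomorphic_on punctured_square"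
  by (simp add: majorized_def analytic_imp_holomorphic)

lemma majorized_le:
  assumes "F \<in> majorized M" "z \<in> unit_square" "Re z \<noteq> 0"
  shows "cmod (F z) \<le> M \<bar>Re z\<bar>"
  using assms by (auto simp: majorized_def punctured_square_def)

text \<open>Levinson's theorem, by Domar's argument: a bound on a strip improves from \<open>exp (2 ^ (n + 1))\<close> to
  \<open>exp (2 ^ n)\<close> at the expense of the height of the strip, and the losses of height are summable.\<close>

lemma levinson:
  obtains C where "\<And>F z. F \<in> majorized M \<Longrightarrow> \<bar>Re z\<bar> < 1 \<Longrightarrow> 1/4 \<le> \<bar>Im z\<bar> \<Longrightarrow> \<bar>Im z\<bar> \<le> 1/2 \<Longrightarrow> cmod (F z) \<le> C"
proof -
  obtain w J0 where w: "summable w" "\<And>j. 0 < w j" "\<And>j. J0 \<le> j \<Longrightarrow> w j \<le> 1/2 \<and> ln (M (w j)) \<le> 2 ^ j"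
    using summable_widths by blast
  obtain N1 where N1: "\<And>n. n \<ge> N1 \<Longrightarrow> norm (\<Sum>i. w (i + n)) < 1/128"
    using suminf_exist_split[OF _ w(1), of "1/128"] by auto
  obtain N2 :: nat where N2: "ln (M (1/2)) < 2 ^ N2" using real_arch_pow[of 2 "ln (M (1/2))"] by auto
  define J where "J = max J0 (max N1 N2)"
  define W where "W = (\<lambda>n. w (n + J))"
  have W: "0 < W n" "W n \<le> 1/2" "ln (M (W n)) \<le> 2 ^ (J + n)" for n
    using w(2,3)[of "n + J"] by (auto simp: W_def J_def add.commute)
  \<comment> \<open>The height given up in n improvements, each costing 16 W k. A tail of the widths
    below 1/128 keeps the total within 1/8, so that |Im z| \<ge> 1/4 keeps all rectangles off the
    origin.\<close>
  define a where "a = (\<lambda>n. \<Sum>k<n. 16 * W k)"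
  have a: "0 \<le> a n" "a n \<le> 1/8" for n
  proof -
    show "0 \<le> a n" unfolding a_def using W(1) less_imp_le by (intro sum_nonneg) auto
    have sW: "summable W" unfolding W_def using w(1) by (rule summable_ignore_initial_segment)
    have "(\<Sum>k<n. W k) \<le> suminf W" by (rule sum_le_suminf[OF sW]) (use W(1) less_imp_le in auto)
    also have "suminf W \<le> 1/128"
    proof -
      have "N1 \<le> J" by (simp add: J_def)
      from N1[OF this] have "\<bar>\<Sum>i. w (i + J)\<bar> < 1/128" by simp
      then show ?thesis unfolding W_def by linarith
    qed
    finally show "a n \<le> 1/8" by (simp add: a_def flip: sum_distrib_left)
  qed
  have MJ: "ln (M (1/2)) \<le> 2 ^ J"
  proof -
    have "(2::real) ^ N2 \<le> 2 ^ J" by (rule power_increasing) (auto simp: J_def)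
    then show ?thesis using N2 by linarith
  qed
  have Mexp: "M x \<le> exp b" if "0 < x" "x < 1" "ln (M x) \<le> b" for x b
    using that pos[of x] by (metis exp_le_cancel_iff exp_ln)
  have main: "cmod (F z) \<le> exp (2 ^ (J + 1))"
    if F: "F \<in> majorized M" and z: "\<bar>Re z\<bar> < 1" "1/4 \<le> \<bar>Im z\<bar>" "\<bar>Im z\<bar> \<le> 1/2" for F z
  proof (cases "\<bar>Re z\<bar> \<le> 1/2")
    case False
    then have "cmod (F z) \<le> M \<bar>Re z\<bar>" using F z by (intro majorized_le) (auto simp: unit_square_def)
    also have "\<dots> \<le> M (1/2)" using False z by (intro antimono) auto
    also have "\<dots> \<le> exp (2 ^ J)" by (rule Mexp) (use MJ in auto)
    also have "\<dots> \<le> exp (2 ^ (J + 1))" by simp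
    finally show ?thesis .
  next
    case True
    define \<eta> where "\<eta> = Im z"
    note hol = majorized_holomorphic[OF F]
    have inS: "u \<in> punctured_square" if "\<bar>Re u\<bar> \<le> 1/2" "\<bar>Im u - \<eta>\<bar> \<le> 1/8" for u
    proof -
      have "\<bar>Im u\<bar> < 1" "Im u \<noteq> 0" "\<bar>Re u\<bar> < 1" using that z unfolding \<eta>_def by linarith+
      then show ?thesis by (auto simp: punctured_square_def unit_square_def)
    qed
    define B where "B = (\<lambda>n. \<forall>u. \<bar>Re u\<bar> \<le> 1/2 \<longrightarrow> \<bar>Im u - \<eta>\<bar> \<le> a n \<longrightarrow> cmod (F u) \<le> exp (2 ^ (J + 1 + n)))"
    have step: "B n" if Bn: "B (Suc n)" for n
      unfolding B_def
    proof (intro allI impI)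
      fix u assume u: "\<bar>Re u\<bar> \<le> 1/2" "\<bar>Im u - \<eta>\<bar> \<le> a n"
      have aS: "a (Suc n) = a n + 16 * W n" by (simp add: a_def)
      \<comment> \<open>With half-height 16 W n the two-constants estimate adds a quarter of
        2^(J+n+2) to 2^(J+n), and the sum is 2^(J+n+1).\<close>
      have "cmod (F u) \<le> exp (2 ^ (J + n) + 2 ^ (J + 1 + Suc n) * (4 * W n / (16 * W n)))"
      proof (rule two_constants_rectangle[OF hol open_punctured_square, where \<rho>="1/2" and \<eta>="Im u"])
        fix x assume x: "\<bar>Re x\<bar> \<le> 1/2" "\<bar>Im x - Im u\<bar> \<le> 16 * W n"
        have xa: "\<bar>Im x - \<eta>\<bar> \<le> a (Suc n)" using x u unfolding aS by linarith
        then show "x \<in> punctured_square" using x a(2)[of "Suc n"] by (intro inS) auto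
        show "cmod (F x) \<le> exp (2 ^ (J + 1 + Suc n))" using Bn x xa by (auto simp: B_def)
      next
        fix x assume x: "W n \<le> \<bar>Re x\<bar>" "\<bar>Re x\<bar> \<le> 1/2" "\<bar>Im x - Im u\<bar> \<le> 16 * W n"
        have "\<bar>Im x - \<eta>\<bar> \<le> a (Suc n)" using x u unfolding aS by linarith
        then have "x \<in> punctured_square" using x a(2)[of "Suc n"] by (intro inS) auto
        then have "cmod (F x) \<le> M \<bar>Re x\<bar>" using x W(1)[of n] by (intro majorized_le[OF F]) (auto simp: punctured_square_def)
        also have "\<dots> \<le> M (W n)" using x W(1)[of n] by (intro antimono) auto
        also have "\<dots> \<le> exp (2 ^ (J + n))" using W[of n] by (intro Mexp) auto
        finally show "cmod (F x) \<le> exp (2 ^ (J + n))" .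
      qed (use W[of n] u in auto)
      also have "2 ^ (J + n) + 2 ^ (J + 1 + Suc n) * (4 * W n / (16 * W n)) = (2::real) ^ (J + 1 + n)"
        using W(1)[of n] by simp
      finally show "cmod (F u) \<le> exp (2 ^ (J + 1 + n))" .
    qed
    define R where "R = cbox (Complex (-1/2) (\<eta> - 1/8)) (Complex (1/2) (\<eta> + 1/8))"
    have inR: "u \<in> R \<longleftrightarrow> \<bar>Re u\<bar> \<le> 1/2 \<and> \<bar>Im u - \<eta>\<bar> \<le> 1/8" for u
      unfolding R_def in_cbox_complex_iff abs_le_iff by (simp, argo)
    have "continuous_on R F"
      by (rule continuous_on_subset[OF holomorphic_on_imp_continuous_on[OF hol]]) (use inS inR in auto)
    moreover have "compact R" unfolding R_def by (rule compact_cbox)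
    ultimately have "bounded (F ` R)" using compact_continuous_image compact_imp_bounded by blast
    then obtain K where K: "\<And>u. u \<in> R \<Longrightarrow> cmod (F u) \<le> K" by (auto simp: bounded_iff)
    \<comment> \<open>Compactness supplies some bound, which may depend on F and z; it only decides
      where the descent starts, and the bound reached at n = 0 does not depend on it.\<close>
    obtain N :: nat where N: "K < 2 ^ N" using real_arch_pow[of 2 K] by auto
    have "B N"
      unfolding B_def
    proof (intro allI impI)
      fix u assume u: "\<bar>Re u\<bar> \<le> 1/2" "\<bar>Im u - \<eta>\<bar> \<le> a N"
      then have "cmod (F u) \<le> K" using a(2)[of N] by (intro K) (auto simp: inR)
      also have "K \<le> 2 ^ (J + 1 + N)" using N power_increasing[of N "J + 1 + N" "2::real"] by simp
      also have "\<dots> \<le> exp (2 ^ (J + 1 + N))" using exp_ge_add_one_self[of "2 ^ (J + 1 + N)"] by linarith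
      finally show "cmod (F u) \<le> exp (2 ^ (J + 1 + N))" .
    qed
    then have "B 0"
    proof (induction N)
      case (Suc N) then show ?case using step by blast
    qed
    then show ?thesis using True by (auto simp: B_def \<eta>_def a_def)
  qed
  show ?thesis by (rule that) (rule main)
qed

text \<open>If the principal part of F at 0 is \<Sum> c_k / z^(k+1), this is \<Sum> c_k v^k / k!,
  the entire function whose Laplace transform is that principal part. In the residue form any
  contour around 0 may be used.\<close>

definition borel_transform :: "(complex \<Rightarrow> complex) \<Rightarrow> complex \<Rightarrow> complex" where
  "borel_transform F v = residue (\<lambda>w. F w * exp (v * w)) 0"

lemma borel_transform_circle:
  assumes F: "F \<in> majorized M" and r: "0 < r" "r < 1"
  shows "((\<lambda>w. F w * exp (v * w)) has_contour_integral 2 * pi * \<i> * borel_transform F v) (circlepath 0 r)"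
  unfolding borel_transform_def
proof (rule base_residue[OF open_unit_square _ r(1)])
  show "(\<lambda>w. F w * exp (v * w)) holomorphic_on unit_square - {0}"
    using majorized_holomorphic[OF F] by (intro holomorphic_intros) (simp add: punctured_square_def)
  show "cball 0 r \<subseteq> unit_square" using r by (intro cball_subset_unit_square)
qed (auto simp: unit_square_def)

lemma circle_in_punctured_square: "0 < r \<Longrightarrow> r < 1 \<Longrightarrow> cmod z = r \<Longrightarrow> z \<in> punctured_square"
  using cball_subset_unit_square[of r] by (auto simp: punctured_square_def)

lemma circle_bound:
  assumes F: "F \<in> majorized M" and r: "0 < r" "r < 1"
  obtains B where "B > 0" "\<And>z. cmod z = r \<Longrightarrow> cmod (F z) \<le> B"
proof -
  have "continuous_on (sphere 0 r) F"
    by (rule continuous_on_subset[OF holomorphic_on_imp_continuous_on[OF majorized_holomorphic[OF F]]])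
       (use circle_in_punctured_square r in auto)
  then have "bounded (F ` sphere 0 r)" using compact_continuous_image compact_imp_bounded compact_sphere by blast
  then obtain B where "B > 0" "\<And>z. z \<in> sphere 0 r \<Longrightarrow> cmod (F z) \<le> B" by (auto simp: bounded_pos)
  then show ?thesis using that by auto
qed

text \<open>The circle may be shrunk to a radius r \<le> \<epsilon>, on which |exp (v w)| \<le> exp
  (\<epsilon> |v|).\<close>

lemma borel_transform_type_zero:
  assumes F: "F \<in> majorized M" and e: "\<epsilon> > 0"
  shows "\<exists>K. \<forall>v. cmod (borel_transform F v) \<le> K * exp (\<epsilon> * cmod v)"
proof -
  define r where "r = min \<epsilon> (1/2)"
  have r: "0 < r" "r < 1" "r \<le> \<epsilon>" using e by (auto simp: r_def)
  obtain B where B: "B > 0" "\<And>z. cmod z = r \<Longrightarrow> cmod (F z) \<le> B" using circle_bound[OF F r(1,2)] by blast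
  have "cmod (borel_transform F v) \<le> B * r * exp (\<epsilon> * cmod v)" for v
  proof -
    have "cmod (2 * pi * \<i> * borel_transform F v) \<le> (B * exp (\<epsilon> * cmod v)) * (2 * pi * r)"
    proof (rule has_contour_integral_bound_circlepath[OF borel_transform_circle[OF F r(1,2)]])
      fix z :: complex assume "cmod (z - 0) = r"
      then have z: "cmod z = r" by simp
      have "Re (v * z) \<le> cmod v * cmod z" by (metis complex_Re_le_cmod norm_mult)
      also have "\<dots> \<le> \<epsilon> * cmod v" using z r by (simp add: mult.commute mult_right_mono)
      finally show "cmod (F z * exp (v * z)) \<le> B * exp (\<epsilon> * cmod v)"
        unfolding norm_mult norm_exp_eq_Re using B(2)[OF z] B(1) by (intro mult_mono) auto
    qed (use B r in auto)
    then show ?thesis by (simp add: norm_mult mult_ac)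
  qed
  then show ?thesis by blast
qed

lemma borel_transform_entire:
  assumes F: "F \<in> majorized M"
  shows "borel_transform F holomorphic_on UNIV"
proof -
  define c where "c = (\<lambda>x. circlepath 0 (1/2) x)"
  define d where "d = (\<lambda>x. vector_derivative (circlepath 0 (1/2)) (at x))"
  have cc: "continuous_on A c" for A unfolding c_def circlepath by (intro continuous_intros)
  have cd: "continuous_on A d" for A unfolding d_def vector_derivative_circlepath by (intro continuous_intros)
  have cn: "c x \<in> punctured_square" for x
  proof (rule circle_in_punctured_square[of "1/2"])
    show "cmod (c x) = 1/2" unfolding c_def circlepath by (simp add: norm_mult)
  qed auto
  have cF: "continuous_on A (\<lambda>x. F (c x))" for A
    by (rule continuous_on_compose2[OF holomorphic_on_imp_continuous_on[OF majorized_holomorphic[OF F]] cc]) (use cn in auto)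
  have "(\<lambda>v. integral (cbox 0 1) (\<lambda>x. F (c x) * exp (v * c x) * d x)) holomorphic_on UNIV"
  proof (rule leibniz_rule_holomorphic[where fx="\<lambda>v x. F (c x) * (c x * exp (v * c x)) * d x"])
    show "((\<lambda>v. F (c t) * exp (v * c t) * d t) has_field_derivative F (c t) * (c t * exp (v * c t)) * d t) (at v within UNIV)" for v t
      by (auto intro!: derivative_eq_intros)
    show "(\<lambda>x. F (c x) * exp (v * c x) * d x) integrable_on cbox 0 1" for v
      by (intro integrable_continuous continuous_intros cF cc cd)
    have s: "continuous_on A (\<lambda>x. F (c (snd x)))" "continuous_on A (\<lambda>x. c (snd x))" "continuous_on A (\<lambda>x. d (snd x))" for A :: "(complex \<times> real) set"
      by (rule continuous_on_compose2[OF cF[of UNIV]] continuous_on_compose2[OF cc[of UNIV]] continuous_on_compose2[OF cd[of UNIV]]; auto intro: continuous_intros)+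
    show "continuous_on (UNIV \<times> cbox 0 1) (\<lambda>(v, x). F (c x) * (c x * exp (v * c x)) * d x)"
      unfolding case_prod_unfold by (intro continuous_intros s)
  qed auto
  moreover have eq: "borel_transform F v = integral (cbox 0 1) (\<lambda>x. F (c x) * exp (v * c x) * d x) / (2 * pi * \<i>)" for v
  proof -
    have "contour_integral (circlepath 0 (1/2)) (\<lambda>w. F w * exp (v * w)) = 2 * pi * \<i> * borel_transform F v"
      by (rule contour_integral_unique[OF borel_transform_circle[OF F]]) auto
    then show ?thesis by (simp add: contour_integral_integral c_def d_def cbox_interval)
  qed
  ultimately show ?thesis unfolding eq[abs_def] by (intro holomorphic_on_divide) auto
qed

text \<open>The contour is the rectangle of half-width \<xi> and half-height 1/2. On its vertical
  sides |F| \<le> M \<xi>, on its horizontal sides Levinson's theorem gives an absolute bound, and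
  |exp (v w)| \<le> exp (|Re v| \<xi> + |Im v|). The infimum over \<xi>, taken at the end, produces
  phi(|Re v|) with a constant common to all F.\<close>

lemma borel_transform_strip:
  obtains C where "C > 0" "\<And>F v. F \<in> majorized M \<Longrightarrow> cmod (borel_transform F v) \<le> C * exp ((phi M \<bar>Re v\<bar> - phi M 0) + \<bar>Im v\<bar>)"
proof -
  obtain C0' where C0': "\<And>F z. F \<in> majorized M \<Longrightarrow> \<bar>Re z\<bar> < 1 \<Longrightarrow> 1/4 \<le> \<bar>Im z\<bar> \<Longrightarrow> \<bar>Im z\<bar> \<le> 1/2 \<Longrightarrow> cmod (F z) \<le> C0'"
    using levinson by blast
  define C0 where "C0 = max C0' 0"
  have C0: "C0 \<ge> 0" "\<And>F z. F \<in> majorized M \<Longrightarrow> \<bar>Re z\<bar> < 1 \<Longrightarrow> 1/4 \<le> \<bar>Im z\<bar> \<Longrightarrow> \<bar>Im z\<bar> \<le> 1/2 \<Longrightarrow> cmod (F z) \<le> C0"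
    using C0' by (force simp: C0_def intro: le_max_iff_disj[THEN iffD2])+
  \<comment> \<open>Converts the absolute bound C0 into a multiple of M \<xi>, as M \<xi> \<ge> M1 >
    0.\<close>
  define C1 where "C1 = 1 + C0 / M1"
  have C1: "C1 > 0" using C0 M1(1) by (simp add: C1_def add_pos_nonneg)
  have bound: "cmod (borel_transform F v) \<le> C1 * M \<xi> * exp (\<bar>Re v\<bar> * \<xi> + \<bar>Im v\<bar>)"
    if F: "F \<in> majorized M" and x: "0 < \<xi>" "\<xi> < 1" for F v \<xi>
  proof -
    define a1 a3 where "a1 = Complex (-\<xi>) (-(1/2))" and "a3 = Complex \<xi> (1/2)"
    define g where "g = (\<lambda>w. F w * exp (v * w))"
    define B where "B = C1 * M \<xi> * exp (\<bar>Re v\<bar> * \<xi> + \<bar>Im v\<bar>)"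
    have Mx: "M \<xi> > 0" using pos x by blast
    have B0: "B \<ge> 0" using C1 Mx by (simp add: B_def)
    have hg: "g holomorphic_on unit_square - {0}"
      unfolding g_def using majorized_holomorphic[OF F] by (intro holomorphic_intros) (simp add: punctured_square_def)
    have side: "u \<in> unit_square - {0} \<and> cmod (g u) \<le> B" if u: "u \<in> path_image (rectpath a1 a3)" for u
    proof -
      have "u \<in> cbox a1 a3 - box a1 a3" using u path_image_rectpath_cbox_minus_box[of a1 a3] x by (auto simp: a1_def a3_def)
      then have u1: "\<bar>Re u\<bar> \<le> \<xi>" "\<bar>Im u\<bar> \<le> 1/2" "\<bar>Re u\<bar> = \<xi> \<or> \<bar>Im u\<bar> = 1/2"
        by (auto simp: in_cbox_complex_iff in_box_complex_iff a1_def a3_def)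
      then have uS: "u \<in> unit_square - {0}" using x by (auto simp: unit_square_def)
      have "cmod (F u) \<le> C1 * M \<xi>"
      proof (cases "\<bar>Re u\<bar> = \<xi>")
        case True
        have "cmod (F u) \<le> M \<bar>Re u\<bar>" using uS True x by (intro majorized_le[OF F]) auto
        also have "\<dots> = M \<xi>" using True by simp
        also have "\<dots> \<le> C1 * M \<xi>" using Mx C0 M1(1) by (simp add: C1_def)
        finally show ?thesis .
      next
        case False
        then have "cmod (F u) \<le> C0" using u1 x by (intro C0(2)[OF F]) auto
        also have "\<dots> = C0 / M1 * M1" using M1(1) by simp
        also have "\<dots> \<le> C0 / M1 * M \<xi>" using M1 C0 x by (intro mult_left_mono) auto
        also have "\<dots> \<le> C1 * M \<xi>" using Mx by (simp add: C1_def algebra_simps)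
        finally show ?thesis .
      qed
      moreover have "Re (v * u) \<le> \<bar>Re v\<bar> * \<xi> + \<bar>Im v\<bar>"
      proof -
        have "Re v * Re u \<le> \<bar>Re v\<bar> * \<bar>Re u\<bar>" by (metis abs_ge_self abs_mult)
        also have "\<dots> \<le> \<bar>Re v\<bar> * \<xi>" using u1 by (intro mult_left_mono) auto
        finally have 1: "Re v * Re u \<le> \<bar>Re v\<bar> * \<xi>" .
        have "- (Im v * Im u) \<le> \<bar>Im v\<bar> * \<bar>Im u\<bar>" by (metis abs_ge_minus_self abs_mult)
        also have "\<dots> \<le> \<bar>Im v\<bar> * 1" using u1 by (intro mult_left_mono) auto
        finally show ?thesis using 1 by simp
      qed
      ultimately have "cmod (g u) \<le> B"
        unfolding g_def B_def norm_mult norm_exp_eq_Re using C1 Mx by (intro mult_mono) auto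
      then show ?thesis using uS by blast
    qed
    have "contour_integral (rectpath a1 a3) g = 2 * pi * \<i> * (\<Sum>p\<in>{0}. winding_number (rectpath a1 a3) p * residue g p)"
    proof (rule Residue_theorem[OF open_unit_square])
      show "connected unit_square" unfolding unit_square_box by (intro convex_connected convex_box)
      show "\<forall>z. z \<notin> unit_square \<longrightarrow> winding_number (rectpath a1 a3) z = 0"
        using side unfolding unit_square_box
        by (intro allI impI winding_number_zero_outside[of _ "box (Complex (-1) (-1)) (Complex 1 1)"] convex_box) (auto simp: unit_square_box)
    qed (use hg side in auto)
    also have "winding_number (rectpath a1 a3) 0 = 1"
      by (rule winding_number_rectpath) (use x in \<open>auto simp: in_box_complex_iff a1_def a3_def\<close>)
    then have "(\<Sum>p\<in>{0}. winding_number (rectpath a1 a3) p * residue g p) = borel_transform F v"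
      by (simp add: borel_transform_def g_def)
    finally have ci: "contour_integral (rectpath a1 a3) g = 2 * pi * \<i> * borel_transform F v" .
    define a2 a4 where "a2 = Complex \<xi> (-(1/2))" and "a4 = Complex (-\<xi>) (1/2)"
    have rp: "rectpath a1 a3 = linepath a1 a2 +++ linepath a2 a3 +++ linepath a3 a4 +++ linepath a4 a1"
      by (simp add: rectpath_def Let_def a1_def a2_def a3_def a4_def)
    have pi: "path_image (rectpath a1 a3) = closed_segment a1 a2 \<union> closed_segment a2 a3 \<union> closed_segment a3 a4 \<union> closed_segment a4 a1"
      unfolding rp by (simp add: path_image_join Un_assoc)
    have cont: "continuous_on (closed_segment a b) g" if "closed_segment a b \<subseteq> path_image (rectpath a1 a3)" for a b
      by (rule continuous_on_subset[OF holomorphic_on_imp_continuous_on[OF hg]]) (use that side in blast)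
    have seg: "g contour_integrable_on linepath a b \<and> cmod (contour_integral (linepath a b) g) \<le> B * cmod (b - a)"
      if s: "closed_segment a b \<subseteq> path_image (rectpath a1 a3)" for a b
    proof -
      have i: "g contour_integrable_on linepath a b" by (rule contour_integrable_continuous_linepath[OF cont[OF s]])
      have "cmod (contour_integral (linepath a b) g) \<le> B * cmod (b - a)"
        by (rule contour_integral_bound_linepath[OF i B0]) (use s side in blast)
      then show ?thesis using i by blast
    qed
    have s12: "closed_segment a1 a2 \<subseteq> path_image (rectpath a1 a3)" "closed_segment a2 a3 \<subseteq> path_image (rectpath a1 a3)"
      "closed_segment a3 a4 \<subseteq> path_image (rectpath a1 a3)" "closed_segment a4 a1 \<subseteq> path_image (rectpath a1 a3)"
      unfolding pi by auto
    have len: "cmod (a2 - a1) \<le> 2" "cmod (a3 - a2) \<le> 1" "cmod (a4 - a3) \<le> 2" "cmod (a1 - a4) \<le> 1"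
      using x by (auto simp: a1_def a2_def a3_def a4_def intro!: order_trans[OF cmod_le])
    have eq: "contour_integral (rectpath a1 a3) g = contour_integral (linepath a1 a2) g + (contour_integral (linepath a2 a3) g
        + (contour_integral (linepath a3 a4) g + contour_integral (linepath a4 a1) g))"
      unfolding rp using seg s12 by (simp add: contour_integrable_joinI)
    have tri: "cmod (p + (q + (r + s))) \<le> cmod p + (cmod q + (cmod r + cmod s))" for p q r s
      by (intro order_trans[OF norm_triangle_ineq] add_left_mono order_refl)
    have "cmod (2 * pi * \<i> * borel_transform F v) \<le> B * 2 + (B * 1 + (B * 2 + B * 1))"
      unfolding ci[symmetric] eq
      by (rule order_trans[OF tri]) (intro add_mono order_trans[OF seg[THEN conjunct2]] s12 mult_left_mono len B0)
    then have "2 * pi * cmod (borel_transform F v) \<le> 6 * B" by (simp add: norm_mult)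
    also have "\<dots> \<le> 2 * pi * B" using pi_gt3 B0 by (intro mult_right_mono) auto
    finally show ?thesis by (simp add: B_def)
  qed
  have "cmod (borel_transform F v) \<le> C1 * exp (phi M 0) * exp ((phi M \<bar>Re v\<bar> - phi M 0) + \<bar>Im v\<bar>)" if F: "F \<in> majorized M" for F v
  proof (cases "borel_transform F v = 0")
    case True then show ?thesis using C1 by simp
  next
    case False
    have "ln (cmod (borel_transform F v)) - ln C1 - \<bar>Im v\<bar> \<le> phi M \<bar>Re v\<bar>"
    proof (rule phi_ge)
      fix \<xi> :: real assume x: "0 < \<xi>" "\<xi> < 1"
      have "ln (cmod (borel_transform F v)) \<le> ln (C1 * M \<xi> * exp (\<bar>Re v\<bar> * \<xi> + \<bar>Im v\<bar>))"
        using bound[OF F x, of v] False C1 pos[OF x] by (subst ln_le_cancel_iff) auto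
      also have "\<dots> = ln C1 + ln (M \<xi>) + (\<bar>Re v\<bar> * \<xi> + \<bar>Im v\<bar>)" using C1 pos[OF x] by (simp add: ln_mult)
      finally show "ln (cmod (borel_transform F v)) - ln C1 - \<bar>Im v\<bar> \<le> ln (M \<xi>) + \<bar>Re v\<bar> * \<xi>" by simp
    qed simp
    then have "exp (ln (cmod (borel_transform F v))) \<le> exp (ln C1 + (phi M 0 + ((phi M \<bar>Re v\<bar> - phi M 0) + \<bar>Im v\<bar>)))"
      by (subst exp_le_cancel_iff) linarith
    also have "\<dots> = C1 * exp (phi M 0) * exp ((phi M \<bar>Re v\<bar> - phi M 0) + \<bar>Im v\<bar>)"
      unfolding exp_add[of "ln C1"] exp_add[of "phi M 0"] using C1 by simp
    finally show ?thesis using False by simp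
  qed
  then show ?thesis using that[of "C1 * exp (phi M 0)"] C1 by simp
qed

end

section \<open>The upper bound\<close>

lemma exp_segment_integral:
  fixes w u :: complex
  assumes "w \<noteq> 0"
  shows "contour_integral (linepath 0 u) (\<lambda>v. exp (v * w)) = (exp (u * w) - 1) / w"
proof -
  have "((\<lambda>v. exp (v * w)) has_contour_integral (exp (pathfinish (linepath 0 u) * w) / w - exp (pathstart (linepath 0 u) * w) / w)) (linepath 0 u)"
  proof (rule contour_integral_primitive[where S=UNIV])
    show "((\<lambda>v. exp (v * w) / w) has_field_derivative exp (v * w)) (at v within UNIV)" for v
      using assms by (auto intro!: derivative_eq_intros)
  qed (rule valid_path_linepath, rule subset_UNIV)
  then show ?thesis using assms by (simp add: contour_integral_unique diff_divide_distrib)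
qed

lemma integral_exp_le:
  fixes k T :: real
  assumes k: "k > 0" and T: "T > 0"
  shows "integral {0..1} (\<lambda>x. T * exp (- (k * (T * x)))) \<le> 1 / k"
proof -
  define P where "P = (\<lambda>x. - exp (- (k * (T * x))) / k)"
  have "((\<lambda>x. T * exp (- (k * (T * x)))) has_integral (P 1 - P 0)) {0..1}"
  proof (rule fundamental_theorem_of_calculus)
    fix x :: real
    have "(P has_real_derivative T * exp (- (k * (T * x)))) (at x within {0..1})"
      unfolding P_def using k by (auto intro!: derivative_eq_intros)
    then show "(P has_vector_derivative T * exp (- (k * (T * x)))) (at x within {0..1})"
      by (simp add: has_real_derivative_iff_has_vector_derivative)
  qed simp
  then have "integral {0..1} (\<lambda>x. T * exp (- (k * (T * x)))) = P 1 - P 0"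
    by (rule integral_unique)
  also have "P 1 - P 0 = (1 - exp (- (k * T))) / k" by (simp add: P_def diff_divide_distrib)
  also have "\<dots> \<le> 1 / k" using k by (intro divide_right_mono) auto
  finally show ?thesis .
qed

context majorant begin

text \<open>F(w) / (w - z) has singularities at 0 and z inside the larger circle. The residue at z
  is F z; the one at 0 is evaluated on the smaller circle, which leaves z outside.\<close>

lemma laurent_split:
  assumes F: "F \<in> majorized M" and z: "0 < r" "r < cmod z" "cmod z < 1/2"
  shows "2 * pi * \<i> * F z = contour_integral (circlepath 0 (1/2)) (\<lambda>w. F w / (w - z)) - contour_integral (circlepath 0 r) (\<lambda>w. F w / (w - z))"
proof -
  define g where "g = (\<lambda>w. F w / (w - z))"
  note hol = majorized_holomorphic[OF F]
  have z0: "z \<noteq> 0" using z by auto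
  have hg: "g holomorphic_on unit_square - {0, z}"
    unfolding g_def by (intro holomorphic_intros holomorphic_on_subset[OF hol]) (auto simp: punctured_square_def)
  have "contour_integral (circlepath 0 (1/2)) g = 2 * pi * \<i> * (\<Sum>p\<in>{0, z}. winding_number (circlepath 0 (1/2)) p * residue g p)"
  proof (rule Residue_theorem[OF open_unit_square _ _ hg])
    show "connected unit_square" unfolding unit_square_box by (intro convex_connected convex_box)
    show "path_image (circlepath 0 (1/2)) \<subseteq> unit_square - {0, z}"
      using cball_subset_unit_square[of "1/2"] z by auto
    show "\<forall>u. u \<notin> unit_square \<longrightarrow> winding_number (circlepath 0 (1/2)) u = 0"
      using cball_subset_unit_square[of "1/2"] unfolding unit_square_box
      by (intro allI impI winding_number_zero_outside[of _ "box (Complex (-1) (-1)) (Complex 1 1)"] convex_box) (auto simp: unit_square_box)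
  qed auto
  moreover have "winding_number (circlepath 0 (1/2)) p = 1" if "p \<in> {0, z}" for p
    by (rule winding_number_circlepath) (use that z in auto)
  ultimately have "contour_integral (circlepath 0 (1/2)) g = 2 * pi * \<i> * (residue g 0 + residue g z)"
    using z0 by simp
  moreover have "residue g z = F z"
    unfolding g_def by (rule residue_simple[OF open_punctured_square _ hol]) (use circle_in_punctured_square[of "cmod z" z] z z0 in simp)
  moreover have "(g has_contour_integral 2 * pi * \<i> * residue g 0) (circlepath 0 r)"
  proof (rule base_residue[of "ball 0 (cmod z)"])
    show "g holomorphic_on ball 0 (cmod z) - {0}"
    proof (rule holomorphic_on_subset[OF hg])
      have "ball 0 (cmod z) \<subseteq> unit_square" using cball_subset_unit_square[of "1/2"] z by force
      then show "ball 0 (cmod z) - {0} \<subseteq> unit_square - {0, z}" by auto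
    qed
  qed (use z in auto)
  then have "contour_integral (circlepath 0 r) g = 2 * pi * \<i> * residue g 0" by (rule contour_integral_unique)
  ultimately show ?thesis by (simp add: g_def algebra_simps)
qed

text \<open>The principal part of \<open>F\<close> at \<open>z\<close> is the Laplace transform of \<open>borel_transform F\<close> along the ray through \<open>cnj z\<close>.\<close>

lemma principal_part_limit:
  assumes F: "F \<in> majorized M" and z: "0 < r" "r < cmod z" "cmod z < 1/2"
  defines "u \<equiv> cnj z / of_real (cmod z)"
  shows "((\<lambda>T. 2 * pi * \<i> * contour_integral (linepath 0 (of_real T * u)) (\<lambda>v. exp (- (v * z)) * borel_transform F v))
    \<longlongrightarrow> - contour_integral (circlepath 0 r) (\<lambda>w. F w / (w - z))) at_top"
proof -
  have z0: "cmod z > 0" using z by linarith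
  have r1: "r < 1" using z by linarith
  have u: "cmod u = 1" using z0 by (simp add: u_def norm_divide)
  have uz: "u * z = of_real (cmod z)" using z0 by (simp add: u_def mult.commute[of "cnj z"] complex_norm_square[symmetric] power2_eq_square)
  note hol = majorized_holomorphic[OF F]
  have circ: "w \<in> punctured_square" "w \<noteq> z" if "cmod w = r" for w
    using circle_in_punctured_square[of r w] that z r1 by auto
  have contF: "continuous_on (sphere 0 r) F"
    by (rule continuous_on_subset[OF holomorphic_on_imp_continuous_on[OF hol]]) (use circ in auto)
  obtain B where B: "B > 0" "\<And>w. cmod w = r \<Longrightarrow> cmod (F w) \<le> B" using circle_bound[OF F z(1) r1] by blast
  define I where "I = contour_integral (circlepath 0 r) (\<lambda>w. F w / (w - z))"
  \<comment> \<open>Interchanging the integrals over circle and segment and integrating exp (v (w -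
    z)) leaves (exp (T u (w - z)) - 1) / (w - z). \<open>E\<close> collects the exponential part,
    which vanishes as T grows since Re (u (w - z)) \<le> r - |z| < 0.\<close>
  define E where "E = (\<lambda>T. contour_integral (circlepath 0 r) (\<lambda>w. F w * exp (of_real T * u * (w - z)) / (w - z)))"
  have split: "2 * pi * \<i> * contour_integral (linepath 0 (of_real T * u)) (\<lambda>v. exp (- (v * z)) * borel_transform F v) = E T - I" for T
  proof -
    have "2 * pi * \<i> * contour_integral (linepath 0 (of_real T * u)) (\<lambda>v. exp (- (v * z)) * borel_transform F v) =
      contour_integral (linepath 0 (of_real T * u)) (\<lambda>v. 2 * pi * \<i> * (exp (- (v * z)) * borel_transform F v))"
    proof (rule contour_integral_lmul[symmetric])
      have "continuous_on UNIV (borel_transform F)" using borel_transform_entire[OF F] holomorphic_on_imp_continuous_on by blast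
      then show "(\<lambda>v. exp (- (v * z)) * borel_transform F v) contour_integrable_on linepath 0 (of_real T * u)"
        by (intro contour_integrable_continuous_linepath continuous_intros) (auto intro: continuous_on_subset)
    qed
    also have "\<dots> = contour_integral (linepath 0 (of_real T * u)) (\<lambda>v. contour_integral (circlepath 0 r) (\<lambda>w. F w * exp (v * (w - z))))"
    proof (rule contour_integral_cong[OF refl])
      fix v
      have "((\<lambda>w. exp (- (v * z)) * (F w * exp (v * w))) has_contour_integral exp (- (v * z)) * (2 * pi * \<i> * borel_transform F v)) (circlepath 0 r)"
        by (intro has_contour_integral_lmul borel_transform_circle F z r1)
      moreover have "(\<lambda>w. exp (- (v * z)) * (F w * exp (v * w))) = (\<lambda>w. F w * exp (v * (w - z)))"
        by (simp add: fun_eq_iff right_diff_distrib exp_diff exp_minus field_simps)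
      ultimately show "2 * pi * \<i> * (exp (- (v * z)) * borel_transform F v) = contour_integral (circlepath 0 r) (\<lambda>w. F w * exp (v * (w - z)))"
        by (metis (no_types, lifting) contour_integral_unique mult.left_commute)
    qed
    also have "\<dots> = contour_integral (circlepath 0 r) (\<lambda>w. contour_integral (linepath 0 (of_real T * u)) (\<lambda>v. F w * exp (v * (w - z))))"
    proof (rule contour_integral_swap)
      have "continuous_on (path_image (linepath 0 (of_real T * u)) \<times> path_image (circlepath 0 r)) (\<lambda>x. F (snd x))"
        by (rule continuous_on_compose2[OF contF]) (use z in \<open>auto intro: continuous_intros\<close>)
      then show "continuous_on (path_image (linepath 0 (of_real T * u)) \<times> path_image (circlepath 0 r)) (\<lambda>(v, w). F w * exp (v * (w - z)))"
        unfolding case_prod_unfold by (intro continuous_intros)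
    qed (auto simp: vector_derivative_circlepath intro!: continuous_intros)
    also have "\<dots> = contour_integral (circlepath 0 r) (\<lambda>w. F w * exp (of_real T * u * (w - z)) / (w - z) - F w / (w - z))"
    proof (rule contour_integral_cong[OF refl])
      fix w assume "w \<in> path_image (circlepath 0 r)"
      then have "w - z \<noteq> 0" using circ z by auto
      have "contour_integral (linepath 0 (of_real T * u)) (\<lambda>v. F w * exp (v * (w - z))) = F w * contour_integral (linepath 0 (of_real T * u)) (\<lambda>v. exp (v * (w - z)))"
        by (rule contour_integral_lmul) (intro contour_integrable_continuous_linepath continuous_intros)
      also have "\<dots> = F w * ((exp (of_real T * u * (w - z)) - 1) / (w - z))"
        unfolding exp_segment_integral[OF \<open>w - z \<noteq> 0\<close>] ..
      finally show "contour_integral (linepath 0 (of_real T * u)) (\<lambda>v. F w * exp (v * (w - z))) = F w * exp (of_real T * u * (w - z)) / (w - z) - F w / (w - z)"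
        by (simp add: field_simps diff_divide_distrib)
    qed
    also have "\<dots> = E T - I"
      unfolding E_def I_def
      by (rule contour_integral_diff) (use circ z in \<open>auto intro!: contour_integrable_continuous_circlepath continuous_intros contF\<close>)
    finally show ?thesis .
  qed
  have E: "(E \<longlongrightarrow> 0) at_top"
  proof (rule Lim_null_comparison)
    have "cmod (E T) \<le> B * exp (- (cmod z - r) * T) / (cmod z - r) * (2 * pi * r)" if T: "T \<ge> 0" for T
    proof -
      have "(\<lambda>w. F w * exp (of_real T * u * (w - z)) / (w - z)) contour_integrable_on circlepath 0 r"
        by (rule contour_integrable_continuous_circlepath) (use circ z in \<open>auto intro!: continuous_intros contF\<close>)
      then have "((\<lambda>w. F w * exp (of_real T * u * (w - z)) / (w - z)) has_contour_integral E T) (circlepath 0 r)"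
        unfolding E_def by (rule has_contour_integral_integral)
      then show ?thesis
      proof (rule has_contour_integral_bound_circlepath)
        show "0 \<le> B * exp (- (cmod z - r) * T) / (cmod z - r)" using B z by simp
        fix w :: complex assume "cmod (w - 0) = r"
        then have w: "cmod w = r" by simp
        have "Re (u * w) \<le> r" using complex_Re_le_cmod[of "u * w"] w u by (simp add: norm_mult)
        then have "T * (Re (u * w) - cmod z) \<le> T * (r - cmod z)" using T by (intro mult_left_mono) auto
        moreover have "Re (of_real T * u * (w - z)) = T * (Re (u * w) - cmod z)"
        proof -
          have e: "of_real T * u * (w - z) = of_real T * (u * w - of_real (cmod z))"
            unfolding uz[symmetric] by (simp add: algebra_simps)
          show ?thesis unfolding e by simp
        qed
        ultimately have ex: "Re (of_real T * u * (w - z)) \<le> - (cmod z - r) * T" by (simp add: algebra_simps)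
        have "cmod z - r \<le> cmod (w - z)" using norm_triangle_ineq2[of z w] w by (simp add: norm_minus_commute)
        then show "cmod (F w * exp (of_real T * u * (w - z)) / (w - z)) \<le> B * exp (- (cmod z - r) * T) / (cmod z - r)"
          unfolding norm_divide norm_mult norm_exp_eq_Re using B(2)[OF w] B(1) z ex
          by (intro frac_le mult_mono) auto
      qed (use z in auto)
    qed
    then show "\<forall>\<^sub>F T in at_top. norm (E T) \<le> B * exp (- (cmod z - r) * T) / (cmod z - r) * (2 * pi * r)"
      using eventually_ge_at_top[of 0] by (rule eventually_mono[rotated])
    have "cmod z - r > 0" using z by simp
    then show "((\<lambda>T. B * exp (- (cmod z - r) * T) / (cmod z - r) * (2 * pi * r)) \<longlongrightarrow> 0) at_top"
      by real_asymp
  qed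
  have "((\<lambda>T. E T - I) \<longlongrightarrow> 0 - I) at_top" by (intro tendsto_intros E)
  then show ?thesis unfolding split by (simp add: I_def)
qed

text \<open>The integral over |w| = 1/2 is bounded by Levinson's theorem near the imaginary axis and
  by M(1/4) elsewhere; the one over the small circle is a Laplace integral. The crossing point Y,
  which measures the effective length of integration, stays in the statement so that ln Y can later
  be compared with \<open>legendre s\<close>. The bound 1/4 on s0 keeps z away from the circle of
  radius 1/2.\<close>

lemma exact_majorant_upper:
  obtains C s0 where "s0 > 0" "s0 \<le> 1/4"
    "\<And>s. 0 < s \<Longrightarrow> s < s0 \<Longrightarrow> \<exists>Y\<ge>1. poisson Y = s * Y \<and> exact_majorant M s \<le> ereal (exp (legendre s + ln Y + C))"
proof -
  obtain Cb where Cb: "Cb > 0" "\<And>F v. F \<in> majorized M \<Longrightarrow> cmod (borel_transform F v) \<le> Cb * exp ((phi M \<bar>Re v\<bar> - phi M 0) + \<bar>Im v\<bar>)"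
    using borel_transform_strip by blast
  have bt: "cmod (borel_transform F v) \<le> Cb * exp 1 * exp (poisson (cmod v))" if "F \<in> majorized M" for F v
    by (rule entire_bound[OF borel_transform_entire borel_transform_type_zero Cb(2)]) (use that in auto)
  obtain C0' where C0': "\<And>F z. F \<in> majorized M \<Longrightarrow> \<bar>Re z\<bar> < 1 \<Longrightarrow> 1/4 \<le> \<bar>Im z\<bar> \<Longrightarrow> \<bar>Im z\<bar> \<le> 1/2 \<Longrightarrow> cmod (F z) \<le> C0'"
    using levinson by blast
  define C0 where "C0 = max (max C0' 0) (M (1/4))"
  have C00: "C0 \<ge> 0" by (simp add: C0_def)
  have C0: "cmod (F w) \<le> C0" if F: "F \<in> majorized M" and w: "cmod w = 1/2" for F w
  proof (cases "1/4 \<le> \<bar>Re w\<bar>")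
    case True
    have wS: "w \<in> unit_square" using circle_in_punctured_square[of "1/2" w] w by (auto simp: punctured_square_def)
    have "cmod (F w) \<le> M \<bar>Re w\<bar>" using True by (intro majorized_le[OF F wS]) auto
    also have "\<dots> \<le> M (1/4)" using True abs_Re_le_cmod[of w] w by (intro antimono) auto
    finally show ?thesis by (simp add: C0_def)
  next
    case False
    have "cmod w \<le> \<bar>Re w\<bar> + \<bar>Im w\<bar>" by (rule cmod_le)
    then have "1/4 \<le> \<bar>Im w\<bar>" using False w by linarith
    then have "cmod (F w) \<le> C0'" using abs_Im_le_cmod[of w] w False by (intro C0'[OF F]) auto
    then show ?thesis by (simp add: C0_def)
  qed
  obtain c s1 where c: "c > 0" "s1 > 0"
    "\<And>s. 0 < s \<Longrightarrow> s < s1 \<Longrightarrow> \<exists>Y\<ge>1. poisson Y = s * Y \<and> (\<forall>t>0. poisson t - s * t \<le> legendre s + 4 * c - c * t / Y)"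
    using legendre_tail by blast
  define C2 where "C2 = Cb * exp 1"
  have C2: "C2 > 0" using Cb by (simp add: C2_def)
  define C3 where "C3 = 2 * C0 + C2 * exp (4 * c) / c"
  have C3: "C3 > 0" unfolding C3_def using C00 C2 c by (intro add_nonneg_pos) auto
  show ?thesis
  proof
    show "min s1 (1/4) > 0" "min s1 (1/4) \<le> 1/4" using c by auto
    fix s assume s: "0 < s" "s < min s1 (1/4)"
    then obtain Y where Y: "Y \<ge> 1" "poisson Y = s * Y" "\<And>t. t > 0 \<Longrightarrow> poisson t - s * t \<le> legendre s + 4 * c - c * t / Y"
      using c(3)[of s] by auto
    have tail: "poisson t - s * t \<le> legendre s + 4 * c - c * t / Y" if "t \<ge> 0" for t
    proof (cases "t = 0")
      case True then show ?thesis using legendre_nonneg[OF s(1)] c by (simp add: poisson_def)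
    qed (use Y(3) that in auto)
    define L where "L = exp (legendre s + 4 * c)"
    have main: "cmod (F z) \<le> exp (legendre s + ln Y + ln C3)" if F: "F \<in> majorized M" and z: "cmod z = s" for F z
    proof -
      define r where "r = s / 2"
      have r: "0 < r" "r < cmod z" "cmod z < 1/2" using s z by (auto simp: r_def)
      \<comment> \<open>In this direction v z is positive, so |exp (- v z)| = exp (- s t) with t =
        |v|.\<close>
      define u where "u = cnj z / of_real (cmod z)"
      have u: "cmod u = 1" using s z by (simp add: u_def norm_divide)
      have uz: "u * z = of_real s" using s z by (simp add: u_def mult.commute[of "cnj z"] complex_norm_square[symmetric] power2_eq_square)
      define K where "K = (\<lambda>T. contour_integral (linepath 0 (of_real T * u)) (\<lambda>v. exp (- (v * z)) * borel_transform F v))"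
      have K: "cmod (K T) \<le> C2 * L * Y / c" if T: "T > 0" for T
      proof -
        have cont: "continuous_on A (borel_transform F)" for A
          using borel_transform_entire[OF F] holomorphic_on_imp_continuous_on holomorphic_on_subset by blast
        define G where "G = (\<lambda>x::real. exp (- (linepath 0 (of_real T * u) x * z)) * borel_transform F (linepath 0 (of_real T * u) x) * (of_real T * u))"
        have lp: "linepath 0 (of_real T * u) x = of_real (x * T) * u" for x by (simp add: linepath_def scaleR_conv_of_real)
        have "K T = integral {0..1} G" by (simp add: K_def contour_integral_integral G_def)
        also have "cmod \<dots> \<le> integral {0..1} (\<lambda>x. C2 * L * (T * exp (- (c / Y * (T * x)))))"
        proof (rule integral_norm_bound_integral)
          have "continuous_on {0..1} (\<lambda>x. borel_transform F (linepath 0 (of_real T * u) x))"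
            by (rule continuous_on_compose2[OF cont[of UNIV]]) (auto intro: continuous_intros)
          then show "G integrable_on {0..1}" unfolding G_def
            by (intro integrable_continuous_real continuous_intros)
          show "(\<lambda>x. C2 * L * (T * exp (- (c / Y * (T * x))))) integrable_on {0..1}"
            by (intro integrable_continuous_real continuous_intros)
          fix x :: real assume x: "x \<in> {0..1}"
          define t where "t = x * T"
          have t: "t \<ge> 0" using x T by (simp add: t_def)
          have "Re (- (of_real t * u * z)) = - (s * t)" using uz by (simp add: mult.assoc)
          then have "cmod (G x) = exp (- (s * t)) * cmod (borel_transform F (of_real t * u)) * T"
            unfolding G_def lp norm_mult norm_exp_eq_Re t_def[symmetric] using T u by simp
          also have "\<dots> \<le> exp (- (s * t)) * (C2 * exp (poisson t)) * T"
            using bt[OF F, of "of_real t * u"] t T u unfolding C2_def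
            by (intro mult_right_mono mult_left_mono) (auto simp: norm_mult)
          also have "\<dots> = C2 * T * exp (poisson t - s * t)" by (simp add: exp_diff exp_minus field_simps)
          also have "\<dots> \<le> C2 * T * exp (legendre s + 4 * c - c * t / Y)"
            using tail[OF t] C2 T by (intro mult_left_mono) auto
          also have "\<dots> = C2 * L * (T * exp (- (c / Y * (T * x))))"
            unfolding L_def t_def by (simp add: exp_diff exp_minus field_simps)
          finally show "cmod (G x) \<le> C2 * L * (T * exp (- (c / Y * (T * x))))" .
        qed
        also have "\<dots> = C2 * L * integral {0..1} (\<lambda>x. T * exp (- (c / Y * (T * x))))" by (rule integral_mult_right)
        also have "\<dots> \<le> C2 * L * (1 / (c / Y))"
          using C2 c Y T by (intro mult_left_mono integral_exp_le) (auto simp: L_def)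
        finally show ?thesis by simp
      qed
      define I1 I2 where "I1 = contour_integral (circlepath 0 (1/2)) (\<lambda>w. F w / (w - z))"
        and "I2 = contour_integral (circlepath 0 r) (\<lambda>w. F w / (w - z))"
      have I1: "cmod I1 \<le> 4 * C0 * (2 * pi * (1/2))"
      proof (rule has_contour_integral_bound_circlepath)
        have wz: "w \<noteq> z" if "cmod w = 1/2" for w using that z s by auto
        have "continuous_on (sphere 0 (1/2)) F"
          by (rule continuous_on_subset[OF holomorphic_on_imp_continuous_on[OF majorized_holomorphic[OF F]]])
             (use circle_in_punctured_square[of "1/2"] in auto)
        then have "(\<lambda>w. F w / (w - z)) contour_integrable_on circlepath 0 (1/2)"
          by (intro contour_integrable_continuous_circlepath continuous_intros) (use wz in auto)
        then show "((\<lambda>w. F w / (w - z)) has_contour_integral I1) (circlepath 0 (1/2))"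
          unfolding I1_def by (rule has_contour_integral_integral)
        fix w :: complex assume "cmod (w - 0) = 1/2"
        then have w: "cmod w = 1/2" by simp
        have "1/4 \<le> cmod (w - z)" using norm_triangle_ineq2[of w z] w z s by simp
        then have "cmod (F w) / cmod (w - z) \<le> C0 / (1/4)" using C0[OF F w] C00 by (intro frac_le) auto
        then show "cmod (F w / (w - z)) \<le> 4 * C0" by (simp add: norm_divide)
      qed (use C00 in auto)
      have I2: "cmod (- I2) \<le> 2 * pi * (C2 * L * Y / c)"
      proof (rule tendsto_upperbound)
        show "((\<lambda>T. cmod (2 * pi * \<i> * K T)) \<longlongrightarrow> cmod (- I2)) at_top"
          unfolding K_def I2_def u_def by (intro tendsto_norm principal_part_limit F r)
        show "\<forall>\<^sub>F T in at_top. cmod (2 * pi * \<i> * K T) \<le> 2 * pi * (C2 * L * Y / c)"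
          using eventually_gt_at_top[of 0]
        proof eventually_elim
          case (elim T)
          have "2 * pi * cmod (K T) \<le> 2 * pi * (C2 * L * Y / c)" using K[OF elim] by (intro mult_left_mono) auto
          then show ?case by (simp add: norm_mult)
        qed
      qed auto
      have "2 * pi * cmod (F z) = cmod (2 * pi * \<i> * F z)" by (simp add: norm_mult)
      also have "\<dots> = cmod (I1 + - I2)" unfolding laurent_split[OF F r] I1_def I2_def by simp
      also have "\<dots> \<le> 4 * C0 * (2 * pi * (1/2)) + 2 * pi * (C2 * L * Y / c)"
        using norm_triangle_ineq[of I1 "- I2"] I1 I2 by linarith
      also have "\<dots> = 2 * pi * (2 * C0 + C2 * L * Y / c)" by (simp add: algebra_simps)
      finally have "cmod (F z) \<le> 2 * C0 + C2 * L * Y / c" by simp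
      \<comment> \<open>The bounded term is absorbed because exp (legendre s) Y \<ge> 1.\<close>
      also have "\<dots> \<le> 2 * C0 * (exp (legendre s) * Y) + C2 * L * Y / c"
      proof -
        have "1 * 1 \<le> exp (legendre s) * Y" using legendre_nonneg[OF s(1)] Y by (intro mult_mono) auto
        then have "2 * C0 * 1 \<le> 2 * C0 * (exp (legendre s) * Y)" using C00 by (intro mult_left_mono) auto
        then show ?thesis by simp
      qed
      also have "\<dots> = C3 * (exp (legendre s) * Y)" unfolding C3_def L_def exp_add by (simp add: algebra_simps add_divide_distrib)
      also have "\<dots> = exp (legendre s + ln Y + ln C3)" using C3 Y by (simp add: exp_add)
      finally show ?thesis .
    qed
    have "exact_majorant M s \<le> ereal (exp (legendre s + ln Y + ln C3))"
      unfolding exact_majorant_def by (intro SUP_least) (use main in auto)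
    then show "\<exists>Y\<ge>1. poisson Y = s * Y \<and> exact_majorant M s \<le> ereal (exp (legendre s + ln Y + ln C3))"
      using Y by blast
  qed
qed

end

section \<open>The lower bound\<close>

text \<open>The Laplace transform of q along the positive ray, written termwise with k! / z^(k+1),
  so that it makes sense for all z \<noteq> 0 and not only for Re z > 0.\<close>

definition laplace_poly :: "complex poly \<Rightarrow> complex \<Rightarrow> complex" where
  "laplace_poly q z = (\<Sum>k\<le>degree q. coeff q k * fact k / z ^ Suc k)"

lemma laplace_poly_holomorphic: "laplace_poly q holomorphic_on - {0}"
  unfolding laplace_poly_def[abs_def] by (intro holomorphic_intros) auto

text \<open>Cauchy's formula for the k-th derivative of exp (v z) at 0 sends k! / z^(k+1) to v^k, so
  a contour integral over any circle around 0 undoes the Laplace transform.\<close>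

lemma laplace_poly_inverse:
  assumes s: "s > 0"
  shows "((\<lambda>z. laplace_poly q z * exp (v * z)) has_contour_integral 2 * pi * \<i> * poly q v) (circlepath 0 s)"
proof -
  have d: "(deriv ^^ k) (\<lambda>z. exp (v * z)) 0 = v ^ k" for k
  proof -
    have "(deriv ^^ k) (\<lambda>z. exp (v * z)) = (\<lambda>z. v ^ k * exp (v * z))"
    proof (induction k)
      case (Suc k)
      have "deriv (\<lambda>z. v ^ k * exp (v * z)) z = v ^ Suc k * exp (v * z)" for z
        by (rule DERIV_imp_deriv) (auto intro!: derivative_eq_intros)
      moreover have "(deriv ^^ Suc k) (\<lambda>z. exp (v * z)) = deriv (\<lambda>z. v ^ k * exp (v * z))" using Suc by simp
      ultimately show ?case by (simp only: fun_eq_iff simp_thms)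
    qed simp
    then show ?thesis by simp
  qed
  have "((\<lambda>z. coeff q k * fact k * (exp (v * z) / (z - 0) ^ Suc k)) has_contour_integral
      coeff q k * fact k * ((2 * pi * \<i>) / fact k * (deriv ^^ k) (\<lambda>z. exp (v * z)) 0)) (circlepath 0 s)" for k
    by (intro has_contour_integral_lmul Cauchy_has_contour_integral_higher_derivative_circlepath continuous_intros holomorphic_intros)
       (use s in auto)
  then have "((\<lambda>z. \<Sum>k\<le>degree q. coeff q k * fact k * (exp (v * z) / (z - 0) ^ Suc k)) has_contour_integral
      (\<Sum>k\<le>degree q. coeff q k * fact k * ((2 * pi * \<i>) / fact k * (deriv ^^ k) (\<lambda>z. exp (v * z)) 0))) (circlepath 0 s)"
    by (intro has_contour_integral_sum) auto
  moreover have "(\<Sum>k\<le>degree q. coeff q k * fact k * ((2 * pi * \<i>) / fact k * (deriv ^^ k) (\<lambda>z. exp (v * z)) 0)) = 2 * pi * \<i> * poly q v"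
    unfolding d poly_altdef by (simp add: sum_distrib_left mult_ac)
  moreover have "(\<lambda>z. \<Sum>k\<le>degree q. coeff q k * fact k * (exp (v * z) / (z - 0) ^ Suc k)) = (\<lambda>z. laplace_poly q z * exp (v * z))"
    by (simp add: laplace_poly_def sum_distrib_right fun_eq_iff)
  ultimately show ?thesis by simp
qed

lemma monomial_exp_tendsto:
  fixes x :: real
  assumes x: "x > 0" shows "((\<lambda>t. t ^ k * exp (- (t * x))) \<longlongrightarrow> 0) at_top"
proof -
  have "filterlim (\<lambda>t. t * x) at_top at_top"
    by (rule filterlim_at_top_mult_tendsto_pos[OF tendsto_const x filterlim_ident])
  from filterlim_compose[OF tendsto_power_div_exp_0[of k] this]
  have "((\<lambda>t. (t * x) ^ k / exp (t * x) / x ^ k) \<longlongrightarrow> 0 / x ^ k) at_top" using x by (intro tendsto_intros) auto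
  moreover have "(t * x) ^ k / exp (t * x) / x ^ k = t ^ k * exp (- (t * x))" for t
    using x by (simp add: power_mult_distrib exp_minus field_simps)
  ultimately show ?thesis by simp
qed

lemma monomial_laplace_tendsto:
  fixes z :: complex
  assumes z: "Re z > 0"
  shows "((\<lambda>T. integral {0..T} (\<lambda>t. of_real t ^ k * exp (- (of_real t * z)))) \<longlongrightarrow> fact k / z ^ Suc k) at_top"
proof (induction k)
  case 0
  have z0: "z \<noteq> 0" using z by auto
  have eq: "integral {0..T} (\<lambda>t. of_real t ^ 0 * exp (- (of_real t * z))) = (1 - exp (- (of_real T * z))) / z" if T: "T \<ge> 0" for T
  proof -
    define P where "P = (\<lambda>t::real. - exp (- (of_real t * z)) / z)"
    have "((\<lambda>t. of_real t ^ 0 * exp (- (of_real t * z))) has_integral (P T - P 0)) {0..T}"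
    proof (rule fundamental_theorem_of_calculus[OF T])
      fix t assume "t \<in> {0..T}"
      have "((\<lambda>w. - exp (- (w * z)) / z) has_field_derivative (of_real t ^ 0 * exp (- (of_real t * z)))) (at (of_real t))"
        using z0 by (auto intro!: derivative_eq_intros)
      then show "(P has_vector_derivative of_real t ^ 0 * exp (- (of_real t * z))) (at t within {0..T})"
        unfolding P_def by (rule has_vector_derivative_real_field)
    qed
    then have "integral {0..T} (\<lambda>t. of_real t ^ 0 * exp (- (of_real t * z))) = P T - P 0" by (rule integral_unique)
    then show ?thesis by (simp add: P_def diff_divide_distrib)
  qed
  have "((\<lambda>T. exp (- (of_real T * z))) \<longlongrightarrow> 0) at_top"
    by (rule tendsto_norm_zero_cancel) (use monomial_exp_tendsto[OF z, of 0] in simp)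
  then have "((\<lambda>T. (1 - exp (- (of_real T * z))) / z) \<longlongrightarrow> (1 - 0) / z) at_top" using z0 by (intro tendsto_intros)
  then have "((\<lambda>T. (1 - exp (- (of_real T * z))) / z) \<longlongrightarrow> fact 0 / z ^ Suc 0) at_top" by simp
  then show ?case
    by (rule Lim_transform_eventually) (use eventually_ge_at_top[of 0] in \<open>eventually_elim, simp add: eq[simplified]\<close>)
next
  case (Suc k)
  have z0: "z \<noteq> 0" using z by auto
  define I where "I = (\<lambda>k T. integral {0..T} (\<lambda>t. of_real t ^ k * exp (- (of_real t * z))))"
  have eq: "I (Suc k) T = of_nat (Suc k) / z * I k T - of_real T ^ Suc k * exp (- (of_real T * z)) / z" if T: "T \<ge> 0" for T
  proof -
    define P where "P = (\<lambda>t::real. of_real t ^ Suc k * (- exp (- (of_real t * z)) / z))"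
    define a b where "a = (\<lambda>t::real. of_nat (Suc k) * of_real t ^ k * (- exp (- (of_real t * z)) / z))"
      and "b = (\<lambda>t::real. of_real t ^ Suc k * exp (- (of_real t * z)))"
    have ib: "b integrable_on {0..T}" "a integrable_on {0..T}"
      unfolding a_def b_def by (intro integrable_continuous_real continuous_intros; use z0 in simp)+
    have "((\<lambda>t. a t + b t) has_integral (P T - P 0)) {0..T}"
    proof (rule fundamental_theorem_of_calculus[OF T])
      fix t assume "t \<in> {0..T}"
      have "((\<lambda>w. w ^ Suc k * (- exp (- (w * z)) / z)) has_field_derivative (a t + b t)) (at (of_real t))"
      proof -
        have d1: "((\<lambda>w. w ^ Suc k) has_field_derivative of_nat (Suc k) * of_real t ^ k) (at (of_real t))"
          by (rule derivative_eq_intros refl | simp)+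
        have d2: "((\<lambda>w. - exp (- (w * z)) / z) has_field_derivative exp (- (of_real t * z))) (at (of_real t))"
          using z0 by (auto intro!: derivative_eq_intros)
        show ?thesis by (rule DERIV_cong[OF DERIV_mult[OF d1 d2]]) (simp add: a_def b_def mult_ac)
      qed
      then show "(P has_vector_derivative a t + b t) (at t within {0..T})"
        unfolding P_def by (rule has_vector_derivative_real_field)
    qed
    then have "integral {0..T} (\<lambda>t. a t + b t) = P T - P 0" by (rule integral_unique)
    then have "integral {0..T} a + integral {0..T} b = P T" using ib by (simp add: integral_add P_def)
    moreover have "integral {0..T} a = - (of_nat (Suc k) / z) * I k T"
    proof -
      have "a = (\<lambda>t. - (of_nat (Suc k) / z) * (of_real t ^ k * exp (- (of_real t * z))))" by (simp add: a_def fun_eq_iff)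
      then show ?thesis unfolding I_def by (simp only: integral_mult_right)
    qed
    moreover have "integral {0..T} b = I (Suc k) T" by (simp add: b_def I_def)
    ultimately show ?thesis by (simp add: P_def algebra_simps)
  qed
  have "((\<lambda>T. of_real T ^ Suc k * exp (- (of_real T * z))) \<longlongrightarrow> 0) at_top"
  proof (rule Lim_null_comparison)
    show "\<forall>\<^sub>F T in at_top. norm (of_real T ^ Suc k * exp (- (of_real T * z))) \<le> T ^ Suc k * exp (- (T * Re z))"
      using eventually_ge_at_top[of 0] by eventually_elim (simp add: norm_mult norm_power)
  qed (rule monomial_exp_tendsto[OF z])
  then have "((\<lambda>T. of_nat (Suc k) / z * I k T - of_real T ^ Suc k * exp (- (of_real T * z)) / z) \<longlongrightarrow> of_nat (Suc k) / z * (fact k / z ^ Suc k) - 0 / z) at_top"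
    using z0 Suc.IH by (intro tendsto_intros) (auto simp: I_def)
  moreover have "of_nat (Suc k) / z * (fact k / z ^ Suc k) - 0 / z = fact (Suc k) / z ^ Suc (Suc k)"
    using z0 by (simp add: field_simps)
  ultimately have "((\<lambda>T. of_nat (Suc k) / z * I k T - of_real T ^ Suc k * exp (- (of_real T * z)) / z) \<longlongrightarrow> fact (Suc k) / z ^ Suc (Suc k)) at_top"
    by simp
  then have "(I (Suc k) \<longlongrightarrow> fact (Suc k) / z ^ Suc (Suc k)) at_top"
    by (rule Lim_transform_eventually) (use eventually_ge_at_top[of 0] in \<open>eventually_elim, simp only: eq\<close>)
  then show ?case by (simp add: I_def)
qed

text \<open>The density B / (1 + t^2) has integral B pi / 2 over the half-line. The estimate is made
  for integrals over [0, T], whose limit is \<open>laplace_poly q z\<close>.\<close>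

lemma laplace_poly_le:
  fixes z :: complex
  assumes z: "Re z > 0" and B: "\<And>t. t \<ge> 0 \<Longrightarrow> cmod (poly q (of_real t)) * exp (- (t * Re z)) \<le> B / (1 + t\<^sup>2)"
  shows "cmod (laplace_poly q z) \<le> B * (pi / 2)"
proof -
  have lim: "((\<lambda>T. integral {0..T} (\<lambda>t. poly q (of_real t) * exp (- (of_real t * z)))) \<longlongrightarrow> laplace_poly q z) at_top"
  proof -
    have eq: "integral {0..T} (\<lambda>t. poly q (of_real t) * exp (- (of_real t * z))) =
        (\<Sum>k\<le>degree q. coeff q k * integral {0..T} (\<lambda>t. of_real t ^ k * exp (- (of_real t * z))))" for T
    proof -
      have "integral {0..T} (\<lambda>t. poly q (of_real t) * exp (- (of_real t * z))) =
        integral {0..T} (\<lambda>t. \<Sum>k\<le>degree q. coeff q k * (of_real t ^ k * exp (- (of_real t * z))))"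
        unfolding poly_altdef by (simp add: sum_distrib_right mult.assoc)
      also have "\<dots> = (\<Sum>k\<le>degree q. integral {0..T} (\<lambda>t. coeff q k * (of_real t ^ k * exp (- (of_real t * z)))))"
        by (rule integral_sum) (auto intro!: integrable_continuous_real continuous_intros)
      finally show ?thesis by (simp only: integral_mult_right)
    qed
    have "((\<lambda>T. \<Sum>k\<le>degree q. coeff q k * integral {0..T} (\<lambda>t. of_real t ^ k * exp (- (of_real t * z)))) \<longlongrightarrow>
       (\<Sum>k\<le>degree q. coeff q k * (fact k / z ^ Suc k))) at_top"
      by (intro tendsto_intros monomial_laplace_tendsto z)
    then show ?thesis unfolding eq by (simp add: laplace_poly_def)
  qed
  have B0: "B \<ge> 0" using B[of 0] by (simp add: order_trans[OF norm_ge_zero])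
  have bd: "cmod (integral {0..T} (\<lambda>t. poly q (of_real t) * exp (- (of_real t * z)))) \<le> B * (pi / 2)" if T: "T \<ge> 0" for T
  proof -
    have i: "((\<lambda>t. B * (1 / (1 + t\<^sup>2))) has_integral B * (arctan T - arctan 0)) {0..T}"
    proof (intro has_integral_mult_right fundamental_theorem_of_calculus[OF T])
      fix x :: real
      have "(arctan has_real_derivative 1 / (1 + x\<^sup>2)) (at x within {0..T})"
        by (auto intro!: derivative_eq_intros simp: inverse_eq_divide)
      then show "(arctan has_vector_derivative 1 / (1 + x\<^sup>2)) (at x within {0..T})"
        by (simp add: has_real_derivative_iff_has_vector_derivative)
    qed
    have "cmod (integral {0..T} (\<lambda>t. poly q (of_real t) * exp (- (of_real t * z)))) \<le> integral {0..T} (\<lambda>t. B * (1 / (1 + t\<^sup>2)))"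
    proof (rule integral_norm_bound_integral)
      show "(\<lambda>t. poly q (of_real t) * exp (- (of_real t * z))) integrable_on {0..T}"
        by (intro integrable_continuous_real continuous_intros)
      show "(\<lambda>t. B * (1 / (1 + t\<^sup>2))) integrable_on {0..T}" using i by blast
      fix t assume "t \<in> {0..T}"
      then show "cmod (poly q (of_real t) * exp (- (of_real t * z))) \<le> B * (1 / (1 + t\<^sup>2))"
        using B[of t] by (simp add: norm_mult)
    qed
    also have "\<dots> = B * arctan T" using integral_unique[OF i] by simp
    also have "\<dots> \<le> B * (pi / 2)" using arctan_ubound[of T] B0 by (intro mult_left_mono) auto
    finally show ?thesis .
  qed
  show ?thesis
    by (rule tendsto_upperbound[OF tendsto_norm[OF lim]])
       (intro eventually_mono[OF eventually_ge_at_top[of 0]] bd, auto)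
qed

text \<open>Up to sign, the same rational function is in the left half-plane the Laplace transform
  of q (- t); a bound on the real line that is even in t therefore serves both half-planes.\<close>

lemma laplace_poly_minus: "laplace_poly q (- z) = - laplace_poly (pcompose q [:0, -1:]) z"
proof -
  have c: "coeff (pcompose q [:0, -1:]) k = (-1) ^ k * coeff q k" for k
    by (simp add: coeff_pcompose_linear)
  have d: "degree (pcompose q [:0, -1:]) = degree q" by (simp add: degree_pcompose)
  show ?thesis
    unfolding laplace_poly_def d c sum_negf[symmetric]
    by (rule sum.cong) (auto simp: power_minus[of z] uminus_power_if)
qed

context majorant begin

text \<open>F is a multiple of the Laplace transform of the polynomial from
  \<open>polynomial_minorant\<close>; it is admissible because phi(t) - t |Re z| \<le> ln (M |Re
  z|). Inverting the transform on |z| = s at the point i y, where the polynomial is about exp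
  (poisson y), forces F to be large somewhere on the circle, at the price exp (y s). As the constant
  does not depend on s and y, y may be adapted to s.\<close>

lemma exact_majorant_lower:
  obtains K where "\<And>s y. 0 < s \<Longrightarrow> s < 1 \<Longrightarrow> 0 < y \<Longrightarrow> ereal (exp (poisson y - y * s - 6 * ln (1 + y) - K)) \<le> exact_majorant M s"
proof -
  obtain K where K: "\<And>y. y > 0 \<Longrightarrow> \<exists>Q :: complex poly.
    (\<forall>t. cmod (poly Q (of_real t)) \<le> exp (phi M \<bar>t\<bar> - phi M 0) / (1 + t\<^sup>2)) \<and> poly Q (\<i> * of_real y) \<noteq> 0 \<and>
    poisson y - 6 * ln (1 + y) - K \<le> ln (cmod (poly Q (\<i> * of_real y)))"
    using polynomial_minorant by blast
  \<comment> \<open>Cancels the normalisation exp (- phi M 0) and the factor pi/2 of the Laplace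
    estimate.\<close>
  define c where "c = exp (phi M 0) * (2 / pi)"
  have c: "c > 0" by (simp add: c_def)
  show ?thesis
  proof
    fix s y :: real assume s: "0 < s" "s < 1" and y: "0 < y"
    obtain Q :: "complex poly" where Q: "\<And>t. cmod (poly Q (of_real t)) \<le> exp (phi M \<bar>t\<bar> - phi M 0) / (1 + t\<^sup>2)"
      "poly Q (\<i> * of_real y) \<noteq> 0" "poisson y - 6 * ln (1 + y) - K \<le> ln (cmod (poly Q (\<i> * of_real y)))"
      using K[OF y] by blast
    have half: "cmod (laplace_poly R z) \<le> M (Re z) * exp (- phi M 0) * (pi / 2)"
      if R: "\<And>t. cmod (poly R (of_real t)) \<le> exp (phi M \<bar>t\<bar> - phi M 0) / (1 + t\<^sup>2)" and z: "0 < Re z" "Re z < 1" for R z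
    proof (rule laplace_poly_le[OF z(1)])
      fix t :: real assume t: "t \<ge> 0"
      have "cmod (poly R (of_real t)) * exp (- (t * Re z)) \<le> exp (phi M \<bar>t\<bar> - phi M 0) / (1 + t\<^sup>2) * exp (- (t * Re z))"
        using R by (intro mult_right_mono) auto
      also have "\<dots> = exp (phi M t - t * Re z) * exp (- phi M 0) / (1 + t\<^sup>2)"
        using t by (simp add: exp_diff exp_minus field_simps)
      also have "\<dots> \<le> M (Re z) * exp (- phi M 0) / (1 + t\<^sup>2)"
      proof -
        have "phi M t - t * Re z \<le> ln (M (Re z))" using phi_le[OF t z] by simp
        then have "exp (phi M t - t * Re z) \<le> M (Re z)" using pos[OF z] by (metis exp_le_cancel_iff exp_ln)
        then show ?thesis by (intro divide_right_mono mult_right_mono) auto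
      qed
      finally show "cmod (poly R (of_real t)) * exp (- (t * Re z)) \<le> M (Re z) * exp (- phi M 0) / (1 + t\<^sup>2)" .
    qed
    define F where "F = (\<lambda>z. of_real c * laplace_poly Q z)"
    have cM: "c * (M x * exp (- phi M 0) * (pi / 2)) = M x" for x by (simp add: c_def exp_minus field_simps)
    have F: "F \<in> majorized M"
      unfolding majorized_def
    proof (intro CollectI conjI ballI impI)
      have "F holomorphic_on - {0}" unfolding F_def by (intro holomorphic_intros laplace_poly_holomorphic)
      then have "F analytic_on - {0}" by (subst analytic_on_open) auto
      then show "F analytic_on punctured_square" by (rule analytic_on_subset) (auto simp: punctured_square_def)
      fix z assume z: "z \<in> punctured_square" "Re z \<noteq> 0"
      have "cmod (laplace_poly Q z) \<le> M \<bar>Re z\<bar> * exp (- phi M 0) * (pi / 2)"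
      proof (cases "Re z > 0")
        case True
        then show ?thesis using half[OF Q(1), of z] z by (auto simp: punctured_square_def unit_square_def)
      next
        case False
        have "cmod (poly (pcompose Q [:0, -1:]) (of_real t)) \<le> exp (phi M \<bar>t\<bar> - phi M 0) / (1 + t\<^sup>2)" for t
          using Q(1)[of "- t"] by (simp add: poly_pcompose)
        from half[OF this, of "- z"] have "cmod (laplace_poly (pcompose Q [:0, -1:]) (- z)) \<le> M \<bar>Re z\<bar> * exp (- phi M 0) * (pi / 2)"
          using z False by (auto simp: punctured_square_def unit_square_def)
        then show ?thesis using laplace_poly_minus[of Q "- z"] by simp
      qed
      then have "c * cmod (laplace_poly Q z) \<le> c * (M \<bar>Re z\<bar> * exp (- phi M 0) * (pi / 2))" using c by (intro mult_left_mono) auto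
      then show "cmod (F z) \<le> M \<bar>Re z\<bar>" unfolding cM using c by (simp add: F_def norm_mult)
    qed
    have "exact_majorant M s \<ge> ereal (exp (poisson y - y * s - 6 * ln (1 + y) - (K - ln c)))"
    proof (cases "exact_majorant M s = \<infinity>")
      case False
      have up: "ereal (cmod (F z)) \<le> exact_majorant M s" if "cmod z = s" for z
        unfolding exact_majorant_def by (intro SUP_upper2[OF F] SUP_upper) (use that in auto)
      obtain m where m: "exact_majorant M s = ereal m"
        using False up[of "of_real s"] s by (cases "exact_majorant M s") auto
      have mz: "cmod (F z) \<le> m" if "cmod z = s" for z using up[OF that] by (simp add: m)
      have m0: "m \<ge> 0" using mz[of "of_real s"] s by (simp add: order_trans[OF norm_ge_zero])
      have "((\<lambda>z. of_real c * (laplace_poly Q z * exp (\<i> * of_real y * z))) has_contour_integral of_real c * (2 * pi * \<i> * poly Q (\<i> * of_real y))) (circlepath 0 s)"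
        by (intro has_contour_integral_lmul laplace_poly_inverse s)
      then have "cmod (of_real c * (2 * pi * \<i> * poly Q (\<i> * of_real y))) \<le> (m * exp (y * s)) * (2 * pi * s)"
      proof (rule has_contour_integral_bound_circlepath)
        fix z :: complex assume "cmod (z - 0) = s"
        then have z: "cmod z = s" by simp
        have "Re (\<i> * of_real y * z) \<le> y * s"
          using complex_Re_le_cmod[of "\<i> * of_real y * z"] y z by (simp add: norm_mult)
        then have "cmod (F z) * exp (Re (\<i> * of_real y * z)) \<le> m * exp (y * s)" using mz[OF z] m0 by (intro mult_mono) auto
        then show "cmod (of_real c * (laplace_poly Q z * exp (\<i> * of_real y * z))) \<le> m * exp (y * s)"
          by (simp add: F_def norm_mult mult.assoc)
      qed (use m0 s in auto)
      then have "2 * pi * (c * cmod (poly Q (\<i> * of_real y))) \<le> 2 * pi * (m * exp (y * s) * s)"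
        using c by (simp add: norm_mult mult_ac)
      then have 1: "c * cmod (poly Q (\<i> * of_real y)) \<le> m * exp (y * s) * s" by (simp only: mult_le_cancel_left_pos pi_gt_zero zero_less_numeral mult_pos_pos)
      also have "\<dots> \<le> m * exp (y * s) * 1" using m0 s by (intro mult_left_mono) auto
      finally have 2: "c * cmod (poly Q (\<i> * of_real y)) \<le> m * exp (y * s)" by simp
      have "exp (poisson y - 6 * ln (1 + y) - K) \<le> exp (ln (cmod (poly Q (\<i> * of_real y))))" using Q(3) by (subst exp_le_cancel_iff)
      then have "exp (poisson y - 6 * ln (1 + y) - K) \<le> cmod (poly Q (\<i> * of_real y))" using Q(2) by simp
      then have "c * exp (poisson y - 6 * ln (1 + y) - K) \<le> m * exp (y * s)" using 2 c by (meson mult_left_mono less_imp_le order_trans)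
      then have "c * exp (poisson y - 6 * ln (1 + y) - K) / exp (y * s) \<le> m" by (simp add: divide_le_eq)
      also have "c * exp (poisson y - 6 * ln (1 + y) - K) / exp (y * s) = exp (poisson y - y * s - 6 * ln (1 + y) - (K - ln c))"
      proof -
        have e: "poisson y - y * s - 6 * ln (1 + y) - (K - ln c) = ln c + (poisson y - 6 * ln (1 + y) - K) - y * s" by simp
        show ?thesis unfolding e exp_diff[of _ "y * s"] exp_add using c by simp
      qed
      finally show ?thesis by (simp add: m)
    qed simp
    then show "ereal (exp (poisson y - y * s - 6 * ln (1 + y) - (K - ln c))) \<le> exact_majorant M s" .
  qed
qed

text \<open>The two bounds differ from \<open>legendre s\<close> by ln Y and by 6 ln (1 + y), up to
  constants. Both points satisfy the inequality s Y \<le> poisson Y of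
  \<open>legendre_dominates_log\<close>, so these logarithms are o(legendre s). As
  \<open>legendre s\<close> tends to infinity, the constants, among them the difference phi(0)
  between Q and \<open>legendre\<close>, disappear in the ratio.\<close>

lemma exact_majorant_asymp:
  shows "\<forall>\<^sub>F s in at_right 0. exact_majorant M s < \<infinity>"
    and "(\<lambda>s. ln (real_of_ereal (exact_majorant M s))) \<sim>[at_right 0] (\<lambda>s. real_of_ereal (Q M s))"
proof -
  obtain C s0 where up: "s0 > 0" "s0 \<le> 1/4"
    "\<And>s. 0 < s \<Longrightarrow> s < s0 \<Longrightarrow> \<exists>Y\<ge>1. poisson Y = s * Y \<and> exact_majorant M s \<le> ereal (exp (legendre s + ln Y + C))"
  proof (rule exact_majorant_upper, goal_cases)
    case (1 C s0)
    show ?case by (rule 1(1)[OF 1(2) 1(3) 1(4)])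
  qed
  obtain K where low: "\<And>s y. 0 < s \<Longrightarrow> s < 1 \<Longrightarrow> 0 < y \<Longrightarrow> ereal (exp (poisson y - y * s - 6 * ln (1 + y) - K)) \<le> exact_majorant M s"
    using exact_majorant_lower by blast
  define m where "m = (\<lambda>s. real_of_ereal (exact_majorant M s))"
  have fin: "exact_majorant M s = ereal (m s) \<and> m s > 0" if s: "0 < s" "s < s0" for s
  proof -
    have "exact_majorant M s \<noteq> \<infinity>" using up(3)[OF s] by auto
    moreover have l: "ereal (exp (poisson 1 - 1 * s - 6 * ln (1 + 1) - K)) \<le> exact_majorant M s" using s up by (intro low) auto
    ultimately show ?thesis
      by (cases "exact_majorant M s") (auto simp: m_def intro: less_le_trans[OF exp_gt_zero])
  qed
  have ev: "\<forall>\<^sub>F s in at_right 0. s \<in> {0<..<s0}" by (rule eventually_at_right_real[OF up(1)])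
  then show "\<forall>\<^sub>F s in at_right 0. exact_majorant M s < \<infinity>" by eventually_elim (use fin in auto)
  have Qr: "real_of_ereal (Q M s) = phi M 0 + legendre s" if "s > 0" for s using Q_eq[OF that] by simp
  obtain B1 where B1: "\<And>y. 0 < y \<Longrightarrow> y \<le> 1 \<Longrightarrow> poisson y \<le> B1" using poisson_bounded_near_zero[of 1] by auto
  have key: "\<forall>\<^sub>F s in at_right 0. \<bar>ln (m s) - legendre s\<bar> \<le> \<epsilon> * legendre s" if e: "\<epsilon> > 0" for \<epsilon>
  proof -
    \<comment> \<open>The largest logarithmic loss is 6 ln y; with A = 12 / \<epsilon> it takes half
      of \<epsilon> legendre s, and the constants collected in \<open>D\<close> take the other
      half.\<close>
    define A where "A = 12 / \<epsilon>"
    have A: "A > 0" using e by (simp add: A_def)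
    obtain KA where KA: "\<And>s Y. 0 < s \<Longrightarrow> 1 \<le> Y \<Longrightarrow> s * Y \<le> poisson Y \<Longrightarrow> A * ln Y \<le> legendre s + KA"
      using legendre_dominates_log by blast
    have lnY: "ln Y \<le> \<epsilon> / 12 * legendre s + \<epsilon> / 12 * KA" if "0 < s" "1 \<le> Y" "s * Y \<le> poisson Y" for s Y
    proof -
      have "\<epsilon> / 12 * (A * ln Y) \<le> \<epsilon> / 12 * (legendre s + KA)" using KA[OF that] e by (intro mult_left_mono) auto
      then show ?thesis using e by (simp add: A_def algebra_simps)
    qed
    define D where "D = \<bar>\<epsilon> * KA\<bar> + \<bar>C\<bar> + 6 * ln 2 + \<bar>K\<bar> + 1"
    have "\<forall>\<^sub>F s in at_right 0. max (2 * D / \<epsilon>) (B1 + 2) \<le> legendre s" using legendre_at_top unfolding filterlim_at_top by blast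
    with ev show ?thesis
    proof eventually_elim
      case (elim s)
      then have s: "0 < s" "s < s0" by auto
      have q: "2 * D / \<epsilon> \<le> legendre s" "B1 + 2 \<le> legendre s" using elim by auto
      have D: "D \<le> \<epsilon> / 2 * legendre s" using q(1) e by (simp add: field_simps)
      have Le: "0 \<le> \<epsilon> * legendre s" using legendre_nonneg[OF s(1)] e by simp
      obtain Y where Y: "Y \<ge> 1" "poisson Y = s * Y" "exact_majorant M s \<le> ereal (exp (legendre s + ln Y + C))" using up(3)[OF s] by blast
      have "m s \<le> exp (legendre s + ln Y + C)" using Y(3) fin[OF s] by simp
      then have "ln (m s) \<le> ln (exp (legendre s + ln Y + C))" using fin[OF s] by (subst ln_le_cancel_iff) auto
      then have "ln (m s) \<le> legendre s + ln Y + C" by simp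
      moreover have "ln Y \<le> \<epsilon> / 12 * legendre s + \<epsilon> / 12 * KA" using Y s by (intro lnY) auto
      moreover have "\<epsilon> / 12 * KA \<le> \<bar>\<epsilon> * KA\<bar>"
      proof -
        have "\<epsilon> / 12 * KA = (\<epsilon> * KA) / 12" by simp
        then show ?thesis by linarith
      qed
      moreover have "6 * ln (2::real) \<ge> 0" by simp
      ultimately have 1: "ln (m s) - legendre s \<le> \<epsilon> * legendre s" using D Le unfolding D_def by linarith
      obtain y where y: "y > 0" "legendre s - 1 < poisson y - y * s" using legendre_near_maximizer[OF s(1), of 1] by auto
      have ys: "0 < y * s" using y s by simp
      \<comment> \<open>For y < 1 the value poisson y - y s would be at most B1, which is below
        legendre s - 1.\<close>
      have y1: "y \<ge> 1"
      proof (rule ccontr)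
        assume "\<not> y \<ge> 1"
        then have "poisson y \<le> B1" using B1[of y] y by simp
        then show False using y(2) q(2) ys by linarith
      qed
      have "poisson 1 \<le> B1" using B1[of 1] by simp
      then have "B1 \<ge> 0" using poisson_nonneg[of 1] by simp
      then have "s * y \<le> poisson y" using y(2) q(2) by (simp add: mult.commute)
      then have ly: "ln y \<le> \<epsilon> / 12 * legendre s + \<epsilon> / 12 * KA" using y1 s by (intro lnY) auto
      have "ln (1 + y) \<le> ln (2 * y)" using y1 by (subst ln_le_cancel_iff) auto
      also have "\<dots> = ln 2 + ln y" using y by (simp add: ln_mult)
      finally have l1: "6 * ln (1 + y) \<le> 6 * ln 2 + 6 * ln y" by simp
      have "ereal (exp (poisson y - y * s - 6 * ln (1 + y) - K)) \<le> exact_majorant M s" using s up y by (intro low) auto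
      then have "exp (poisson y - y * s - 6 * ln (1 + y) - K) \<le> m s" using fin[OF s] by simp
      then have "poisson y - y * s - 6 * ln (1 + y) - K \<le> ln (m s)" using fin[OF s] by (simp add: ln_ge_iff)
      moreover have "6 * (\<epsilon> / 12 * KA) \<le> \<bar>\<epsilon> * KA\<bar>"
      proof -
        have "6 * (\<epsilon> / 12 * KA) = (\<epsilon> * KA) / 2" by simp
        then show ?thesis by linarith
      qed
      ultimately have 2: "legendre s - ln (m s) \<le> \<epsilon> * legendre s" using D ly l1 y(2) unfolding D_def by linarith
      show ?case using 1 2 by linarith
    qed
  qed
  have "((\<lambda>s. ln (m s) / (phi M 0 + legendre s)) \<longlongrightarrow> 1) (at_right 0)"
  proof -
    have inv: "((\<lambda>s. 1 / legendre s) \<longlongrightarrow> 0) (at_right 0)"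
      by (rule tendsto_divide_0[OF tendsto_const]) (rule filterlim_at_top_imp_at_infinity[OF legendre_at_top])
    have posL: "\<forall>\<^sub>F s in at_right 0. 1 \<le> legendre s" using legendre_at_top by (simp add: filterlim_at_top)
    have "((\<lambda>s. ln (m s) / legendre s) \<longlongrightarrow> 1) (at_right 0)"
    proof (rule tendstoI)
      fix e :: real assume e: "e > 0"
      from key[of "e/2"] e posL have "\<forall>\<^sub>F s in at_right 0. \<bar>ln (m s) - legendre s\<bar> \<le> e/2 * legendre s \<and> 1 \<le> legendre s"
        by (intro eventually_conj) auto
      then show "\<forall>\<^sub>F s in at_right 0. dist (ln (m s) / legendre s) 1 < e"
      proof eventually_elim
        case (elim s)
        then have L: "legendre s > 0" by simp
        have "\<bar>ln (m s) / legendre s - 1\<bar> = \<bar>ln (m s) - legendre s\<bar> / legendre s"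
        proof -
          have e: "ln (m s) / legendre s - 1 = (ln (m s) - legendre s) / legendre s" using L by (simp add: diff_divide_distrib)
          show ?thesis unfolding e abs_divide using L by simp
        qed
        also have "\<dots> \<le> e/2" using elim L by (simp add: divide_le_eq)
        also have "\<dots> < e" using e by simp
        finally show ?case by (simp add: dist_real_def)
      qed
    qed
    moreover have "((\<lambda>s. phi M 0 * (1 / legendre s) + 1) \<longlongrightarrow> phi M 0 * 0 + 1) (at_right 0)" by (intro tendsto_intros inv)
    ultimately have "((\<lambda>s. ln (m s) / legendre s / (phi M 0 * (1 / legendre s) + 1)) \<longlongrightarrow> 1 / (phi M 0 * 0 + 1)) (at_right 0)"
      by (intro tendsto_divide) auto
    then have "((\<lambda>s. ln (m s) / legendre s / (phi M 0 * (1 / legendre s) + 1)) \<longlongrightarrow> 1) (at_right 0)" by simp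
    then show ?thesis
    proof (rule Lim_transform_eventually)
      show "\<forall>\<^sub>F s in at_right 0. ln (m s) / legendre s / (phi M 0 * (1 / legendre s) + 1) = ln (m s) / (phi M 0 + legendre s)"
        using posL
      proof eventually_elim
        case (elim s)
        then have "phi M 0 * (1 / legendre s) + 1 = (phi M 0 + legendre s) / legendre s" by (simp add: add_divide_distrib)
        then show ?case using elim by simp
      qed
    qed
  qed
  then have "((\<lambda>s. ln (m s) / real_of_ereal (Q M s)) \<longlongrightarrow> 1) (at_right 0)"
    by (rule Lim_transform_eventually) (use ev in \<open>eventually_elim, simp add: Qr\<close>)
  then show "(\<lambda>s. ln (real_of_ereal (exact_majorant M s))) \<sim>[at_right 0] (\<lambda>s. real_of_ereal (Q M s))"
    unfolding m_def by (rule asymp_equivI')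
qed

end

theorem theorem2p3:
  fixes M :: "real \<Rightarrow> real"
  assumes pos: "\<And>\<xi>. 0 < \<xi> \<Longrightarrow> \<xi> < 1 \<Longrightarrow> 0 < M \<xi>"
    and nonincreasing: "antimono_on {0<..<1} M"
    and loglog: "loglog_integrable_at_0 M"
    and growth: "\<And>N::real. filterlim (\<lambda>\<xi>. \<xi> powr N * M \<xi>) at_top (at_right 0)"
    and convex_exp: "convex_on {0<..} (\<lambda>s. ln (M (exp (- s))))"
    and convex: "convex_on {0<..<1} (\<lambda>\<xi>. ln (M \<xi>))"
  shows "(\<forall>\<^sub>F s in at_right 0. exact_majorant M s < \<infinity>) \<and>
    (\<forall>y>0. set_integrable lborel {0..} (\<lambda>t. phi M t / (t\<^sup>2 + y\<^sup>2))) \<and>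
    (\<forall>s>0. Q M s < \<infinity>) \<and>
    (\<lambda>s. ln (real_of_ereal (exact_majorant M s))) \<sim>[at_right 0] (\<lambda>s. real_of_ereal (Q M s))"
proof -
  interpret majorant M by unfold_locales (fact assms)+
  show ?thesis
    using exact_majorant_asymp phi_quotient_integrable(1) Q_eq by auto
qed

end
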